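(* Let $m,n\ge 1$ be integers and let $\pi$ be a partition of $\{1,\dots,m+n\}$ such that every component of $\pi$ has at least $n+1$ elements. Let $\psi:\mathbb{N}\to(0,\infty)$ be a function such that $x\mapsto x^{m-1}\psi(x)^n$ is non-increasing on $\mathbb{N}$. If $\sum_{j\ge 1} j^{m-1}\psi(j)^n=\infty$, then for every $\mathbf{y}\in\mathbb{R}^n$ and for almost every matrix $X=(\Theta,\Phi)\in \mathrm{Mat}_{n,m+n}(\mathbb{R})$ there exist infinitely many points $(\mathbf{q},\mathbf{p})^t\in P(\pi)$, with $\mathbf{q}\in\mathbb{Z}^m\setminus\{0\}$ and $\mathbf{p}\in\mathbb{Z}^n$, such that $$|\Theta\mathbf{q}+\Phi\mathbf{p}-\mathbf{y}|\le\psi(|\mathbf{q}|).$$ Conversely, if $\sum_{j\ge 1} j^{m-1}\psi(j)^n<\infty$, then for every $\mathbf{y}\in\mathbb{R}^n$ and for almost every $X=(\Theta,\Phi)\in \mathrm{Mat}_{n,m+n}(\mathbb{R})$ there exist only finitely many $(\mathbf{q},\mathbf{p})^t\in\mathbb{Z}^{m+n}$, with $\mathbf{q}\in\mathbb{Z}^m\setminus\{0\}$, $\mathbf{p}\in\mathbb{Z}^n$, satisfying $|\Theta\mathbf{q}+\Phi\mathbf{p}-\mathbf{y}|\le\psi(|\mathbf{q}|)$.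
   Context: $\mathbb{N}=\{1,2,\dots\}$. $\mathrm{Mat}_{n,m}(\mathbb{R})$ is the space of real $n\times m$ matrices; a matrix $X\in\mathrm{Mat}_{n,m+n}(\mathbb{R})$ is written $X=(\Theta,\Phi)$ with $\Theta\in\mathrm{Mat}_{n,m}(\mathbb{R})$ (first $m$ columns) and $\Phi\in\mathrm{Mat}_{n,n}(\mathbb{R})$ (last $n$ columns). Vectors are columns, and $(\mathbf{q},\mathbf{p})^t\in\mathbb{R}^{m+n}$ denotes the column vector obtained by stacking $\mathbf{q}\in\mathbb{R}^m$ above $\mathbf{p}\in\mathbb{R}^n$. $|\cdot|$ is the supremum norm. "Almost every" refers to Lebesgue measure. For a partition $\pi$ of $\{1,\dots,d\}$ whose components $\pi_1,\dots,\pi_k$ each have at least two elements, $P(\pi)$ is the set of $\mathbf{v}=(v_1,\dots,v_d)^t\in\mathbb{Z}^d$ such that for every component $\pi_j$ one has $\gcd(v_i : i\in\pi_j)=1$. *)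

theory Defs
  imports "HOL-Analysis.Analysis" "HOL-Library.Disjoint_Sets"
begin

text \<open>
  The dimensions are \<open>m = CARD('m)\<close> and \<open>n = CARD('n)\<close>, and the index set
  \<open>{1,\<dots>,m+n}\<close> is the sum type \<^typ>\<open>'m + 'n\<close>: \<^const>\<open>Inl\<close> gives the first \<open>m\<close> indices
  and \<^const>\<open>Inr\<close> the last \<open>n\<close>. In \<^typ>\<open>'a ^ 'c ^ 'r\<close> the outer index \<open>'r\<close> is the row.
\<close>

definition Theta :: "'a ^ ('m::finite + 'n::finite) ^ 'n \<Rightarrow> 'a ^ 'm ^ 'n" where
  "Theta X = (\<chi> i j. X $ i $ Inl j)"

definition Phi :: "'a ^ ('m::finite + 'n::finite) ^ 'n \<Rightarrow> 'a ^ 'n ^ 'n" where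
  "Phi X = (\<chi> i j. X $ i $ Inr j)"

definition stack :: "'a ^ 'm::finite \<Rightarrow> 'a ^ 'n::finite \<Rightarrow> 'a ^ ('m + 'n)" where
  "stack q p = (\<chi> k. case k of Inl i \<Rightarrow> q $ i | Inr j \<Rightarrow> p $ j)"

definition real_vec :: "int ^ 'k::finite \<Rightarrow> real ^ 'k" where
  "real_vec v = (\<chi> i. real_of_int (v $ i))"

text \<open>The supremum norm of an integer vector, as a natural number so that it can be an
  argument of \<open>\<psi>\<close>; on real vectors the supremum norm is \<^const>\<open>infnorm\<close>.\<close>

definition int_supnorm :: "int ^ 'k::finite \<Rightarrow> nat" where
  "int_supnorm v = Max (range (\<lambda>i. nat \<bar>v $ i\<bar>))"

lemma real_int_supnorm: "real (int_supnorm v) = infnorm (real_vec v)"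
proof -
  have "infnorm (real_vec v) = Max (range (\<lambda>i. \<bar>real_of_int (v $ i)\<bar>))"
    unfolding infnorm_cart by (subst cSup_eq_Max) (auto simp: real_vec_def full_SetCompr_eq)
  also have "range (\<lambda>i. \<bar>real_of_int (v $ i)\<bar>) = real ` range (\<lambda>i. nat \<bar>v $ i\<bar>)"
    by (simp add: image_image)
  also have "Max \<dots> = real (int_supnorm v)"
    unfolding int_supnorm_def
    by (rule mono_Max_commute[symmetric]) (auto simp: mono_def)
  finally show ?thesis by simp
qed

definition partition_points :: "'k::finite set set \<Rightarrow> (int ^ 'k) set" where
  "partition_points \<pi> = {v. \<forall>B\<in>\<pi>. Gcd ((\<lambda>i. v $ i) ` B) = 1}"

end

theory Submission
  imports Defs
begin

text \<open>
  \<^bold>\<open>Divergence.\<close> It suffices to find solutions \<open>(q, p)\<close> in which \<open>q\<close> runs through a set of positive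
  density and all entries are coprime to a leading entry of their block that has few prime factors.
  Multiplication by \<open>\<Phi>\<close> reduces to \<open>\<Phi> = 1\<close>. Dropping the coprimality, the sets of \<open>X\<close> for which
  \<open>X u\<close> is close to an integer vector are exactly pairwise independent modulo 1 for pairwise
  linearly independent integer vectors \<open>u\<close>. This gives the upper bound in the second moment method,
  and since the variance of the counting function is then of smaller order than the square of its
  mean, also on small cells; the lower bound for the first moment with coprimality is a
  count in one variable. Hence the limsup set has density bounded below in every dyadic cell and is
  conull. For \<open>y = 0\<close> and \<open>m \<ge> 2\<close> take \<open>u = q\<close>, which is primitive. For \<open>y \<noteq> 0\<close> take \<open>u = (q, -1)\<close>,
  which treats the target as a further random column; one good target yields all the others by
  left multiplication with an invertible matrix. For \<open>y = 0\<close> and \<open>m = 1\<close> all the \<open>q\<close> are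
  parallel, and the overlaps are bounded by counting the non-zero values of \<open>t q' - t' q\<close>.

  \<^bold>\<open>Convergence.\<close> Borel-Cantelli, once \<open>\<Phi>\<close> is invertible and hence \<open>|p|\<close> is bounded by a multiple of \<open>|q|\<close>.
\<close>

section \<open>Dyadic cells and a local Borel-Cantelli lemma\<close>

text \<open>Coprimality destroys the independence of the approximation events. Therefore overlaps
  are bounded above after coprimality has been dropped, and means are bounded below with coprimality
  kept. The two bounds match up to a constant only if a fixed proportion of integers is coprime to
  the modulus, uniformly in the modulus; hence the restriction to leading entries whose odd prime
  divisors have reciprocals summing to at most 3/4. No zero-one law enters: a lower bound for the
  density that is the same in all dyadic cells already forces full measure. Every block needs a
  leader among the q-indices, and for m >= 2 some q-index must not lead; both come from the size
  bound n + 1, because only n indices belong to p. The target y = 0 stands apart because an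
  invertible matrix cannot move a nonzero target to 0, and m = 1 then leaves no second column to
  make vectors independent. Left multiplication distorts the sup norm, so divergence is proved for
  all \<psi>/k at once.\<close>

definition cell :: "nat \<Rightarrow> 'a::euclidean_space \<Rightarrow> 'a set" where
  "cell j x = {y. \<forall>b\<in>Basis. \<lfloor>2 ^ j * (y \<bullet> b)\<rfloor> = \<lfloor>2 ^ j * (x \<bullet> b)\<rfloor>}"

lemma mem_cell_self [simp]: "x \<in> cell j x"
  by (simp add: cell_def)

lemma cell_eq: "y \<in> cell j x \<Longrightarrow> cell j y = cell j x"
  by (auto simp: cell_def)

lemma emeasure_lborel_product:
  assumes [measurable]: "\<And>b. b \<in> Basis \<Longrightarrow> S b \<in> sets lborel"
  shows "emeasure lborel {x::'a::euclidean_space. \<forall>b\<in>Basis. x \<bullet> b \<in> S b}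
       = (\<Prod>b\<in>Basis. emeasure lborel (S b))"
proof -
  have meas: "{x::'a. \<forall>b\<in>Basis. x \<bullet> b \<in> S b} \<in> sets lborel" (is "?A \<in> _") by measurable
  have "emeasure lborel ?A = (\<integral>\<^sup>+x. indicator ?A x \<partial>lborel)"
    using meas by simp
  also have "\<dots> = (\<integral>\<^sup>+x. (\<Prod>b\<in>Basis. indicator (S b) (x \<bullet> b)) \<partial>(lborel :: 'a measure))"
  proof (rule nn_integral_cong)
    fix x :: 'a
    show "indicator ?A x = (\<Prod>b\<in>Basis. indicator (S b) (x \<bullet> b) :: ennreal)"
    proof (cases "x \<in> ?A")
      case False
      then obtain b where "b \<in> Basis" "x \<bullet> b \<notin> S b" by auto
      then have "(\<Prod>b\<in>Basis. indicator (S b) (x \<bullet> b) :: ennreal) = 0"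
        by (intro prod_zero) (auto intro!: bexI[of _ b])
      then show ?thesis using False by simp
    qed (auto intro!: prod.neutral[symmetric])
  qed
  also have "\<dots> = (\<Prod>b\<in>Basis. \<integral>\<^sup>+x. indicator (S b) x \<partial>lborel)"
    by (rule nn_integral_lborel_prod) auto
  also have "\<dots> = (\<Prod>b\<in>Basis. emeasure lborel (S b))"
    using assms by (intro prod.cong) (auto intro!: nn_integral_indicator)
  finally show ?thesis .
qed

lemma floor_eq_interval:
  "{t::real. \<lfloor>2 ^ j * t\<rfloor> = i} = {of_int i / 2 ^ j ..< (of_int i + 1) / 2 ^ j}"
  by (auto simp: floor_eq_iff field_simps)

lemma cell_interval:
  "cell j x = {y. \<forall>b\<in>Basis. y \<bullet> b \<in> {\<lfloor>2 ^ j * (x \<bullet> b)\<rfloor> / 2 ^ j ..< (\<lfloor>2 ^ j * (x \<bullet> b)\<rfloor> + 1) / 2 ^ j}}"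
proof -
  have "(y \<bullet> b \<in> {\<lfloor>2 ^ j * (x \<bullet> b)\<rfloor> / 2 ^ j ..< (\<lfloor>2 ^ j * (x \<bullet> b)\<rfloor> + 1) / 2 ^ j})
    \<longleftrightarrow> \<lfloor>2 ^ j * (y \<bullet> b)\<rfloor> = \<lfloor>2 ^ j * (x \<bullet> b)\<rfloor>" for y b
    using floor_eq_interval[of j "\<lfloor>2 ^ j * (x \<bullet> b)\<rfloor>"] by (auto simp: set_eq_iff)
  then show ?thesis unfolding cell_def by simp
qed

lemma cell_measurable [measurable, simp]: "cell j x \<in> sets lborel"
  unfolding cell_def by measurable

lemma cell_borel [measurable, simp]: "cell j x \<in> sets borel"
  using cell_measurable by simp

lemma emeasure_cell:
  "emeasure lborel (cell j (x::'a::euclidean_space)) = ennreal ((1 / 2 ^ j) ^ DIM('a))"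
proof -
  have "emeasure lborel (cell j x) = (\<Prod>b\<in>(Basis::'a set). ennreal (1 / 2 ^ j))"
    unfolding cell_interval
    by (subst emeasure_lborel_product) (auto intro!: prod.cong simp: field_simps)
  then show ?thesis by (simp add: ennreal_power)
qed

lemma measure_cell: "measure lborel (cell j (x::'a::euclidean_space)) = (1 / 2 ^ j) ^ DIM('a)"
  by (simp add: measure_def emeasure_cell)

lemma cell_Suc_subset: "cell (Suc j) x \<subseteq> cell j x"
proof
  fix y assume y: "y \<in> cell (Suc j) x"
  have "\<lfloor>2 ^ j * (y \<bullet> b)\<rfloor> = \<lfloor>2 ^ j * (x \<bullet> b)\<rfloor>" if b: "b \<in> Basis" for b
  proof -
    have "\<lfloor>2 * (2 ^ j * (y \<bullet> b))\<rfloor> = \<lfloor>2 * (2 ^ j * (x \<bullet> b))\<rfloor>"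
      using y b by (auto simp: cell_def mult.assoc)
    moreover have "\<lfloor>2 * t\<rfloor> = \<lfloor>2 * s\<rfloor> \<Longrightarrow> \<lfloor>t\<rfloor> = \<lfloor>s\<rfloor>" for s t :: real
      using floor_divide_real_eq_div[of 2 "2 * t"] floor_divide_real_eq_div[of 2 "2 * s"] by simp
    ultimately show ?thesis by blast
  qed
  then show "y \<in> cell j x" by (simp add: cell_def)
qed

lemma countable_cells: "countable (range (cell j :: 'a::euclidean_space \<Rightarrow> 'a set))"
proof -
  have "range (cell j) \<subseteq> (\<lambda>f. {y::'a. \<forall>b\<in>Basis. \<lfloor>2 ^ j * (y \<bullet> b)\<rfloor> = f b}) ` (Basis \<rightarrow>\<^sub>E (UNIV :: int set))"
  proof safe
    fix x :: 'a
    show "cell j x \<in> (\<lambda>f. {y. \<forall>b\<in>Basis. \<lfloor>2 ^ j * (y \<bullet> b)\<rfloor> = f b}) ` (Basis \<rightarrow>\<^sub>E (UNIV :: int set))"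
      by (rule image_eqI[where x = "restrict (\<lambda>b. \<lfloor>2 ^ j * (x \<bullet> b)\<rfloor>) Basis"]) (auto simp: cell_def)
  qed
  then show ?thesis
    by (rule countable_subset) (intro countable_image countable_PiE, auto)
qed

lemma cell_subset_ball:
  assumes "e > 0"
  obtains j where "cell j (x::'a::euclidean_space) \<subseteq> ball x e"
proof -
  obtain j where j: "(1/2) ^ j < e / real DIM('a)"
    using assms real_arch_pow_inv[of "e / real DIM('a)" "1/2"] by auto
  have "cell j x \<subseteq> ball x e"
  proof
    fix y assume y: "y \<in> cell j x"
    have *: "\<bar>(y - x) \<bullet> b\<bar> < e / real DIM('a)" if b: "b \<in> Basis" for b
    proof -
      have "\<lfloor>2 ^ j * (y \<bullet> b)\<rfloor> = \<lfloor>2 ^ j * (x \<bullet> b)\<rfloor>" using y b by (auto simp: cell_def)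
      then have "\<bar>2 ^ j * (y \<bullet> b) - 2 ^ j * (x \<bullet> b)\<bar> < 1" by linarith
      also have "2 ^ j * (y \<bullet> b) - 2 ^ j * (x \<bullet> b) = 2 ^ j * ((y - x) \<bullet> b)"
        by (simp add: algebra_simps inner_diff_left)
      finally have "\<bar>(y - x) \<bullet> b\<bar> < (1/2) ^ j"
        by (simp add: abs_mult field_simps)
      with j show ?thesis by simp
    qed
    have "norm (y - x) \<le> (\<Sum>b\<in>Basis. \<bar>(y - x) \<bullet> b\<bar>)" by (rule norm_le_l1)
    also have "\<dots> < (\<Sum>b\<in>(Basis::'a set). e / real DIM('a))"
      using * by (intro sum_strict_mono) auto
    finally show "y \<in> ball x e" by (simp add: dist_norm norm_minus_commute)
  qed
  then show ?thesis by (rule that)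
qed

text \<open>Cells of one level are equal or disjoint and there are countably many of them, so the
  bound in a single cell adds up.\<close>

lemma emeasure_union_of_cells_lower:
  fixes W :: "'a::euclidean_space set"
  assumes W [measurable]: "W \<in> sets lborel"
    and dens: "\<And>x. c * emeasure lborel (cell j x) \<le> emeasure lborel (cell j x \<inter> W)"
    and S: "S \<subseteq> range (cell j)"
  shows "c * emeasure lborel (\<Union>S) \<le> emeasure lborel (\<Union>S \<inter> W)"
proof -
  have cnt: "countable S" using S countable_cells by (rule countable_subset)
  have ms: "\<And>Q. Q \<in> S \<Longrightarrow> Q \<in> sets lborel" using S by auto
  have disj: "disjoint_family_on (\<lambda>Q. Q) S"
    unfolding disjoint_family_on_def using S cell_eq by blast
  have disj': "disjoint_family_on (\<lambda>Q. Q \<inter> W) S"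
    using disj unfolding disjoint_family_on_def by blast
  have "c * emeasure lborel (\<Union>S) = (\<integral>\<^sup>+Q. c * emeasure lborel Q \<partial>count_space S)"
    using emeasure_UN_countable[OF ms cnt disj] by (simp add: nn_integral_cmult)
  also have "\<dots> \<le> (\<integral>\<^sup>+Q. emeasure lborel (Q \<inter> W) \<partial>count_space S)"
    using dens S by (intro nn_integral_mono) auto
  also have "\<dots> = emeasure lborel (\<Union>Q\<in>S. Q \<inter> W)"
    using ms by (intro emeasure_UN_countable[symmetric] cnt disj') auto
  also have "(\<Union>Q\<in>S. Q \<inter> W) = \<Union>S \<inter> W" by auto
  finally show ?thesis .
qed

text \<open>A substitute for the Lebesgue density theorem.\<close>

lemma null_of_uniform_density:
  fixes W :: "'a::euclidean_space set"
  assumes W [measurable]: "W \<in> sets lborel" and c: "c > 0"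
    and dens: "\<And>j x. ennreal c * emeasure lborel (cell j x) \<le> emeasure lborel (cell j x \<inter> W)"
  shows "emeasure lborel (- W) = 0"
proof -
  have sub: "- W = (\<Union>Q\<in>range (cell 0). Q - W)"
    using mem_cell_self by blast
  have "emeasure lborel (cell 0 x - W) = 0" for x
  proof (rule ccontr)
    assume nz: "emeasure lborel (cell 0 x - W) \<noteq> 0"
    define z where "z = measure lborel (cell 0 x - W)"
    have "emeasure lborel (cell 0 x - W) \<le> emeasure lborel (cell 0 x)"
      by (intro emeasure_mono) auto
    then have fin: "emeasure lborel (cell 0 x - W) \<noteq> \<infinity>"
      by (auto simp: emeasure_cell top_unique)
    then have z: "emeasure lborel (cell 0 x - W) = ennreal z"
      by (simp add: z_def emeasure_eq_ennreal_measure)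
    with nz have "z > 0" by (metis ennreal_eq_0_iff not_le)
    have "cell 0 x - W \<in> sets borel" using W by auto
    \<comment> \<open>With an excess below c z, the set W fills less than c z of U, while its
      density in the cells inside U forces at least c times the measure of U, which is at least
      z.\<close>
    from outer_regular_lborel[OF this, of "c * z"]
    obtain U where U: "open U" "cell 0 x - W \<subseteq> U"
      "emeasure lborel (U - (cell 0 x - W)) < ennreal (c * z)"
      using c \<open>z > 0\<close> by auto
    \<comment> \<open>The cells of level j inside U increase to U, since every point of an open set
      has a small cell around it inside the set.\<close>
    define V where "V j = \<Union>{Q \<in> range (cell j). Q \<subseteq> U}" for j
    have V: "V j = {x. cell j x \<subseteq> U}" for j
    proof -
      have "x \<in> V j \<longleftrightarrow> cell j x \<subseteq> U" for x
        unfolding V_def by (auto dest: cell_eq intro!: exI[of _ x])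
      then show ?thesis by auto
    qed
    have Vm [measurable]: "V j \<in> sets lborel" for j
      unfolding V_def using countable_cells
      by (intro sets.countable_Union) (auto intro: countable_subset)
    have inc: "incseq V"
      unfolding V using cell_Suc_subset by (intro incseq_SucI) blast
    have UN: "(\<Union>j. V j) = U"
    proof
      show "(\<Union>j. V j) \<subseteq> U" unfolding V_def by auto
      show "U \<subseteq> (\<Union>j. V j)"
      proof
        fix y assume "y \<in> U"
        then obtain e where "e > 0" "ball y e \<subseteq> U" using U(1) open_contains_ball by blast
        moreover obtain j where "cell j y \<subseteq> ball y e" using cell_subset_ball[OF \<open>e > 0\<close>] by blast
        ultimately show "y \<in> (\<Union>j. V j)" unfolding V by blast
      qed
    qed
    have Um [measurable]: "U \<in> sets lborel" using U(1) by auto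
    have "ennreal c * emeasure lborel U = (SUP j. ennreal c * emeasure lborel (V j))"
    proof -
      have "(SUP j. emeasure lborel (V j)) = emeasure lborel (\<Union>j. V j)"
        using inc Vm by (intro SUP_emeasure_incseq) auto
      then show ?thesis unfolding UN SUP_mult_left_ennreal[symmetric] by simp
    qed
    also have "\<dots> \<le> emeasure lborel (U \<inter> W)"
    proof (rule SUP_least)
      fix j
      have "ennreal c * emeasure lborel (V j) \<le> emeasure lborel (V j \<inter> W)"
        unfolding V_def by (intro emeasure_union_of_cells_lower W dens) auto
      also have "\<dots> \<le> emeasure lborel (U \<inter> W)"
        using UN by (intro emeasure_mono) auto
      finally show "ennreal c * emeasure lborel (V j) \<le> emeasure lborel (U \<inter> W)" .
    qed
    also have "\<dots> \<le> emeasure lborel (U - (cell 0 x - W))"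
    proof (rule emeasure_mono)
      show "U - (cell 0 x - W) \<in> sets lborel" using W Um by (intro sets.Diff cell_measurable)
    qed auto
    also have "\<dots> < ennreal c * ennreal z"
      using U(3) c \<open>z > 0\<close> by (simp add: ennreal_mult)
    also have "\<dots> \<le> ennreal c * emeasure lborel U"
      unfolding z[symmetric] using U(1,2) by (intro mult_left_mono emeasure_mono) auto
    finally show False by simp
  qed
  then have "(\<Union>Q\<in>range (cell 0). Q - W) \<in> null_sets lborel"
    using W by (intro null_sets_UN' countable_cells null_setsI sets.Diff) auto
  then show ?thesis using sub by auto
qed

text \<open>The integral of \<open>(f - L)\<^sup>2\<close> over \<open>B\<close>, where \<open>f\<close> counts the sets \<open>A u\<close> containing a point.\<close>

definition quadratic_moment :: "'a measure \<Rightarrow> ('i \<Rightarrow> 'a set) \<Rightarrow> 'i set \<Rightarrow> real \<Rightarrow> 'a set \<Rightarrow> real" where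
  "quadratic_moment M A F L B = (\<Sum>u\<in>F. \<Sum>v\<in>F. measure M (A u \<inter> A v \<inter> B))
     - 2 * L * (\<Sum>u\<in>F. measure M (A u \<inter> B)) + L\<^sup>2 * measure M B"

text \<open>The quadratic moment is the integral of a square, hence nonnegative and increasing in
  the domain. This carries a variance bound from a unit cell to its subcells.\<close>

lemma quadratic_moment_mono:
  fixes A :: "'i \<Rightarrow> 'a set" and M :: "'a measure"
  assumes F: "finite F" and A [measurable]: "\<And>u. u \<in> F \<Longrightarrow> A u \<in> sets M"
    and B [measurable]: "B \<in> sets M" and Q [measurable]: "Q \<in> sets M" and sub: "B \<subseteq> Q"
    and fin: "emeasure M Q < \<infinity>"
  shows "0 \<le> quadratic_moment M A F L B" "quadratic_moment M A F L B \<le> quadratic_moment M A F L Q"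
proof -
  define f where "f x = (\<Sum>u\<in>F. indicator (A u) x :: real)" for x
  have *: "integrable M (\<lambda>x. indicator S x * (f x - L)\<^sup>2)"
    "(\<integral>x. indicator S x * (f x - L)\<^sup>2 \<partial>M) = quadratic_moment M A F L S"
    if S [measurable]: "S \<in> sets M" and "S \<subseteq> Q" for S
  proof -
    have ii: "integrable M (indicator E :: 'a \<Rightarrow> real)" if "E \<subseteq> S" "E \<in> sets M" for E
    proof (intro integrable_real_indicator that)
      have "emeasure M E \<le> emeasure M Q" using that(1) \<open>S \<subseteq> Q\<close> by (intro emeasure_mono) auto
      then show "emeasure M E < \<infinity>" using fin by (rule le_less_trans)
    qed
    have i: "integrable M (indicator (A u \<inter> S) :: 'a \<Rightarrow> real)" "integrable M (indicator S :: 'a \<Rightarrow> real)"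
      "v \<in> F \<Longrightarrow> integrable M (indicator (A u \<inter> A v \<inter> S) :: 'a \<Rightarrow> real)" if "u \<in> F" for u v
      using that by (intro ii; auto)+
    have iS: "integrable M (indicator S :: 'a \<Rightarrow> real)" by (intro ii) auto
    have eq: "(\<lambda>x. indicator S x * (f x - L)\<^sup>2) = (\<lambda>x. (\<Sum>u\<in>F. \<Sum>v\<in>F. indicator (A u \<inter> A v \<inter> S) x)
      - 2 * L * (\<Sum>u\<in>F. indicator (A u \<inter> S) x) + L\<^sup>2 * indicator S x)"
    proof
      fix x
      have "(\<Sum>u\<in>F. \<Sum>v\<in>F. indicator (A u \<inter> A v \<inter> S) x) = indicator S x * (f x)\<^sup>2"
        unfolding f_def power2_eq_square sum_product sum_distrib_left
        by (intro sum.cong refl) (auto simp: indicator_def)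
      moreover have "(\<Sum>u\<in>F. indicator (A u \<inter> S) x) = indicator S x * f x"
        unfolding f_def sum_distrib_left by (intro sum.cong refl) (auto simp: indicator_def)
      ultimately show "indicator S x * (f x - L)\<^sup>2 = (\<Sum>u\<in>F. \<Sum>v\<in>F. indicator (A u \<inter> A v \<inter> S) x)
        - 2 * L * (\<Sum>u\<in>F. indicator (A u \<inter> S) x) + L\<^sup>2 * indicator S x"
        by (simp add: power2_diff algebra_simps)
    qed
    show "integrable M (\<lambda>x. indicator S x * (f x - L)\<^sup>2)"
      unfolding eq using i iS by (auto intro!: integrable_add integrable_diff integrable_sum integrable_mult_right)
    show "(\<integral>x. indicator S x * (f x - L)\<^sup>2 \<partial>M) = quadratic_moment M A F L S"
      unfolding eq quadratic_moment_def using i iS A S by (simp add: sets.Int_space_eq2)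
  qed
  show "0 \<le> quadratic_moment M A F L B"
    unfolding *(2)[OF B sub, symmetric] by simp
  show "quadratic_moment M A F L B \<le> quadratic_moment M A F L Q"
    unfolding *(2)[OF B sub, symmetric] *(2)[OF Q subset_refl, symmetric]
    using sub by (intro integral_mono * mult_right_mono) (auto simp: indicator_def)
qed

text \<open>Nonnegativity of the integral of (f - L)^2 over the part T of B covered by the sets; f
  vanishes on the rest of B, so its first two moments do not notice the restriction to T. The free
  parameter L replaces the Cauchy-Schwarz quotient and avoids dividing by the second moment.\<close>

lemma second_moment_bound:
  fixes A :: "'i \<Rightarrow> 'a set" and M :: "'a measure"
  assumes F: "finite F" and A: "\<And>u. u \<in> F \<Longrightarrow> A u \<in> sets M"
    and B: "B \<in> sets M" and fin: "emeasure M B < \<infinity>"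
  shows "2 * L * (\<Sum>u\<in>F. measure M (A u \<inter> B)) - (\<Sum>u\<in>F. \<Sum>v\<in>F. measure M (A u \<inter> A v \<inter> B))
     \<le> L\<^sup>2 * measure M ((\<Union>u\<in>F. A u) \<inter> B)"
proof -
  define T where "T = (\<Union>u\<in>F. A u) \<inter> B"
  have "T \<in> sets M"
    unfolding T_def using F A B by (intro sets.Int sets.finite_UN) auto
  then have "0 \<le> quadratic_moment M A F L T"
    using F A B fin by (intro quadratic_moment_mono(1)[of F A M T B]) (auto simp: T_def)
  moreover have "A u \<inter> T = A u \<inter> B" "A u \<inter> A v \<inter> T = A u \<inter> A v \<inter> B" if "u \<in> F" for u v
    using that by (auto simp: T_def)
  ultimately show ?thesis unfolding quadratic_moment_def T_def[symmetric] by simp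
qed

text \<open>The second moment bound gives each tail union a share of at least c^2/C of every cell,
  so the tail union is conull by uniform density. Avoiding an arbitrary finite \<open>F0\<close>
  turns one event into infinitely many.\<close>

theorem divergence_Borel_Cantelli_local:
  fixes A :: "'i \<Rightarrow> 'a::euclidean_space set"
  assumes U: "countable U" and A [measurable]: "\<And>u. u \<in> U \<Longrightarrow> A u \<in> sets lborel"
    and c: "c > 0" and C: "C > 0"
    and H: "\<And>j x F0. finite F0 \<Longrightarrow> \<exists>F \<Psi>. finite F \<and> F \<subseteq> U - F0 \<and> \<Psi> > 0 \<and>
        c * measure lborel (cell j x) * \<Psi> \<le> (\<Sum>u\<in>F. measure lborel (A u \<inter> cell j x)) \<and>
        (\<Sum>u\<in>F. \<Sum>v\<in>F. measure lborel (A u \<inter> A v \<inter> cell j x)) \<le> C * measure lborel (cell j x) * \<Psi>\<^sup>2"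
  shows "AE x in lborel. infinite {u \<in> U. x \<in> A u}"
proof -
  have "AE x in lborel. x \<in> (\<Union>u\<in>U - F0. A u)" if F0: "finite F0" for F0
  proof -
    define W where "W = (\<Union>u\<in>U - F0. A u)"
    have Wm [measurable]: "W \<in> sets lborel"
      unfolding W_def using U A by (intro sets.countable_UN') auto
    have "emeasure lborel (- W) = 0"
    proof (rule null_of_uniform_density[where c = "c\<^sup>2 / C"])
      fix j and x :: 'a
      define b where "b = measure lborel (cell j x)"
      have b: "b > 0" unfolding b_def measure_cell by simp
      obtain F \<Psi> where F: "finite F" "F \<subseteq> U - F0" "\<Psi> > 0"
        and lo: "c * b * \<Psi> \<le> (\<Sum>u\<in>F. measure lborel (A u \<inter> cell j x))"
        and up: "(\<Sum>u\<in>F. \<Sum>v\<in>F. measure lborel (A u \<inter> A v \<inter> cell j x)) \<le> C * b * \<Psi>\<^sup>2"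
        using H[OF F0, of j x] unfolding b_def by blast
      \<comment> \<open>This L maximises (2 L c b \<Psi> - C b \<Psi>^2) / L^2, and the maximum is
        c^2 b / C.\<close>
      define L where "L = C / c * \<Psi>"
      have L: "L > 0" unfolding L_def using c C F by simp
      have "2 * L * (c * b * \<Psi>) - C * b * \<Psi>\<^sup>2
        \<le> 2 * L * (\<Sum>u\<in>F. measure lborel (A u \<inter> cell j x))
          - (\<Sum>u\<in>F. \<Sum>v\<in>F. measure lborel (A u \<inter> A v \<inter> cell j x))"
        using L lo up by (intro diff_mono mult_left_mono) auto
      also have "\<dots> \<le> L\<^sup>2 * measure lborel ((\<Union>u\<in>F. A u) \<inter> cell j x)"
        using F A by (intro second_moment_bound) (auto simp: emeasure_cell)
      also have "\<dots> \<le> L\<^sup>2 * measure lborel (cell j x \<inter> W)"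
      proof (intro mult_left_mono measure_mono_fmeasurable)
        show "cell j x \<inter> W \<in> fmeasurable lborel"
          by (rule fmeasurableI2[of "cell j x"]) (auto intro!: fmeasurableI simp: emeasure_cell)
        show "(\<Union>u\<in>F. A u) \<inter> cell j x \<in> sets lborel"
          using F A by (intro sets.Int sets.finite_UN) auto
        show "(\<Union>u\<in>F. A u) \<inter> cell j x \<subseteq> cell j x \<inter> W"
          using F unfolding W_def by blast
      qed simp
      also have "2 * L * (c * b * \<Psi>) - C * b * \<Psi>\<^sup>2 = L\<^sup>2 * (c\<^sup>2 / C * b)"
        unfolding L_def using c C by (simp add: field_simps power2_eq_square)
      finally have "c\<^sup>2 / C * b \<le> measure lborel (cell j x \<inter> W)"
        using L by (simp only: mult_le_cancel_left_pos zero_less_power)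
      moreover have "emeasure lborel (cell j x \<inter> W) = ennreal (measure lborel (cell j x \<inter> W))"
      proof (intro emeasure_eq_ennreal_measure)
        have "emeasure lborel (cell j x \<inter> W) \<le> emeasure lborel (cell j x)" by (intro emeasure_mono) auto
        then show "emeasure lborel (cell j x \<inter> W) \<noteq> top" by (auto simp: emeasure_cell top_unique)
      qed
      moreover have "emeasure lborel (cell j x) = ennreal b"
        by (simp add: b_def measure_cell emeasure_cell)
      ultimately show "ennreal (c\<^sup>2 / C) * emeasure lborel (cell j x) \<le> emeasure lborel (cell j x \<inter> W)"
        using b c C by (simp add: ennreal_mult[symmetric])
    qed (use Wm c C in simp_all)
    moreover have "- W \<in> sets lborel"
      using sets.compl_sets[OF Wm] by (simp add: Compl_eq_Diff_UNIV)
    ultimately have "- W \<in> null_sets lborel" by (rule null_setsI)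
    then show ?thesis unfolding W_def[symmetric]
      by (rule AE_I') auto
  qed
  \<comment> \<open>A countable set has only countably many finite subsets, so the exceptional null
    sets can be merged.\<close>
  then have "AE x in lborel. \<forall>F0 \<in> {F0. finite F0 \<and> F0 \<subseteq> U}. x \<in> (\<Union>u\<in>U - F0. A u)"
    using countable_Collect_finite_subset[OF U] by (subst AE_ball_countable) (auto simp: conj_commute)
  then show ?thesis
    by (rule AE_mp) (rule AE_I2, fastforce)
qed

section \<open>Pairwise independence modulo 1\<close>

lemma emeasure_lborel_shift:
  fixes z :: "'a::euclidean_space"
  assumes "T \<in> sets lborel"
  shows "emeasure lborel {x. x + z \<in> T} = emeasure lborel T"
proof -
  have "emeasure lborel T = emeasure (distr lborel borel ((+) z)) T"
    by (simp add: lborel_distr_plus)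
  also have "\<dots> = emeasure lborel {x. x + z \<in> T}"
    using assms by (subst emeasure_distr) (auto intro!: arg_cong[where f = "emeasure lborel"] simp: add.commute)
  finally show ?thesis by simp
qed

lemma borel_shift [measurable]:
  fixes s :: "'a::euclidean_space"
  assumes "S \<in> sets borel"
  shows "{x. x + s \<in> S} \<in> sets borel"
proof -
  have "(\<lambda>x. x + s) -` S \<inter> space borel \<in> sets borel"
    using assms by (intro measurable_sets[of _ _ borel]) auto
  then show ?thesis by (simp add: vimage_def)
qed

definition lattice :: "'a::euclidean_space set" where
  "lattice = {z. \<forall>b\<in>Basis. z \<bullet> b \<in> \<int>}"

lemma countable_lattice: "countable (lattice :: 'a::euclidean_space set)"
proof -
  have "(lattice :: 'a set) \<subseteq> (\<lambda>f. \<Sum>b\<in>Basis. f b *\<^sub>R b) ` (Basis \<rightarrow>\<^sub>E (\<int> :: real set))"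
  proof
    fix x :: 'a assume x: "x \<in> lattice"
    show "x \<in> (\<lambda>f. \<Sum>b\<in>Basis. f b *\<^sub>R b) ` (Basis \<rightarrow>\<^sub>E (\<int> :: real set))"
      by (rule image_eqI[where x = "restrict (\<lambda>b. x \<bullet> b) Basis"])
         (use x in \<open>auto simp: lattice_def euclidean_representation\<close>)
  qed
  then show ?thesis
    by (rule countable_subset) (intro countable_image countable_PiE, auto simp: Ints_def)
qed

lemma lattice_inner_Basis:
  assumes "z \<in> lattice" "b \<in> Basis"
  obtains k :: int where "z \<bullet> b = of_int k"
  using assms by (auto simp: lattice_def Ints_def)

lemma uminus_lattice: "z \<in> lattice \<Longrightarrow> - z \<in> lattice"
  by (simp add: lattice_def)

lemma cell_add_lattice:
  assumes "z \<in> lattice"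
  shows "y + z \<in> cell 0 (a + z) \<longleftrightarrow> y \<in> cell 0 a"
proof -
  have "\<lfloor>(y + z) \<bullet> b\<rfloor> = \<lfloor>(a + z) \<bullet> b\<rfloor> \<longleftrightarrow> \<lfloor>y \<bullet> b\<rfloor> = \<lfloor>a \<bullet> b\<rfloor>" if b: "b \<in> Basis" for b
  proof -
    obtain k where "z \<bullet> b = of_int k" using lattice_inner_Basis[OF assms b] by blast
    then show ?thesis by (simp add: inner_add_left)
  qed
  then show ?thesis by (auto simp: cell_def)
qed

lemma ex1_lattice_cell: "\<exists>!z. z \<in> lattice \<and> y \<in> cell 0 (a + z)"
proof
  let ?z = "\<Sum>b\<in>Basis. of_int (\<lfloor>y \<bullet> b\<rfloor> - \<lfloor>a \<bullet> b\<rfloor>) *\<^sub>R b"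
  show "?z \<in> lattice \<and> y \<in> cell 0 (a + ?z)"
    by (auto simp: lattice_def cell_def inner_add_left)
next
  fix z assume z: "z \<in> lattice \<and> y \<in> cell 0 (a + z)"
  show "z = (\<Sum>b\<in>Basis. of_int (\<lfloor>y \<bullet> b\<rfloor> - \<lfloor>a \<bullet> b\<rfloor>) *\<^sub>R b)"
  proof (rule euclidean_eqI)
    fix b :: 'a assume b: "b \<in> Basis"
    then obtain k where "z \<bullet> b = of_int k" using z lattice_inner_Basis by blast
    moreover have "\<lfloor>y \<bullet> b\<rfloor> = \<lfloor>(a + z) \<bullet> b\<rfloor>" using z b by (auto simp: cell_def)
    ultimately show "z \<bullet> b = (\<Sum>b\<in>Basis. of_int (\<lfloor>y \<bullet> b\<rfloor> - \<lfloor>a \<bullet> b\<rfloor>) *\<^sub>R b) \<bullet> b"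
      using b by (simp add: inner_add_left)
  qed
qed

definition periodic :: "'a::euclidean_space set \<Rightarrow> bool" where
  "periodic S \<longleftrightarrow> (\<forall>z\<in>lattice. \<forall>x. x + z \<in> S \<longleftrightarrow> x \<in> S)"

text \<open>The unit cell and its translate by s are both fundamental domains of the lattice.
  Cutting the translate along the lattice copies of the cell and moving each piece back by its
  lattice vector reassembles the cell, and these moves do not change S.\<close>

lemma emeasure_periodic_shift:
  fixes S :: "'a::euclidean_space set"
  assumes S [measurable]: "S \<in> sets lborel" and per: "periodic S"
  shows "emeasure lborel (cell 0 a \<inter> {x. x + s \<in> S}) = emeasure lborel (cell 0 a \<inter> S)"
proof -
  define T where "T = {y. y - s \<in> cell 0 a} \<inter> S"
  have "{y. y - s \<in> cell 0 a} = (\<lambda>y. y - s) -` cell 0 a \<inter> space lborel" by auto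
  also have "\<dots> \<in> sets lborel" by (rule measurable_sets[of _ _ lborel]) auto
  finally have sm: "{y. y - s \<in> cell 0 a} \<in> sets lborel" .
  then have T: "T \<in> sets lborel" unfolding T_def by auto
  \<comment> \<open>\<open>X z\<close> is the piece of the translate lying in the lattice copy z of
    the cell; \<open>Y z\<close> is the same piece moved back by z.\<close>
  define X where "X z = T \<inter> cell 0 (a + z)" for z
  define Y where "Y z = {y. y + z - s \<in> cell 0 a} \<inter> (cell 0 a \<inter> S)" for z
  have YX: "Y z = {y. y + z \<in> X z}" if "z \<in> lattice" for z
    using that per cell_add_lattice[OF that]
    by (auto simp: X_def Y_def T_def periodic_def)
  have Xm: "X z \<in> sets lborel" for z unfolding X_def using T by auto
  have Ym: "Y z \<in> sets lborel" for z
  proof -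
    have "{y. y + z - s \<in> cell 0 a} = (\<lambda>y. y + z - s) -` cell 0 a \<inter> space lborel" by auto
    also have "\<dots> \<in> sets lborel" by (rule measurable_sets[of _ _ lborel]) auto
    finally show ?thesis unfolding Y_def by auto
  qed
  have dX: "disjoint_family_on X lattice"
    unfolding disjoint_family_on_def X_def using ex1_lattice_cell[of _ a] by blast
  have dY: "disjoint_family_on Y lattice"
  proof -
    have "z = w" if "z \<in> lattice" "w \<in> lattice" "y + z - s \<in> cell 0 a" "y + w - s \<in> cell 0 a" for y z w
    proof -
      have "(y + v - s) + (- v) \<in> cell 0 (a + - v) \<longleftrightarrow> (y + v - s) \<in> cell 0 a" if "v \<in> lattice" for v
        using cell_add_lattice uminus_lattice that by blast
      then have "y - s \<in> cell 0 (a + - z)" "y - s \<in> cell 0 (a + - w)"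
        using that by (auto simp: algebra_simps)
      then have "- z = - w" using ex1_lattice_cell[of "y - s" a] uminus_lattice that(1,2) by blast
      then show ?thesis by simp
    qed
    then show ?thesis unfolding disjoint_family_on_def Y_def by blast
  qed
  have UX: "(\<Union>z\<in>lattice. X z) = T"
    unfolding X_def using ex1_lattice_cell[of _ a] by blast
  have UY: "(\<Union>z\<in>lattice. Y z) = cell 0 a \<inter> S"
  proof -
    have "\<exists>z\<in>lattice. y + z - s \<in> cell 0 a" for y
    proof -
      obtain z where z: "z \<in> lattice" "y - s \<in> cell 0 (a + z)" using ex1_lattice_cell[of "y - s" a] by blast
      then have "y - s + - z \<in> cell 0 (a + z + - z)" using cell_add_lattice uminus_lattice by blast
      then show ?thesis using uminus_lattice[OF z(1)] by (intro bexI[of _ "- z"]) (auto simp: algebra_simps)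
    qed
    then show ?thesis unfolding Y_def by blast
  qed
  have "cell 0 a \<inter> {x. x + s \<in> S} = {x. x + s \<in> T}"
    by (auto simp: T_def)
  then have "emeasure lborel (cell 0 a \<inter> {x. x + s \<in> S}) = emeasure lborel T"
    using emeasure_lborel_shift[OF T] by simp
  also have "\<dots> = (\<integral>\<^sup>+z. emeasure lborel (X z) \<partial>count_space lattice)"
    unfolding UX[symmetric] by (intro emeasure_UN_countable Xm countable_lattice dX)
  also have "\<dots> = (\<integral>\<^sup>+z. emeasure lborel (Y z) \<partial>count_space lattice)"
    by (intro nn_integral_cong) (simp add: YX emeasure_lborel_shift[OF Xm])
  also have "\<dots> = emeasure lborel (cell 0 a \<inter> S)"
    unfolding UY[symmetric] by (intro emeasure_UN_countable[symmetric] Ym countable_lattice dY)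
  finally show ?thesis .
qed

section \<open>Points near the integer lattice\<close>

definition near_lattice :: "real \<Rightarrow> 'a::euclidean_space set" where
  "near_lattice \<psi> = {c. \<forall>b\<in>Basis. \<exists>t::int. \<bar>c \<bullet> b + of_int t\<bar> \<le> \<psi>}"

lemma near_lattice_measurable [measurable, simp]: "near_lattice \<psi> \<in> sets borel"
  unfolding near_lattice_def by measurable

lemma near_lattice_periodic: "periodic (near_lattice \<psi>)"
  unfolding periodic_def
proof (intro ballI allI)
  fix z x :: 'a assume z: "z \<in> lattice"
  have "(\<exists>t::int. \<bar>(x + z) \<bullet> b + of_int t\<bar> \<le> \<psi>) \<longleftrightarrow> (\<exists>t::int. \<bar>x \<bullet> b + of_int t\<bar> \<le> \<psi>)"
    if b: "b \<in> Basis" for b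
  proof -
    obtain k where k: "z \<bullet> b = of_int k" using lattice_inner_Basis[OF z b] by blast
    show ?thesis
    proof (safe, goal_cases)
      case (1 t) then show ?case by (intro exI[of _ "t + k"]) (simp add: k inner_add_left algebra_simps)
    next
      case (2 t) then show ?case by (intro exI[of _ "t - k"]) (simp add: k inner_add_left algebra_simps)
    qed
  qed
  then show "x + z \<in> near_lattice \<psi> \<longleftrightarrow> x \<in> near_lattice \<psi>" by (simp add: near_lattice_def)
qed

text \<open>Rounding leaves a distance of at most 1/2. Radius 1/2 thus makes a condition void, which
  derives one-vector statements from two-vector ones.\<close>

lemma near_lattice_half: "1 / 2 \<le> \<psi> \<Longrightarrow> near_lattice \<psi> = UNIV"
proof -
  assume "1 / 2 \<le> \<psi>"
  have "\<bar>x + of_int (- round x)\<bar> \<le> \<psi>" for x :: real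
    using of_int_round_abs_le[of x] \<open>1 / 2 \<le> \<psi>\<close> by (simp add: abs_minus_commute)
  then show ?thesis unfolding near_lattice_def by blast
qed

lemma emeasure_near_lattice_real:
  assumes "0 \<le> \<psi>" "\<psi> \<le> 1 / 2"
  shows "emeasure lborel (cell 0 a \<inter> near_lattice \<psi> :: real set) = ennreal (2 * \<psi>)"
\<comment> \<open>Radius 1/2 is separate because the closed interval of the other case would then
  leave the half-open cell.\<close>
proof (cases "\<psi> = 1 / 2")
  case True
  then show ?thesis by (simp add: near_lattice_half emeasure_cell)
next
  case False
  \<comment> \<open>Shifted by 1/2 the set meets the unit cell in a single interval around the
    midpoint; unshifted it would split into pieces at both ends.\<close>
  have "cell 0 a \<inter> {x. x + 1 / 2 \<in> near_lattice \<psi>} = {of_int \<lfloor>a\<rfloor> + 1 / 2 - \<psi> .. of_int \<lfloor>a\<rfloor> + 1 / 2 + \<psi>}"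
  proof (intro set_eqI iffI)
    fix x assume "x \<in> cell 0 a \<inter> {x. x + 1 / 2 \<in> near_lattice \<psi>}"
    then obtain t :: int where t: "\<lfloor>x\<rfloor> = \<lfloor>a\<rfloor>" "\<bar>x + 1 / 2 + of_int t\<bar> \<le> \<psi>"
      by (auto simp: cell_def near_lattice_def)
    then have "of_int (- t) - 1 < real_of_int \<lfloor>x\<rfloor> + 1" "real_of_int \<lfloor>x\<rfloor> < of_int (- t)"
      using False assms by linarith+
    then have "t = - \<lfloor>x\<rfloor> - 1" by linarith
    then show "x \<in> {of_int \<lfloor>a\<rfloor> + 1 / 2 - \<psi> .. of_int \<lfloor>a\<rfloor> + 1 / 2 + \<psi>}"
      using t by (auto simp: abs_le_iff)
  next
    fix x assume x: "x \<in> {of_int \<lfloor>a\<rfloor> + 1 / 2 - \<psi> .. of_int \<lfloor>a\<rfloor> + 1 / 2 + \<psi>}"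
    then have "\<lfloor>x\<rfloor> = \<lfloor>a\<rfloor>" using False assms by (auto simp: floor_eq_iff)
    moreover have "\<bar>x + 1 / 2 + of_int (- \<lfloor>a\<rfloor> - 1)\<bar> \<le> \<psi>" using x by (auto simp: abs_le_iff)
    ultimately show "x \<in> cell 0 a \<inter> {x. x + 1 / 2 \<in> near_lattice \<psi>}"
      unfolding near_lattice_def cell_def by (auto intro: exI[of _ "- \<lfloor>a\<rfloor> - 1"])
  qed
  then show ?thesis
    using emeasure_periodic_shift[of "near_lattice \<psi> :: real set" a "1 / 2"] assms
    by (simp add: near_lattice_periodic)
qed

lemma emeasure_near_lattice_shift:
  assumes "0 \<le> \<psi>" "\<psi> \<le> 1 / 2"
  shows "emeasure lborel (cell 0 a \<inter> {x. x + s \<in> near_lattice \<psi>} :: 'a::euclidean_space set)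
    = ennreal ((2 * \<psi>) ^ DIM('a))"
proof -
  have "emeasure lborel (cell 0 a \<inter> {x. x + s \<in> near_lattice \<psi>} :: 'a set)
      = emeasure lborel (cell 0 a \<inter> near_lattice \<psi> :: 'a set)"
    by (intro emeasure_periodic_shift near_lattice_periodic) simp
  also have "cell 0 a \<inter> near_lattice \<psi> = {x::'a. \<forall>b\<in>Basis. x \<bullet> b \<in> cell 0 (a \<bullet> b) \<inter> near_lattice \<psi>}"
    by (auto simp: cell_def near_lattice_def)
  also have "emeasure lborel \<dots> = (\<Prod>b\<in>(Basis::'a set). emeasure lborel (cell 0 (a \<bullet> b) \<inter> near_lattice \<psi> :: real set))"
    by (intro emeasure_lborel_product) auto
  also have "\<dots> = ennreal ((2 * \<psi>) ^ DIM('a))"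
    using assms by (simp add: emeasure_near_lattice_real ennreal_power)
  finally show ?thesis .
qed

section \<open>Matrices applied to a fixed vector\<close>

lemma bounded_linear_matrix_vector: "bounded_linear (\<lambda>A :: real ^ 'k ^ 'n. A *v u)"
proof -
  have "linear (\<lambda>A :: real ^ 'k ^ 'n. A *v u)"
    by (intro linearI) (auto simp: matrix_vector_mult_def vec_eq_iff algebra_simps sum.distrib sum_distrib_left)
  then show ?thesis by (rule linear_conv_bounded_linear[THEN iffD1])
qed

lemma matrix_vector_borel_measurable [measurable]:
  "(\<lambda>A :: real ^ 'k ^ 'n. A *v u) \<in> borel_measurable borel"
  by (intro borel_measurable_continuous_onI linear_continuous_on bounded_linear_matrix_vector)

lemma matrix_vector_entry_measurable [measurable]: "(\<lambda>A :: real ^ 'k ^ 'n. (A *v u) $ i) \<in> borel_measurable borel"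
  by (rule measurable_compose[OF matrix_vector_borel_measurable]) simp

lemma matrix_entry_measurable [measurable]: "(\<lambda>A :: real ^ 'k ^ 'n. A $ i $ k) \<in> borel_measurable borel"
  by (intro borel_measurable_continuous_onI continuous_intros)

lemma lattice_vec: "(x :: real ^ 'n) \<in> lattice \<longleftrightarrow> (\<forall>i. x $ i \<in> \<int>)"
  by (auto simp: lattice_def Basis_vec_def inner_axis)

lemma lattice_matrix: "(X :: real ^ 'k ^ 'n) \<in> lattice \<longleftrightarrow> (\<forall>i j. X $ i $ j \<in> \<int>)"
  by (auto simp: lattice_def Basis_vec_def inner_axis)

lemma lattice_matrix_vector:
  assumes "(X :: real ^ 'k ^ 'n) \<in> lattice" "u \<in> lattice"
  shows "X *v u \<in> lattice"
  using assms by (auto simp: lattice_matrix lattice_vec matrix_vector_mult_def intro!: Ints_sum Ints_mult)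

lemma emeasure_lborel_Times:
  fixes A :: "'a::euclidean_space set" and B :: "'b::euclidean_space set"
  assumes "A \<in> sets lborel" "B \<in> sets lborel"
  shows "emeasure lborel (A \<times> B) = emeasure lborel A * emeasure lborel B"
  unfolding lborel_prod[symmetric] using assms by (rule lborel.emeasure_pair_measure_Times)

text \<open>Translating \<open>X\<close> by \<open>K w\<close> moves the two targets by the components of \<open>w\<close> and, by periodicity, does
  not change the measure; averaging over \<open>w\<close> separates the two conditions.\<close>

lemma emeasure_pairwise_independent:
  fixes u v :: "real ^ 'k" and A :: "real ^ 'k ^ 'n"
  assumes u: "u \<in> lattice" and v: "v \<in> lattice" and ind: "u $ i * v $ j \<noteq> u $ j * v $ i"
    and p: "0 \<le> \<psi>" "\<psi> \<le> 1 / 2" and p': "0 \<le> \<psi>'" "\<psi>' \<le> 1 / 2"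
  shows "emeasure lborel (cell 0 A \<inter> {X. X *v u \<in> near_lattice \<psi> \<and> X *v v \<in> near_lattice \<psi>'})
    = ennreal ((2 * \<psi>) ^ CARD('n) * (2 * \<psi>') ^ CARD('n))"
proof -
  define S where "S = {X :: real ^ 'k ^ 'n. X *v u \<in> near_lattice \<psi> \<and> X *v v \<in> near_lattice \<psi>'}"
  have Sm [measurable]: "S \<in> sets borel" unfolding S_def by measurable
  have per: "periodic S"
    unfolding periodic_def
  proof (intro ballI allI)
    fix Z X :: "real ^ 'k ^ 'n" assume Z: "Z \<in> lattice"
    have "x + Z *v w \<in> near_lattice r \<longleftrightarrow> x \<in> near_lattice r" if "w \<in> lattice" for x w r
      using near_lattice_periodic lattice_matrix_vector[OF Z that] unfolding periodic_def by blast
    with u v show "X + Z \<in> S \<longleftrightarrow> X \<in> S"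
      unfolding S_def by (simp add: matrix_vector_mult_add_rdistrib)
  qed
  \<comment> \<open>A nonvanishing 2 by 2 minor of (u, v). Cramer's rule on the coordinates i and j
    gives a and b as a dual pair to u and v, so \<open>K w\<close> sends u to \<open>fst w\<close>
    and v to \<open>snd w\<close>.\<close>
  define D where "D = u $ i * v $ j - u $ j * v $ i"
  have "D \<noteq> 0" using ind by (simp add: D_def)
  define a where "a = (v $ j / D) *\<^sub>R axis i 1 - (v $ i / D) *\<^sub>R axis j (1::real)"
  define b where "b = (u $ i / D) *\<^sub>R axis j 1 - (u $ j / D) *\<^sub>R axis i (1::real)"
  have dual: "a \<bullet> u = 1" "a \<bullet> v = 0" "b \<bullet> u = 0" "b \<bullet> v = 1"
    using \<open>D \<noteq> 0\<close> unfolding a_def b_def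
    by (simp_all add: inner_diff_left inner_axis' divide_simps) (simp_all add: D_def algebra_simps)
  define K where "K w = (\<chi> r l. fst w $ r * a $ l + snd w $ r * b $ l)" for w :: "(real ^ 'n) \<times> (real ^ 'n)"
  have Kmul: "K w *v x = (a \<bullet> x) *\<^sub>R fst w + (b \<bullet> x) *\<^sub>R snd w" for w x
    by (simp add: vec_eq_iff matrix_vector_mult_def K_def inner_vec_def algebra_simps sum.distrib sum_distrib_left)
  have K: "X + K w \<in> S \<longleftrightarrow> fst w + X *v u \<in> near_lattice \<psi> \<and> snd w + X *v v \<in> near_lattice \<psi>'" for w X
    by (simp add: S_def matrix_vector_mult_add_rdistrib Kmul dual add.commute)
  define C where "C = (cell 0 0 :: (real ^ 'n) set)"
  have Cm [measurable]: "C \<in> sets borel" and C1: "emeasure lborel C = 1"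
    unfolding C_def by (simp_all add: emeasure_cell)
  have CC: "emeasure lborel (C \<times> C) = 1"
    by (subst emeasure_lborel_Times) (simp_all add: C1)
  define f :: "real ^ 'k ^ 'n \<Rightarrow> (real ^ 'n) \<times> (real ^ 'n) \<Rightarrow> ennreal" where
    "f = (\<lambda>X w. indicator (cell 0 A \<inter> {X. X + K w \<in> S}) X * indicator (C \<times> C) w)"
  have f_eq: "f = (\<lambda>X w. indicator (cell 0 A) X * indicator C (fst w) * indicator C (snd w)
     * indicator (near_lattice \<psi>) (fst w + X *v u) * indicator (near_lattice \<psi>') (snd w + X *v v))"
    unfolding f_def by (auto simp: fun_eq_iff K indicator_def)
  have fm: "(\<lambda>(X, w). f X w) \<in> borel_measurable (lborel \<Otimes>\<^sub>M lborel)"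
  proof -
    have "(\<lambda>(X, w). f X w) \<in> borel_measurable (borel \<Otimes>\<^sub>M (borel \<Otimes>\<^sub>M borel))"
      unfolding f_eq by measurable
    also have "borel_measurable (borel \<Otimes>\<^sub>M (borel \<Otimes>\<^sub>M borel)) = borel_measurable (lborel \<Otimes>\<^sub>M (lborel :: ((real^'n) \<times> (real^'n)) measure))"
      by (intro measurable_cong_sets sets_pair_measure_cong) (simp_all only: borel_prod sets_lborel)
    finally show ?thesis .
  qed
  have "emeasure lborel (cell 0 A \<inter> S) = (\<integral>\<^sup>+w. emeasure lborel (cell 0 A \<inter> S) * indicator (C \<times> C) w \<partial>lborel)"
    by (subst nn_integral_cmult_indicator) (auto simp: CC borel_prod[symmetric])
  also have "\<dots> = (\<integral>\<^sup>+w. (\<integral>\<^sup>+X. f X w \<partial>lborel) \<partial>lborel)"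
  proof (intro nn_integral_cong)
    fix w
    have [measurable]: "{X. X + K w \<in> S} \<in> sets borel" by (rule borel_shift) simp
    have "(\<integral>\<^sup>+X. f X w \<partial>lborel) = emeasure lborel (cell 0 A \<inter> {X. X + K w \<in> S}) * indicator (C \<times> C) w"
      unfolding f_def by (simp add: nn_integral_multc)
    then show "emeasure lborel (cell 0 A \<inter> S) * indicator (C \<times> C) w = (\<integral>\<^sup>+X. f X w \<partial>lborel)"
      using emeasure_periodic_shift[OF _ per, of A "K w"] by simp
  qed
  also have "\<dots> = (\<integral>\<^sup>+X. (\<integral>\<^sup>+w. f X w \<partial>lborel) \<partial>lborel)"
    by (rule lborel_pair.Fubini'[OF fm])
  also have "\<dots> = (\<integral>\<^sup>+X. ennreal ((2 * \<psi>) ^ CARD('n) * (2 * \<psi>') ^ CARD('n)) * indicator (cell 0 A) X \<partial>lborel)"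
  proof (intro nn_integral_cong)
    fix X
    let ?P = "C \<inter> {x. x + X *v u \<in> near_lattice \<psi>}" and ?Q = "C \<inter> {x. x + X *v v \<in> near_lattice \<psi>'}"
    have m: "C \<inter> {x. x + s \<in> near_lattice r} \<in> sets borel" for s r
      by (intro sets.Int borel_shift) simp_all
    have "(\<integral>\<^sup>+w. f X w \<partial>lborel) = (\<integral>\<^sup>+w. indicator (cell 0 A) X * indicator (?P \<times> ?Q) w \<partial>lborel)"
      unfolding f_eq by (intro nn_integral_cong) (auto simp: indicator_def)
    also have "\<dots> = indicator (cell 0 A) X * emeasure lborel (?P \<times> ?Q)"
      using m by (subst nn_integral_cmult_indicator) (auto simp: borel_prod[symmetric])
    also have "emeasure lborel (?P \<times> ?Q) = ennreal ((2 * \<psi>) ^ CARD('n) * (2 * \<psi>') ^ CARD('n))"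
      using m p p' by (subst emeasure_lborel_Times)
        (simp_all add: C_def emeasure_near_lattice_shift ennreal_mult)
    finally show "(\<integral>\<^sup>+w. f X w \<partial>lborel)
      = ennreal ((2 * \<psi>) ^ CARD('n) * (2 * \<psi>') ^ CARD('n)) * indicator (cell 0 A) X"
      by (simp add: mult.commute)
  qed
  also have "\<dots> = ennreal ((2 * \<psi>) ^ CARD('n) * (2 * \<psi>') ^ CARD('n))"
    by (simp add: nn_integral_cmult_indicator emeasure_cell)
  finally show ?thesis unfolding S_def .
qed

text \<open>The case of two vectors with a unit vector as the second one, at radius 1/2, where its
  condition is void. The second column provides a unit vector independent of u.\<close>

lemma emeasure_near_lattice_matrix:
  fixes u :: "real ^ 'k" and A :: "real ^ 'k ^ 'n"
  assumes "u \<in> lattice" "u \<noteq> 0" "i \<noteq> (j :: 'k)" "0 \<le> \<psi>" "\<psi> \<le> 1 / 2"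
  shows "emeasure lborel (cell 0 A \<inter> {X. X *v u \<in> near_lattice \<psi>}) = ennreal ((2 * \<psi>) ^ CARD('n))"
proof -
  obtain k where k: "u $ k \<noteq> 0" using assms by (auto simp: vec_eq_iff)
  obtain l where l: "l \<noteq> k" using assms by metis
  have "axis l 1 \<in> (lattice :: (real ^ 'k) set)" by (auto simp: lattice_vec axis_def)
  from emeasure_pairwise_independent[OF assms(1) this, of k l \<psi> "1 / 2" A]
  show ?thesis using assms k l by (simp add: near_lattice_half axis_def)
qed

section \<open>Coprime integers in intervals\<close>

text \<open>The numbers r + d k in the interval are parametrised by the k between two floors, and a
  difference of floors is within 1 of the difference of the arguments.\<close>

lemma card_cong_interval:
  fixes a r d :: int
  assumes d: "d > 0"
  shows "real (card {t \<in> {a<..a + int L}. d dvd t - r}) \<le> real L / of_int d + 1"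
    and "real (card {t \<in> {a<..a + int L}. d dvd t - r}) \<ge> real L / of_int d - 1"
proof -
  define l u where "l = \<lfloor>of_int (a - r) / real_of_int d\<rfloor>" and "u = \<lfloor>of_int (a + int L - r) / real_of_int d\<rfloor>"
  have iff: "t \<in> {a<..a + int L} \<longleftrightarrow> k \<in> {l<..u}" if "t = r + d * k" for t k
  proof -
    have "a < t \<longleftrightarrow> l < k"
    proof -
      have "a < t \<longleftrightarrow> a - r < d * k" using that by auto
      also have "\<dots> \<longleftrightarrow> real_of_int (a - r) < of_int d * of_int k" by (metis of_int_less_iff of_int_mult)
      also have "\<dots> \<longleftrightarrow> of_int (a - r) / real_of_int d < of_int k" using d by (simp add: field_simps)
      finally show ?thesis by (simp add: l_def floor_less_iff)
    qed
    moreover have "t \<le> a + int L \<longleftrightarrow> k \<le> u"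
    proof -
      have "t \<le> a + int L \<longleftrightarrow> d * k \<le> a + int L - r" using that by auto
      also have "\<dots> \<longleftrightarrow> of_int d * of_int k \<le> real_of_int (a + int L - r)" by (metis of_int_le_iff of_int_mult)
      also have "\<dots> \<longleftrightarrow> of_int k \<le> of_int (a + int L - r) / real_of_int d" using d by (simp add: field_simps)
      finally show ?thesis by (simp add: u_def le_floor_iff)
    qed
    ultimately show ?thesis by simp
  qed
  have "{t \<in> {a<..a + int L}. d dvd t - r} = (\<lambda>k. r + d * k) ` {l<..u}"
  proof (intro set_eqI iffI)
    fix t assume t: "t \<in> {t \<in> {a<..a + int L}. d dvd t - r}"
    then obtain k where "t = r + d * k" by (auto simp: dvd_def algebra_simps)
    with t iff show "t \<in> (\<lambda>k. r + d * k) ` {l<..u}" by blast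
  next
    fix t assume "t \<in> (\<lambda>k. r + d * k) ` {l<..u}"
    then obtain k where "t = r + d * k" "k \<in> {l<..u}" by blast
    then show "t \<in> {t \<in> {a<..a + int L}. d dvd t - r}" using iff[of t k] by simp
  qed
  then have "card {t \<in> {a<..a + int L}. d dvd t - r} = card {l<..u}"
    using d by (simp add: card_image inj_on_def)
  moreover have "l \<le> u" unfolding l_def u_def using d by (intro floor_mono divide_right_mono) auto
  ultimately have card: "real (card {t \<in> {a<..a + int L}. d dvd t - r}) = of_int u - of_int l" by simp
  have "of_int (a + int L - r) / real_of_int d - of_int (a - r) / real_of_int d = real L / of_int d"
    by (simp add: diff_divide_distrib[symmetric])
  then show "real (card {t \<in> {a<..a + int L}. d dvd t - r}) \<le> real L / of_int d + 1"
    "real (card {t \<in> {a<..a + int L}. d dvd t - r}) \<ge> real L / of_int d - 1"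
    unfolding card l_def u_def by linarith+
qed

text \<open>Such numbers have positive density, and coprimality to one of them has probability bounded
  below. The prime \<open>2\<close> is not counted, so that the class is closed under doubling.\<close>

definition few_factors :: "nat \<Rightarrow> bool" where
  "few_factors s \<longleftrightarrow> (\<Sum>p\<in>prime_factors s - {2}. 1 / real p) \<le> 3 / 4"

text \<open>Writing p = 2j + 3, the inequality (2j + 3)^2 >= 4 (j + 1) (j + 2) compares the sum with
  a telescoping one. Enlarging the odd primes to all odd numbers above 1 still leaves 1/4.\<close>

lemma sum_odd_inverse_squares_le: "(\<Sum>p\<in>{p \<in> {1..T}. odd p \<and> p > 1}. 1 / (real p)\<^sup>2) \<le> 1 / 4"
proof -
  have "(\<Sum>p\<in>{p \<in> {1..T}. odd p \<and> p > 1}. 1 / (real p)\<^sup>2) \<le> (\<Sum>p\<in>(\<lambda>j. 2 * j + 3) ` {..<T}. 1 / (real p)\<^sup>2)"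
  proof (intro sum_mono2)
    show "{p \<in> {1..T}. odd p \<and> p > 1} \<subseteq> (\<lambda>j. 2 * j + 3) ` {..<T}"
    proof
      fix p assume p: "p \<in> {p \<in> {1..T}. odd p \<and> p > 1}"
      then obtain k where "p = 2 * k + 1" "k > 0" by (auto elim!: oddE)
      with p show "p \<in> (\<lambda>j. 2 * j + 3) ` {..<T}" by (intro image_eqI[of _ _ "k - 1"]) auto
    qed
  qed auto
  also have "\<dots> = (\<Sum>j<T. 1 / (real (2 * j + 3))\<^sup>2)"
    by (subst sum.reindex) (auto simp: inj_on_def)
  also have "\<dots> \<le> (\<Sum>j<T. 1 / 4 * (1 / real (j + 1) - 1 / real (j + 2)))"
  proof (intro sum_mono)
    fix j :: nat
    have "1 / (real (2 * j + 3))\<^sup>2 \<le> 1 / (4 * (real j + 1) * (real j + 2))"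
    proof (intro divide_left_mono)
      show "4 * (real j + 1) * (real j + 2) \<le> (real (2 * j + 3))\<^sup>2"
        by (simp add: power2_eq_square algebra_simps)
      show "0 < (real (2 * j + 3))\<^sup>2 * (4 * (real j + 1) * (real j + 2))"
        by (intro mult_pos_pos) auto
    qed simp
    also have "\<dots> = 1 / 4 * (1 / real (j + 1) - 1 / real (j + 2))"
      by (simp add: divide_simps) (simp add: algebra_simps)
    finally show "1 / (real (2 * j + 3))\<^sup>2 \<le> 1 / 4 * (1 / real (j + 1) - 1 / real (j + 2))" .
  qed
  also have "\<dots> = 1 / 4 * (1 - 1 / real (T + 1))"
  proof -
    have "(\<Sum>j<T. 1 / real (j + 1) - 1 / real (j + 2)) = 1 - 1 / real (T + 1)"
      using sum_lessThan_telescope'[of "\<lambda>j. 1 / real (j + 1)" T] by (simp add: add.commute)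
    then show ?thesis unfolding sum_distrib_left[symmetric] by simp
  qed
  also have "\<dots> \<le> 1 / 4" by simp
  finally show ?thesis .
qed

text \<open>Markov's inequality: averaged over s, the reciprocals of the odd prime divisors sum to
  at most the sum of 1/p^2, so to at most 1/4, and the threshold 3/4 is exceeded by at most a third
  of all s. A proportion above 1/2 matters because it survives the removal of the lower half of
  {1..2L}.\<close>

lemma card_few_factors: "real (card {s \<in> {1..T}. few_factors s}) \<ge> 2 / 3 * real T"
proof -
  define Bad where "Bad = {s \<in> {1..T}. \<not> few_factors s}"
  have "3 / 4 * real (card Bad) = (\<Sum>s\<in>Bad. 3 / 4)" by simp
  also have "\<dots> \<le> (\<Sum>s\<in>Bad. \<Sum>p\<in>prime_factors s - {2}. 1 / real p)"
    by (intro sum_mono) (auto simp: Bad_def few_factors_def)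
  also have "\<dots> \<le> (\<Sum>s\<in>{1..T}. \<Sum>p\<in>prime_factors s - {2}. 1 / real p)"
    by (intro sum_mono2) (auto simp: Bad_def intro!: sum_nonneg)
  also have "\<dots> \<le> (\<Sum>s\<in>{1..T}. \<Sum>p\<in>{p \<in> {1..T}. odd p \<and> p > 1}. if p dvd s then 1 / real p else 0)"
  proof (intro sum_mono)
    fix s assume s: "s \<in> {1..T}"
    have "(\<Sum>p\<in>prime_factors s - {2}. 1 / real p) = (\<Sum>p\<in>prime_factors s - {2}. if p dvd s then 1 / real p else 0)"
      by (intro sum.cong) auto
    also have "\<dots> \<le> (\<Sum>p\<in>{p \<in> {1..T}. odd p \<and> p > 1}. if p dvd s then 1 / real p else 0)"
    proof (intro sum_mono2)
      show "prime_factors s - {2} \<subseteq> {p \<in> {1..T}. odd p \<and> p > 1}"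
      proof
        fix p assume p: "p \<in> prime_factors s - {2}"
        then have "prime p" "p dvd s" "p \<noteq> 2" by auto
        moreover have "p \<le> s" using \<open>p dvd s\<close> s by (intro dvd_imp_le) auto
        ultimately show "p \<in> {p \<in> {1..T}. odd p \<and> p > 1}"
          using s prime_gt_1_nat[of p] primes_dvd_imp_eq[of 2 p] two_is_prime_nat
          by auto
      qed
    qed auto
    finally show "(\<Sum>p\<in>prime_factors s - {2}. 1 / real p)
      \<le> (\<Sum>p\<in>{p \<in> {1..T}. odd p \<and> p > 1}. if p dvd s then 1 / real p else 0)" .
  qed
  also have "\<dots> = (\<Sum>p\<in>{p \<in> {1..T}. odd p \<and> p > 1}. \<Sum>s\<in>{1..T}. if p dvd s then 1 / real p else 0)"
    by (rule sum.swap)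
  also have "\<dots> \<le> (\<Sum>p\<in>{p \<in> {1..T}. odd p \<and> p > 1}. real T * (1 / (real p)\<^sup>2))"
  proof (intro sum_mono)
    fix p assume p: "p \<in> {p \<in> {1..T}. odd p \<and> p > 1}"
    have eq: "(\<Sum>s\<in>{1..T}. if p dvd s then 1 / real p else 0) = real (card {s \<in> {1..T}. p dvd s}) * (1 / real p)"
      by (simp add: sum.inter_filter[symmetric])
    have "{s \<in> {1..T}. p dvd s} \<subseteq> (\<lambda>k. p * k) ` {1..T div p}"
    proof
      fix s assume s: "s \<in> {s \<in> {1..T}. p dvd s}"
      then obtain k where k: "s = p * k" by auto
      with s p have "k \<le> T div p" by (simp add: less_eq_div_iff_mult_less_eq mult.commute)
      with s k show "s \<in> (\<lambda>k. p * k) ` {1..T div p}" by (cases "k = 0") auto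
    qed
    then have "card {s \<in> {1..T}. p dvd s} \<le> card ((\<lambda>k. p * k) ` {1..T div p})"
      by (intro card_mono) auto
    also have "\<dots> \<le> T div p" by (rule order_trans[OF card_image_le]) auto
    finally have "real (card {s \<in> {1..T}. p dvd s}) \<le> real T / real p"
      using of_nat_div_le_of_nat[of T p, where 'a = real] by linarith
    then have "real (card {s \<in> {1..T}. p dvd s}) * (1 / real p) \<le> real T / real p * (1 / real p)"
      by (intro mult_right_mono) auto
    then show "(\<Sum>s\<in>{1..T}. if p dvd s then 1 / real p else 0) \<le> real T * (1 / (real p)\<^sup>2)"
      unfolding eq by (simp add: power2_eq_square)
  qed
  also have "\<dots> \<le> real T * (1 / 4)"
    unfolding sum_distrib_left[symmetric] by (intro mult_left_mono sum_odd_inverse_squares_le) auto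
  finally have "real (card Bad) \<le> real T / 3" by simp
  moreover have "card {s \<in> {1..T}. few_factors s} + card Bad = T"
  proof -
    have "card {s \<in> {1..T}. few_factors s} + card Bad = card ({s \<in> {1..T}. few_factors s} \<union> Bad)"
      by (intro card_Un_disjoint[symmetric]) (auto simp: Bad_def)
    also have "{s \<in> {1..T}. few_factors s} \<union> Bad = {1..T}" by (auto simp: Bad_def)
    finally show ?thesis by simp
  qed
  ultimately show ?thesis by linarith
qed

text \<open>For the case of one column, where denominators have to be multiples of a power of 2 that
  depends on the cell.\<close>

lemma few_factors_power2_mult:
  assumes "few_factors s" "s > 0"
  shows "few_factors (2 ^ j * s)"
proof -
  have "prime_factors (2 ^ j * s) - {2} \<subseteq> prime_factors s - {2}"
  proof
    fix p assume p: "p \<in> prime_factors (2 ^ j * s) - {2}"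
    then have "prime p" "p dvd 2 ^ j * s" by auto
    then have "p dvd 2 ^ j \<or> p dvd s" by (simp add: prime_dvd_mult_iff)
    moreover have "\<not> p dvd 2 ^ j"
      using p \<open>prime p\<close> prime_dvd_power[of p 2 j] primes_dvd_imp_eq[of p 2] two_is_prime_nat by auto
    ultimately show "p \<in> prime_factors s - {2}" using p \<open>prime p\<close> assms by (auto simp: prime_factors_dvd)
  qed
  then have "(\<Sum>p\<in>prime_factors (2 ^ j * s) - {2}. 1 / real p) \<le> (\<Sum>p\<in>prime_factors s - {2}. 1 / real p)"
    by (intro sum_mono2) auto
  with assms show ?thesis by (simp add: few_factors_def)
qed

text \<open>Only odd t are counted, which disposes of the prime 2 whether or not it divides s. Of
  about L/2 odd numbers an odd prime p removes at most L/(2p) + 1, in all at most (3/8) L plus the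
  number of primes; this leaves L/8.\<close>

lemma card_coprime_interval:
  assumes s: "few_factors s" "s > 0"
  shows "real (card {t \<in> {a<..a + int L}. coprime t (int s)}) \<ge> real L / 8 - real (card (prime_factors s)) - 1"
proof -
  define P where "P = prime_factors s - {2}"
  define O1 where "O1 = {t \<in> {a<..a + int L}. 2 dvd t - 1}"
  \<comment> \<open>For odd p the class of p modulo 2p consists of the odd multiples of p.\<close>
  define M where "M p = {t \<in> {a<..a + int L}. 2 * int p dvd t - int p}" for p
  have fin: "finite O1" "finite (M p)" "finite P" for p
    unfolding O1_def M_def P_def by (auto intro: finite_subset[OF _ finite_greaterThanAtMost_int])
  have sub: "O1 - (\<Union>p\<in>P. M p) \<subseteq> {t \<in> {a<..a + int L}. coprime t (int s)}"
  proof
    fix t assume t: "t \<in> O1 - (\<Union>p\<in>P. M p)"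
    then have "odd t" by (auto simp: O1_def)
    have "coprime t (int s)"
    proof (rule ccontr)
      assume "\<not> coprime t (int s)"
      then have "gcd (nat \<bar>t\<bar>) s \<noteq> 1"
        by (metis coprime_int_iff coprime_iff_gcd_eq_1 coprime_abs_left_iff int_nat_eq abs_ge_zero nat_0_le)
      then obtain p where p: "prime p" "p dvd gcd (nat \<bar>t\<bar>) s" using prime_factor_nat by blast
      then have "p dvd nat \<bar>t\<bar>" "p dvd s"
        using gcd_dvd1[of "nat \<bar>t\<bar>" s] gcd_dvd2[of "nat \<bar>t\<bar>" s] dvd_trans by blast+
      then have pt: "int p dvd t" by (metis dvd_abs_iff int_dvd_int_iff int_nat_eq abs_ge_zero nat_0_le)
      with \<open>odd t\<close> have "odd p" by (meson dvd_trans int_dvd_int_iff even_of_nat)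
      then have "p \<in> P" using p \<open>p dvd s\<close> s by (auto simp: P_def prime_factors_dvd)
      from pt obtain k where k: "t = int p * k" by auto
      with \<open>odd t\<close> have "odd k" by auto
      then obtain l where "k = 2 * l + 1" by (rule oddE)
      then have "t - int p = 2 * int p * l" using k by (simp add: algebra_simps)
      then have "t \<in> M p" using t by (auto simp: M_def O1_def)
      with t \<open>p \<in> P\<close> show False by blast
    qed
    with t show "t \<in> {t \<in> {a<..a + int L}. coprime t (int s)}" by (auto simp: O1_def)
  qed
  have "real (card O1) \<ge> real L / 2 - 1"
    using card_cong_interval(2)[of 2 L a 1] by (simp add: O1_def)
  moreover have "real (card (\<Union>p\<in>P. M p)) \<le> 3 / 8 * real L + real (card (prime_factors s))"
  proof -
    have "real (card (\<Union>p\<in>P. M p)) \<le> (\<Sum>p\<in>P. real (card (M p)))"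
      using card_UN_le[OF fin(3), of M] by (metis of_nat_le_iff of_nat_sum)
    also have "\<dots> \<le> (\<Sum>p\<in>P. real L / 2 * (1 / real p) + 1)"
    proof (intro sum_mono)
      fix p assume "p \<in> P"
      then have "p > 0" by (auto simp: P_def in_prime_factors_iff prime_gt_0_nat)
      then show "real (card (M p)) \<le> real L / 2 * (1 / real p) + 1"
        using card_cong_interval(1)[of "2 * int p" a L "int p"] by (simp add: M_def)
    qed
    also have "\<dots> = real L / 2 * (\<Sum>p\<in>P. 1 / real p) + real (card P)"
      by (simp add: sum.distrib sum_distrib_left)
    also have "\<dots> \<le> real L / 2 * (3 / 4) + real (card (prime_factors s))"
      using s unfolding P_def few_factors_def
      by (intro add_mono mult_left_mono of_nat_mono card_mono) auto
    finally show ?thesis by simp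
  qed
  moreover have "real (card (O1 - (\<Union>p\<in>P. M p))) \<ge> real (card O1) - real (card (\<Union>p\<in>P. M p))"
    using diff_card_le_card_Diff[of "\<Union>p\<in>P. M p" O1] fin by auto
  moreover have "real (card {t \<in> {a<..a + int L}. coprime t (int s)}) \<ge> real (card (O1 - (\<Union>p\<in>P. M p)))"
    using sub by (intro of_nat_mono card_mono finite_subset[OF _ finite_greaterThanAtMost_int[of a "a + int L"]]) auto
  ultimately show ?thesis by linarith
qed

text \<open>Each prime divisor contributes a factor of at least 2, so the number of prime divisors
  is at most logarithmic in s.\<close>

lemma two_power_card_prime_factors_le:
  assumes "s > 0"
  shows "2 ^ card (prime_factors s) \<le> (s :: nat)"
proof -
  have "2 ^ card (prime_factors s) = (\<Prod>p\<in>prime_factors s. 2)" by simp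
  also have "\<dots> \<le> (\<Prod>p\<in>prime_factors s. p ^ multiplicity p s)"
  proof (intro prod_mono conjI)
    fix p assume p: "p \<in> prime_factors s"
    then have "prime p" "multiplicity p s > 0" by (auto simp: prime_factors_multiplicity)
    then have "2 \<le> p ^ 1" "p ^ 1 \<le> p ^ multiplicity p s"
      using prime_ge_2_nat[of p] power_increasing[of 1 "multiplicity p s" p] by auto
    then show "2 \<le> p ^ multiplicity p s" by linarith
  qed auto
  also have "\<dots> = s" using prod_prime_factors[of s] assms by simp
  finally show ?thesis .
qed

lemma square_le_two_power: "n \<ge> 4 \<Longrightarrow> n\<^sup>2 \<le> 2 ^ (n :: nat)"
proof (induction n rule: dec_induct)
  case (step n)
  have "4 * n \<le> n * n" using step(1) by (intro mult_right_mono) auto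
  then have "2 * n + 1 \<le> n * n" using step(1) by linarith
  then have "(Suc n)\<^sup>2 \<le> 2 * n\<^sup>2" by (simp add: power2_eq_square)
  with step show ?case by simp
qed simp

text \<open>The error term is logarithmic in s, hence below L/16 once L is large in terms of K; the
  main term L/8 loses at most half.\<close>

lemma card_coprime_interval_linear:
  fixes K :: real
  obtains L0 :: nat where "\<And>L s a. L \<ge> L0 \<Longrightarrow> few_factors s \<Longrightarrow> s > 0 \<Longrightarrow> real s \<le> K * real L
     \<Longrightarrow> real (card {t \<in> {a<..a + int L}. coprime t (int s)}) \<ge> real L / 16"
proof
  fix L s :: nat and a :: int
  assume L: "L \<ge> max 160 (nat \<lceil>1024 * K\<rceil> + 1)" and s: "few_factors s" "s > 0" "real s \<le> K * real L"
  let ?w = "card (prime_factors s)"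
  \<comment> \<open>Otherwise the number w of prime divisors satisfies (L/32)^2 <= w^2 <= 2^w <= s
    <= K L, which forces L <= 1024 K. From L >= 160 and w + 1 > L/16 follow w >= L/32 and w >= 4,
    the latter for w^2 <= 2^w.\<close>
  have "real ?w + 1 \<le> real L / 16"
  proof (rule ccontr)
    assume *: "\<not> real ?w + 1 \<le> real L / 16"
    then have w: "real ?w \<ge> real L / 32" "?w \<ge> 4" using L by linarith+
    have "(real L / 32)\<^sup>2 \<le> (real ?w)\<^sup>2" using w by (intro power_mono) auto
    also have "\<dots> \<le> real (2 ^ ?w)" using square_le_two_power[OF w(2)] by (metis of_nat_le_iff of_nat_power)
    also have "\<dots> \<le> real s" using two_power_card_prime_factors_le[OF s(2)] by (rule of_nat_mono)
    also have "\<dots> \<le> K * real L" by fact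
    finally have "real L * real L \<le> (1024 * K) * real L" by (simp add: power2_eq_square)
    then have "real L \<le> 1024 * K" using L by (simp add: mult_le_cancel_right)
    then show False using L by linarith
  qed
  with card_coprime_interval[OF s(1,2), of L a]
  show "real (card {t \<in> {a<..a + int L}. coprime t (int s)}) \<ge> real L / 16" by linarith
qed

section \<open>Local estimates\<close>

lemma emeasure_lborel_product_reindex:
  fixes e :: "'i::finite \<Rightarrow> 'a::euclidean_space"
  assumes e: "bij_betw e UNIV Basis" and S: "\<And>i. S i \<in> sets borel"
  shows "emeasure lborel {x. \<forall>i. x \<bullet> e i \<in> S i} = (\<Prod>i\<in>UNIV. emeasure lborel (S i))"
proof -
  define S' where "S' b = S (inv_into UNIV e b)" for b
  have S': "S' (e i) = S i" for i
    using e by (simp add: S'_def bij_betw_def)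
  have "{x. \<forall>i. x \<bullet> e i \<in> S i} = {x. \<forall>b\<in>e ` UNIV. x \<bullet> b \<in> S' b}"
    by (simp add: S')
  also have "e ` UNIV = Basis" using e by (simp add: bij_betw_def)
  finally have "emeasure lborel {x. \<forall>i. x \<bullet> e i \<in> S i} = (\<Prod>b\<in>Basis. emeasure lborel (S' b))"
    using S by (simp add: emeasure_lborel_product S'_def)
  also have "\<dots> = (\<Prod>i\<in>UNIV. emeasure lborel (S i))"
    by (simp add: prod.reindex_bij_betw[OF e, symmetric] S')
  finally show ?thesis .
qed

lemma emeasure_lborel_product_vec:
  fixes S :: "'n::finite \<Rightarrow> real set"
  assumes "\<And>i. S i \<in> sets borel"
  shows "emeasure lborel {x :: real ^ 'n. \<forall>i. x $ i \<in> S i} = (\<Prod>i\<in>UNIV. emeasure lborel (S i))"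
proof -
  have "bij_betw (\<lambda>i. axis i 1 :: real ^ 'n) UNIV Basis"
    by (auto simp: bij_betw_def inj_on_def axis_eq_axis Basis_vec_def)
  from emeasure_lborel_product_reindex[OF this assms] show ?thesis by (simp add: inner_axis)
qed

lemma emeasure_lborel_product_column:
  fixes S :: "'n::finite \<Rightarrow> real set" and l :: "'k::finite"
  assumes S: "\<And>i. S i \<in> sets borel" and l: "\<And>j. j = l"
  shows "emeasure lborel {X :: real ^ 'k ^ 'n. \<forall>i. X $ i $ l \<in> S i} = (\<Prod>i\<in>UNIV. emeasure lborel (S i))"
proof -
  have "axis j (1::real) = axis l 1" for j :: 'k using l[of j] by simp
  then have "(Basis :: (real ^ 'k ^ 'n) set) = range (\<lambda>i. axis i (axis l 1))"
    unfolding Basis_vec_def Basis_real_def by (auto, metis rangeI)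
  then have "bij_betw (\<lambda>i. axis i (axis l 1) :: real ^ 'k ^ 'n) UNIV Basis"
    by (auto simp: bij_betw_def inj_on_def axis_eq_axis)
  from emeasure_lborel_product_reindex[OF this S] show ?thesis by (simp add: inner_axis)
qed

text \<open>Exact pairwise independence on \<open>Q\<close> bounds the variance there by \<open>m\<close>; on the smaller set \<open>B\<close> use
  \<open>f\<^sup>2 \<le> 2 (f - m)\<^sup>2 + 2 m\<^sup>2\<close>.\<close>

lemma pair_measure_localize:
  fixes A :: "'i \<Rightarrow> 'a set" and M :: "'a measure" and m :: real
  assumes F: "finite F" and A [measurable]: "\<And>u. u \<in> F \<Longrightarrow> A u \<in> sets M"
    and B [measurable]: "B \<in> sets M" and Q [measurable]: "Q \<in> sets M" and sub: "B \<subseteq> Q"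
    and Q1: "emeasure M Q = 1"
    and single: "\<And>u. u \<in> F \<Longrightarrow> measure M (A u \<inter> Q) = \<mu> u"
    and pair: "\<And>u v. u \<in> F \<Longrightarrow> v \<in> F \<Longrightarrow> u \<noteq> v \<Longrightarrow> measure M (A u \<inter> A v \<inter> Q) = \<mu> u * \<mu> v"
    and m: "m = (\<Sum>u\<in>F. \<mu> u)"
  shows "(\<Sum>u\<in>F. \<Sum>v\<in>F. measure M (A u \<inter> A v \<inter> B)) \<le> 2 * m + 2 * m\<^sup>2 * measure M B"
proof -
  have pos: "\<mu> u \<ge> 0" if "u \<in> F" for u using single[OF that] by (metis measure_nonneg)
  have "(\<Sum>v\<in>F. measure M (A u \<inter> A v \<inter> Q)) \<le> (\<Sum>v\<in>F. \<mu> u * \<mu> v) + \<mu> u" if "u \<in> F" for u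
  proof -
    have "(\<Sum>v\<in>F. measure M (A u \<inter> A v \<inter> Q)) \<le> (\<Sum>v\<in>F. \<mu> u * \<mu> v + (if v = u then \<mu> u else 0))"
      using pair[OF that] single[OF that] pos that by (intro sum_mono) auto
    also have "\<dots> = (\<Sum>v\<in>F. \<mu> u * \<mu> v) + \<mu> u" using F that by (simp add: sum.distrib)
    finally show ?thesis .
  qed
  then have "(\<Sum>u\<in>F. \<Sum>v\<in>F. measure M (A u \<inter> A v \<inter> Q)) \<le> (\<Sum>u\<in>F. (\<Sum>v\<in>F. \<mu> u * \<mu> v) + \<mu> u)"
    by (rule sum_mono)
  also have "\<dots> = m\<^sup>2 + m" unfolding m power2_eq_square sum_product by (simp add: sum.distrib)
  finally have "(\<Sum>u\<in>F. \<Sum>v\<in>F. measure M (A u \<inter> A v \<inter> Q)) \<le> m\<^sup>2 + m" .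
  moreover have "(\<Sum>u\<in>F. measure M (A u \<inter> Q)) = m" unfolding m by (intro sum.cong) (simp_all add: single)
  moreover have "measure M Q = 1" using Q1 by (simp add: measure_def)
  ultimately have "quadratic_moment M A F m Q \<le> m" by (simp add: quadratic_moment_def power2_eq_square)
  \<comment> \<open>The inequality f^2 <= 2 (f - m)^2 + 2 m^2 is the same as (f - 2m)^2 >= 0, hence
    the second parameter 2m.\<close>
  moreover have "quadratic_moment M A F m B \<le> quadratic_moment M A F m Q" "0 \<le> quadratic_moment M A F (2 * m) B"
    using quadratic_moment_mono[OF F A B Q sub] Q1 by auto
  ultimately show ?thesis unfolding quadratic_moment_def by (simp add: power_mult_distrib algebra_simps)
qed

text \<open>As x runs through [0, h), c + x m sweeps a range of length h m. At least L/16 of the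
  integers t opposite to that range are coprime to s, with L >= h m / 2, and each owns an interval
  of x of length 2 \<psi> / m; \<psi> < 1/2 keeps these disjoint. The threshold R is chosen before
  everything else and so is uniform in s, c and \<psi>.\<close>

lemma coprime_near_lower_bound:
  fixes h :: real
  assumes h: "h > 0"
  shows "\<exists>R. \<forall>m s c \<psi>. m \<ge> R \<longrightarrow> few_factors s \<longrightarrow> s > 0 \<longrightarrow> real s \<le> m \<longrightarrow> 0 \<le> \<psi> \<longrightarrow> \<psi> < 1 / 2 \<longrightarrow>
    ennreal (\<psi> * h / 16) \<le> emeasure lborel {x. 0 \<le> x \<and> x < h \<and> (\<exists>t::int. coprime t (int s) \<and> \<bar>c + x * m + of_int t\<bar> \<le> \<psi>)}"
proof -
  \<comment> \<open>The ratio 2/h is what s <= m and L >= h m / 2 allow.\<close>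
  obtain L0 :: nat where L0: "\<And>L s a. L \<ge> L0 \<Longrightarrow> few_factors s \<Longrightarrow> s > 0 \<Longrightarrow> real s \<le> (2 / h) * real L
     \<Longrightarrow> real (card {t \<in> {a<..a + int L}. coprime t (int s)}) \<ge> real L / 16"
    using card_coprime_interval_linear[of "2 / h"] by blast
  show ?thesis
  proof (intro exI allI impI)
    fix m c \<psi> :: real and s :: nat
    assume m: "m \<ge> (real L0 + 8) / h" and s: "few_factors s" "s > 0" "real s \<le> m" and \<psi>: "0 \<le> \<psi>" "\<psi> < 1 / 2"
    have m0: "m > 0" using m h by (smt (verit) divide_pos_pos of_nat_0_le_iff)
    have hm: "h * m \<ge> real L0 + 8" using m h by (simp add: field_simps)
    \<comment> \<open>Giving up 3 integers leaves room for rounding and for \<psi>, so that the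
      intervals stay inside [0, h).\<close>
    define L where "L = nat (\<lfloor>h * m\<rfloor> - 3)"
    have L: "real L \<ge> h * m - 4" "real L \<le> h * m - 3" using hm unfolding L_def by linarith+
    define a where "a = \<lceil>- c - h * m\<rceil>"
    define T where "T = {t \<in> {a<..a + int L}. coprime t (int s)}"
    have "finite T" unfolding T_def by (rule finite_subset[OF _ finite_greaterThanAtMost_int]) auto
    have "real s \<le> (2 / h) * real L"
    proof -
      have "m \<le> (2 / h) * (h * m - 4)" using h hm by (simp add: field_simps)
      also have "\<dots> \<le> (2 / h) * real L" using L h by (intro mult_left_mono) auto
      finally show ?thesis using s by linarith
    qed
    moreover have "L \<ge> L0" using L hm by linarith
    ultimately have cardT: "real (card T) \<ge> real L / 16" unfolding T_def using s by (intro L0) auto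
    define I where "I t = {(- c - of_int t - \<psi>) / m .. (- c - of_int t + \<psi>) / m}" for t :: int
    have I: "x \<in> I t \<longleftrightarrow> \<bar>c + x * m + of_int t\<bar> \<le> \<psi>" for x t
      using m0 unfolding I_def by (auto simp: field_simps abs_le_iff)
    have disj: "disjoint_family_on I T"
      unfolding disjoint_family_on_def
    proof (intro ballI impI)
      fix t t' assume "t \<in> T" "t' \<in> T" "t \<noteq> t'"
      have False if "x \<in> I t" "x \<in> I t'" for x
      proof -
        have "\<bar>real_of_int t - real_of_int t'\<bar> < 1" using that \<psi> unfolding I by linarith
        then show False using \<open>t \<noteq> t'\<close> by linarith
      qed
      then show "I t \<inter> I t' = {}" by blast
    qed
    have "ennreal (\<psi> * h / 16) \<le> ennreal (real (card T) * (2 * \<psi> / m))"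
    proof (intro ennreal_leI)
      have "h * m / 2 \<le> h * m - 4" using hm by simp
      then have "real (card T) \<ge> h * m / 32" using cardT L by linarith
      then have "real (card T) * (2 * \<psi> / m) \<ge> h * m / 32 * (2 * \<psi> / m)" using \<psi> m0 by (intro mult_right_mono) auto
      then show "\<psi> * h / 16 \<le> real (card T) * (2 * \<psi> / m)" using m0 by (simp add: field_simps)
    qed
    also have "\<dots> = (\<Sum>t\<in>T. ennreal (2 * \<psi> / m))"
      using \<psi> m0 by (simp add: ennreal_mult ennreal_of_nat_eq_real_of_nat del: times_divide_eq_right)
    also have "\<dots> = (\<Sum>t\<in>T. emeasure lborel (I t))"
      using \<psi> m0 by (intro sum.cong) (simp_all add: I_def diff_divide_distrib[symmetric] divide_right_mono)
    also have "\<dots> = emeasure lborel (\<Union>t\<in>T. I t)"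
    proof (rule sum_emeasure)
      show "I ` T \<subseteq> sets lborel" by (auto simp: I_def)
    qed fact+
    also have "\<dots> \<le> emeasure lborel {x. 0 \<le> x \<and> x < h \<and> (\<exists>t::int. coprime t (int s) \<and> \<bar>c + x * m + of_int t\<bar> \<le> \<psi>)}"
    proof (intro emeasure_mono subsetI)
      fix x assume "x \<in> (\<Union>t\<in>T. I t)"
      then obtain t where t: "t \<in> T" "\<bar>c + x * m + of_int t\<bar> \<le> \<psi>" by (auto simp: I)
      have "a + 1 \<le> t" "t \<le> a + int L" using t(1) unfolding T_def by auto
      then have "of_int a + 1 \<le> real_of_int t" "real_of_int t \<le> of_int a + real L" by linarith+
      moreover have "- c - h * m \<le> of_int a" "of_int a < - c - h * m + 1" unfolding a_def by linarith+
      ultimately have "of_int t \<ge> - c - h * m + 1" "of_int t \<le> - c - 2"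
        using L(2) by linarith+
      then have "0 \<le> x * m" "x * m < h * m" using t(2) \<psi> by linarith+
      then have "0 \<le> x" "x < h" using m0 by (simp_all add: zero_le_mult_iff)
      then show "x \<in> {x. 0 \<le> x \<and> x < h \<and> (\<exists>t::int. coprime t (int s) \<and> \<bar>c + x * m + of_int t\<bar> \<le> \<psi>)}"
        using t by (auto simp: T_def)
    qed measurable
    finally show "ennreal (\<psi> * h / 16) \<le> emeasure lborel
      {x. 0 \<le> x \<and> x < h \<and> (\<exists>t::int. coprime t (int s) \<and> \<bar>c + x * m + of_int t\<bar> \<le> \<psi>)}" .
  qed
qed

section \<open>Translations of a single column\<close>

definition column_matrix :: "'k \<Rightarrow> real ^ 'n \<Rightarrow> real ^ 'k ^ 'n" where
  "column_matrix l \<tau> = (\<chi> i k. if k = l then \<tau> $ i else 0)"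

lemma add_column_matrix_vector:
  fixes u :: "real ^ 'k" and X :: "real ^ 'k ^ 'n"
  shows "((X + column_matrix l \<tau>) *v u) $ i = (X *v u) $ i + \<tau> $ i * u $ l"
proof -
  have "(column_matrix l \<tau> *v u) $ i = \<tau> $ i * u $ l"
    by (simp add: column_matrix_def matrix_vector_mult_def if_distrib[of "\<lambda>x. x * _"] cong: if_cong)
  then show ?thesis by (simp add: matrix_vector_mult_add_rdistrib)
qed

lemma column_matrix_borel_measurable [measurable]:
  "(column_matrix l :: real ^ 'n \<Rightarrow> real ^ 'k ^ 'n) \<in> borel_measurable borel"
proof -
  have "linear (column_matrix l :: real ^ 'n \<Rightarrow> real ^ 'k ^ 'n)"
    by (rule linearI) (auto simp: column_matrix_def vec_eq_iff)
  then show ?thesis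
    by (intro borel_measurable_continuous_onI linear_continuous_on) (simp add: linear_conv_bounded_linear)
qed

text \<open>Translating a single column reduces estimates for matrices to one variable in each row.\<close>

lemma emeasure_column_translations:
  fixes E :: "(real ^ 'k ^ 'n) set" and T :: "(real ^ 'n) set"
  assumes [measurable]: "E \<in> sets borel" "T \<in> sets borel"
  shows "{\<tau> \<in> T. X + column_matrix l \<tau> \<in> E} \<in> sets borel"
    and "emeasure lborel E * emeasure lborel T
      = (\<integral>\<^sup>+X. emeasure lborel {\<tau> \<in> T. X + column_matrix l \<tau> \<in> E} \<partial>lborel)"
proof -
  define f :: "real ^ 'k ^ 'n \<Rightarrow> real ^ 'n \<Rightarrow> ennreal" where
    "f X \<tau> = indicator T \<tau> * indicator E (X + column_matrix l \<tau>)" for X \<tau>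
  have fm: "(\<lambda>(X, \<tau>). f X \<tau>) \<in> borel_measurable (lborel \<Otimes>\<^sub>M lborel)"
  proof -
    have "(\<lambda>(X, \<tau>). f X \<tau>) \<in> borel_measurable (borel \<Otimes>\<^sub>M borel)" unfolding f_def by measurable
    also have "borel_measurable (borel \<Otimes>\<^sub>M borel)
        = borel_measurable ((lborel :: (real ^ 'k ^ 'n) measure) \<Otimes>\<^sub>M (lborel :: (real ^ 'n) measure))"
      by (intro measurable_cong_sets sets_pair_measure_cong) (simp_all only: sets_lborel)
    finally show ?thesis .
  qed
  have m: "{\<tau> \<in> T. X + column_matrix l \<tau> \<in> E} \<in> sets borel" for X
  proof -
    have "(\<lambda>\<tau>. X + column_matrix l \<tau>) -` E \<inter> space borel \<in> sets borel"
      by (rule measurable_sets[of _ _ borel]) measurable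
    then have "T \<inter> (\<lambda>\<tau>. X + column_matrix l \<tau>) -` E \<in> sets borel" using assms(2) by simp
    then show ?thesis by (rule back_subst[of "\<lambda>S. S \<in> sets borel"]) auto
  qed
  then show "{\<tau> \<in> T. X + column_matrix l \<tau> \<in> E} \<in> sets borel" .
  have "emeasure lborel E * emeasure lborel T = (\<integral>\<^sup>+\<tau>. emeasure lborel E * indicator T \<tau> \<partial>lborel)"
    by (simp add: nn_integral_cmult_indicator)
  also have "\<dots> = (\<integral>\<^sup>+\<tau>. (\<integral>\<^sup>+X. f X \<tau> \<partial>lborel) \<partial>lborel)"
  proof (intro nn_integral_cong)
    fix \<tau> :: "real ^ 'n"
    have "(\<integral>\<^sup>+X. f X \<tau> \<partial>lborel) = (\<integral>\<^sup>+X. indicator T \<tau> * indicator {X. X + column_matrix l \<tau> \<in> E} X \<partial>lborel)"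
      by (intro nn_integral_cong) (auto simp: f_def indicator_def)
    also have "\<dots> = indicator T \<tau> * emeasure lborel {X. X + column_matrix l \<tau> \<in> E}"
      using borel_shift[OF assms(1)] by (subst nn_integral_cmult_indicator) auto
    also have "emeasure lborel {X. X + column_matrix l \<tau> \<in> E} = emeasure lborel E"
      using assms by (intro emeasure_lborel_shift) simp
    finally show "emeasure lborel E * indicator T \<tau> = (\<integral>\<^sup>+X. f X \<tau> \<partial>lborel)"
      by (simp add: mult.commute)
  qed
  also have "\<dots> = (\<integral>\<^sup>+X. (\<integral>\<^sup>+\<tau>. f X \<tau> \<partial>lborel) \<partial>lborel)"
    by (rule lborel_pair.Fubini'[OF fm])
  also have "\<dots> = (\<integral>\<^sup>+X. emeasure lborel {\<tau> \<in> T. X + column_matrix l \<tau> \<in> E} \<partial>lborel)"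
  proof (intro nn_integral_cong)
    fix X :: "real ^ 'k ^ 'n"
    have "(\<integral>\<^sup>+\<tau>. f X \<tau> \<partial>lborel) = (\<integral>\<^sup>+\<tau>. indicator {\<tau> \<in> T. X + column_matrix l \<tau> \<in> E} \<tau> \<partial>lborel)"
      by (intro nn_integral_cong) (auto simp: f_def indicator_def)
    then show "(\<integral>\<^sup>+\<tau>. f X \<tau> \<partial>lborel) = emeasure lborel {\<tau> \<in> T. X + column_matrix l \<tau> \<in> E}"
      using m by simp
  qed
  finally show "emeasure lborel E * emeasure lborel T
      = (\<integral>\<^sup>+X. emeasure lborel {\<tau> \<in> T. X + column_matrix l \<tau> \<in> E} \<partial>lborel)" .
qed

lemma cell_matrix:
  "cell j (X :: real ^ 'k ^ 'n) = {Y. \<forall>i l. \<lfloor>2 ^ j * Y $ i $ l\<rfloor> = \<lfloor>2 ^ j * X $ i $ l\<rfloor>}"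
  by (auto simp: cell_def Basis_vec_def inner_axis)

text \<open>Starting points X are confined to a subcell \<open>B\<close> of half the side, so that
  translations by less than half the side stay inside the cell; this costs the factor 2^(kn), with k
  columns. For fixed X the condition splits over the rows into one-variable conditions on the
  entries of \<tau>, each of measure at least \<delta>.\<close>

lemma local_lower_bound:
  fixes u :: "real ^ 'k" and x :: "real ^ 'k ^ 'n" and P :: "'n \<Rightarrow> int set"
  assumes \<delta>: "\<delta> \<ge> 0"
    and one: "\<And>i c. ennreal \<delta> \<le> emeasure lborel {x. 0 \<le> x \<and> x < 1 / 2 ^ Suc j \<and> (\<exists>t\<in>P i. \<bar>c + x * (u $ l) + of_int t\<bar> \<le> \<psi>)}"
  shows "(\<delta> * 2 ^ Suc j) ^ CARD('n) / 2 ^ (CARD('k) * CARD('n)) * measure lborel (cell j x)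
     \<le> measure lborel ({X. \<forall>i. \<exists>t\<in>P i. \<bar>(X *v u) $ i + of_int t\<bar> \<le> \<psi>} \<inter> cell j x)"
proof -
  define A where "A = {X :: real ^ 'k ^ 'n. \<forall>i. \<exists>t\<in>P i. \<bar>(X *v u) $ i + of_int t\<bar> \<le> \<psi>}"
  have [measurable]: "A \<in> sets borel" unfolding A_def by measurable
  define E where "E = A \<inter> cell j x"
  have E [measurable]: "E \<in> sets borel" unfolding E_def by measurable
  \<comment> \<open>The corner of the cell with least coordinates; translations by nonnegative
    amounts start from the subcell at this corner.\<close>
  define x0 :: "real ^ 'k ^ 'n" where "x0 = (\<chi> i l. of_int \<lfloor>2 ^ j * x $ i $ l\<rfloor> / 2 ^ j)"
  define B where "B = cell (Suc j) x0"
  define T where "T = (cell (Suc j) 0 :: (real ^ 'n) set)"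
  have Tm: "T \<in> sets borel" by (simp add: T_def)
  have T: "\<tau> \<in> T \<longleftrightarrow> (\<forall>i. 0 \<le> \<tau> $ i \<and> \<tau> $ i < 1 / 2 ^ Suc j)" for \<tau>
  proof -
    have "\<tau> \<in> T \<longleftrightarrow> (\<forall>i. \<lfloor>2 ^ Suc j * \<tau> $ i\<rfloor> = 0)" by (auto simp: T_def cell_def Basis_vec_def inner_axis)
    also have "\<dots> \<longleftrightarrow> (\<forall>i. 0 \<le> \<tau> $ i \<and> \<tau> $ i < 1 / 2 ^ Suc j)"
      using floor_eq_interval[of "Suc j" 0] by (simp add: set_eq_iff)
    finally show ?thesis .
  qed
  have sub: "X + column_matrix l \<tau> \<in> cell j x" if "X \<in> B" "\<tau> \<in> T" for X \<tau>
    unfolding cell_matrix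
  proof (intro CollectI allI)
    fix i k
    define z where "z = \<lfloor>2 ^ j * x $ i $ k\<rfloor>"
    let ?c = "column_matrix l \<tau> $ i $ k"
    have "\<lfloor>2 ^ Suc j * X $ i $ k\<rfloor> = \<lfloor>2 ^ Suc j * x0 $ i $ k\<rfloor>" using that by (simp add: B_def cell_matrix)
    also have "\<dots> = \<lfloor>real_of_int (2 * z)\<rfloor>" by (simp add: x0_def z_def mult.assoc)
    also have "\<dots> = 2 * z" by (rule floor_of_int)
    finally have "2 * of_int z \<le> 2 * (2 ^ j * X $ i $ k)" "2 * (2 ^ j * X $ i $ k) < 2 * of_int z + 1"
      by (simp_all add: floor_eq_iff mult.assoc)
    moreover have "0 \<le> 2 ^ j * ?c" "2 * (2 ^ j * ?c) < 1"
      using that T[of \<tau>] by (auto simp: column_matrix_def field_simps)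
    ultimately have "\<lfloor>2 ^ j * X $ i $ k + 2 ^ j * ?c\<rfloor> = z"
      unfolding floor_eq_iff by linarith
    then show "\<lfloor>2 ^ j * (X + column_matrix l \<tau>) $ i $ k\<rfloor> = \<lfloor>2 ^ j * x $ i $ k\<rfloor>"
      by (simp add: z_def distrib_left)
  qed
  have "ennreal (\<delta> ^ CARD('n)) * emeasure lborel B = (\<integral>\<^sup>+X. ennreal (\<delta> ^ CARD('n)) * indicator B X \<partial>lborel)"
    by (simp add: nn_integral_cmult_indicator B_def)
  also have "\<dots> \<le> (\<integral>\<^sup>+X. emeasure lborel {\<tau> \<in> T. X + column_matrix l \<tau> \<in> E} \<partial>lborel)"
  proof (intro nn_integral_mono)
    fix X :: "real ^ 'k ^ 'n"
    define V where "V i = {x. 0 \<le> x \<and> x < 1 / 2 ^ Suc j \<and> (\<exists>t\<in>P i. \<bar>(X *v u) $ i + x * (u $ l) + of_int t\<bar> \<le> \<psi>)}" for i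
    have Vm: "V i \<in> sets borel" for i unfolding V_def by measurable
    have "ennreal (\<delta> ^ CARD('n)) \<le> emeasure lborel {\<tau> \<in> T. X + column_matrix l \<tau> \<in> E}" if "X \<in> B"
    proof -
      have "ennreal (\<delta> ^ CARD('n)) = (\<Prod>i\<in>(UNIV::'n set). ennreal \<delta>)" using \<delta> by (simp add: ennreal_power)
      also have "\<dots> \<le> (\<Prod>i\<in>(UNIV::'n set). emeasure lborel (V i))"
        unfolding V_def by (intro prod_mono_ennreal one)
      also have "\<dots> = emeasure lborel {\<tau> :: real ^ 'n. \<forall>i. \<tau> $ i \<in> V i}"
        using Vm by (rule emeasure_lborel_product_vec[symmetric])
      also have "\<dots> \<le> emeasure lborel {\<tau> \<in> T. X + column_matrix l \<tau> \<in> E}"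
        using emeasure_column_translations(1)[OF E Tm] sub[OF that]
        by (intro emeasure_mono subsetI) (auto simp: E_def A_def T V_def add_column_matrix_vector)
      finally show ?thesis .
    qed
    then show "ennreal (\<delta> ^ CARD('n)) * indicator B X \<le> emeasure lborel {\<tau> \<in> T. X + column_matrix l \<tau> \<in> E}"
      by (simp add: indicator_def)
  qed
  also have "\<dots> = emeasure lborel E * emeasure lborel T"
    by (rule emeasure_column_translations(2)[OF E Tm, symmetric])
  also have "emeasure lborel E = ennreal (measure lborel E)"
  proof (intro emeasure_eq_ennreal_measure)
    have "emeasure lborel E \<le> emeasure lborel (cell j x)" unfolding E_def by (intro emeasure_mono) auto
    then show "emeasure lborel E \<noteq> top" by (auto simp: emeasure_cell top_unique)
  qed
  finally have "\<delta> ^ CARD('n) * (1 / 2 ^ Suc j) ^ (CARD('k) * CARD('n)) \<le> measure lborel E * (1 / 2 ^ Suc j) ^ CARD('n)"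
    unfolding T_def B_def emeasure_cell using \<delta> by (simp add: ennreal_mult[symmetric] mult.commute)
  then have "\<delta> ^ CARD('n) * (2 ^ Suc j) ^ CARD('n) * (1 / 2 ^ Suc j) ^ (CARD('k) * CARD('n)) \<le> measure lborel E"
    by (simp add: power_one_over field_simps)
  moreover have "(1 / 2 ^ Suc j :: real) ^ (CARD('k) * CARD('n)) = (1 / 2 ^ j) ^ (CARD('k) * CARD('n)) / 2 ^ (CARD('k) * CARD('n)) "
    by (simp add: power_one_over power_mult_distrib)
  ultimately show ?thesis unfolding A_def[symmetric] E_def[symmetric] measure_cell
    by (simp add: power_mult_distrib mult.commute)
qed

text \<open>The modulus depends on the row because the coordinates of p may lie in different blocks,
  with different leading entries.\<close>

definition coprime_near :: "real ^ 'k \<Rightarrow> ('n \<Rightarrow> nat) \<Rightarrow> real \<Rightarrow> (real ^ 'k ^ 'n) set" where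
  "coprime_near u s \<psi> = {X. \<forall>r. \<exists>t\<in>{t. coprime t (int (s r))}. \<bar>(X *v u) $ r + of_int t\<bar> \<le> \<psi>}"

lemma coprime_near_measurable [measurable, simp]: "coprime_near u s \<psi> \<in> sets borel"
  unfolding coprime_near_def by measurable

text \<open>The one-variable bound with h = 2^-(j+1) in each row; relative to the side of the
  subcell it becomes \<psi>/16 per row. The threshold R depends on the level j but not on the
  cell.\<close>

lemma measure_coprime_near_lower_bound:
  obtains R where "\<And>(u :: real ^ 'k) l s \<psi> x. R \<le> u $ l \<Longrightarrow> 0 \<le> \<psi> \<Longrightarrow> \<psi> < 1 / 2 \<Longrightarrow>
      (\<And>r. few_factors (s r) \<and> s r > 0 \<and> real (s r) \<le> u $ l) \<Longrightarrow>
    \<psi> ^ CARD('n) / (16 ^ CARD('n) * 2 ^ (CARD('k) * CARD('n))) * measure lborel (cell j x)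
      \<le> measure lborel (coprime_near u s \<psi> \<inter> cell j (x :: real ^ 'k ^ 'n))"
proof -
  have "(0::real) < 1 / 2 ^ Suc j" by simp
  from coprime_near_lower_bound[OF this]
  obtain R where R: "\<And>m s c \<psi>. m \<ge> R \<Longrightarrow> few_factors s \<Longrightarrow> s > 0 \<Longrightarrow> real s \<le> m \<Longrightarrow> 0 \<le> \<psi> \<Longrightarrow> \<psi> < 1 / 2 \<Longrightarrow>
      ennreal (\<psi> * (1 / 2 ^ Suc j) / 16) \<le> emeasure lborel {x. 0 \<le> x \<and> x < 1 / 2 ^ Suc j \<and> (\<exists>t::int. coprime t (int s) \<and> \<bar>c + x * m + of_int t\<bar> \<le> \<psi>)}"
    by blast
  show thesis
  proof (rule that)
    fix u :: "real ^ 'k" and s :: "'n \<Rightarrow> nat" and \<psi> :: real and l and x :: "real ^ 'k ^ 'n"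
    assume u: "R \<le> u $ l" and \<psi>: "0 \<le> \<psi>" "\<psi> < 1 / 2" and s: "\<And>r. few_factors (s r) \<and> s r > 0 \<and> real (s r) \<le> u $ l"
    have "(\<psi> * (1 / 2 ^ Suc j) / 16 * 2 ^ Suc j) ^ CARD('n) / 2 ^ (CARD('k) * CARD('n)) * measure lborel (cell j x)
       \<le> measure lborel (coprime_near u s \<psi> \<inter> cell j x)"
      unfolding coprime_near_def
    proof (rule local_lower_bound[where l = l])
      show "0 \<le> \<psi> * (1 / 2 ^ Suc j) / 16" using \<psi> by simp
      fix r c
      show "ennreal (\<psi> * (1 / 2 ^ Suc j) / 16) \<le> emeasure lborel {x. 0 \<le> x \<and> x < 1 / 2 ^ Suc j \<and>
          (\<exists>t\<in>{t. coprime t (int (s r))}. \<bar>c + x * u $ l + of_int t\<bar> \<le> \<psi>)}"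
        using R[OF u, of "s r" \<psi> c] s[of r] \<psi> by simp
    qed
    then show "\<psi> ^ CARD('n) / (16 ^ CARD('n) * 2 ^ (CARD('k) * CARD('n))) * measure lborel (cell j x)
      \<le> measure lborel (coprime_near u s \<psi> \<inter> cell j x)"
      by (simp add: power_divide)
  qed
qed

section \<open>A Khintchine-Groshev theorem for pairwise independent vectors\<close>

lemma nonsummable_finite_sums:
  fixes f :: "'i \<Rightarrow> real"
  assumes ns: "\<not> f summable_on U" and nn: "\<And>i. i \<in> U \<Longrightarrow> f i \<ge> 0" and G: "finite G"
  shows "\<exists>F. finite F \<and> F \<subseteq> U - G \<and> R \<le> sum f F"
proof (rule ccontr)
  assume *: "\<not> (\<exists>F. finite F \<and> F \<subseteq> U - G \<and> R \<le> sum f F)"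
  have "f summable_on (U - G)"
  proof (rule nonneg_bdd_above_summable_on)
    show "bdd_above (sum f ` {F. F \<subseteq> U - G \<and> finite F})"
      using * by (intro bdd_aboveI[of _ R]) (auto simp: not_le intro: less_imp_le)
  qed (use nn in auto)
  moreover have "f summable_on (U \<inter> G)" using G by (intro summable_on_finite) auto
  ultimately have "f summable_on ((U - G) \<union> (U \<inter> G))" by (rule summable_on_union)
  also have "(U - G) \<union> (U \<inter> G) = U" by auto
  finally show False using ns by simp
qed

text \<open>The lower bound uses the events \<open>A i\<close> with coprimality, the upper bound the
  larger events \<open>E i\<close> without it, which are pairwise independent on unit cells. A
  modulus is kept below the entry at \<open>l i\<close> because that entry is proportional to the
  number of integers among which coprime ones are sought. On a given level the lower bound holds for
  all but finitely many indices, by the finiteness assumption.\<close>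

theorem Khintchine_Groshev_pairwise_independent:
  fixes u :: "'i \<Rightarrow> real ^ 'k" and s :: "'i \<Rightarrow> 'n::finite \<Rightarrow> nat" and \<psi> :: "'i \<Rightarrow> real" and l :: "'i \<Rightarrow> 'k"
  assumes U: "countable U" and k: "a \<noteq> (b :: 'k)"
    and lat: "\<And>i. i \<in> U \<Longrightarrow> u i \<in> lattice"
    and ind: "\<And>i j. i \<in> U \<Longrightarrow> j \<in> U \<Longrightarrow> i \<noteq> j \<Longrightarrow> \<exists>a b. u i $ a * u j $ b \<noteq> u i $ b * u j $ a"
    and \<psi>: "\<And>i. i \<in> U \<Longrightarrow> 0 \<le> \<psi> i \<and> \<psi> i < 1 / 2"
    and s: "\<And>i r. i \<in> U \<Longrightarrow> few_factors (s i r) \<and> s i r > 0 \<and> real (s i r) \<le> u i $ l i"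
    and fin: "\<And>R. finite {i \<in> U. u i $ l i \<le> R}"
    and div: "\<not> (\<lambda>i. \<psi> i ^ CARD('n)) summable_on U"
  shows "AE X :: real ^ 'k ^ 'n in lborel. infinite {i \<in> U. X \<in> coprime_near (u i) (s i) (\<psi> i)}"
proof -
  define A where "A i = (coprime_near (u i) (s i) (\<psi> i) :: (real ^ 'k ^ 'n) set)" for i
  define E where "E i = {X :: real ^ 'k ^ 'n. X *v u i \<in> near_lattice (\<psi> i)}" for i
  have Em [measurable, simp]: "E i \<in> sets borel" for i unfolding E_def by measurable
  have Am [measurable, simp]: "A i \<in> sets borel" for i unfolding A_def by simp
  have AE: "A i \<subseteq> E i" for i
    unfolding A_def coprime_near_def E_def near_lattice_def Basis_vec_def by (auto simp: inner_axis)
  let ?n = "CARD('n)"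
  have "AE X in lborel. infinite {i \<in> U. X \<in> A i}"
  proof (rule divergence_Borel_Cantelli_local[where c = "1 / (16 ^ ?n * 2 ^ (CARD('k) * ?n))" and C = "4 ^ Suc ?n"])
    fix j and x :: "real ^ 'k ^ 'n" and F0 :: "'i set" assume F0: "finite F0"
    define B where "B = cell j x"
    have mB: "measure lborel B > 0" unfolding B_def measure_cell by simp
    obtain R where R: "\<And>u l s \<psi> x. R \<le> u $ l \<Longrightarrow> 0 \<le> \<psi> \<Longrightarrow> \<psi> < 1 / 2 \<Longrightarrow>
        (\<And>r. few_factors (s r) \<and> s r > 0 \<and> real (s r) \<le> u $ l) \<Longrightarrow>
      \<psi> ^ ?n / (16 ^ ?n * 2 ^ (CARD('k) * ?n)) * measure lborel (cell j x)
        \<le> measure lborel (coprime_near u s \<psi> \<inter> cell j (x :: real ^ 'k ^ 'n))"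
      using measure_coprime_near_lower_bound by blast
    have "finite (F0 \<union> {i \<in> U. u i $ l i \<le> R})" using F0 fin by auto
    \<comment> \<open>A sum of at least the inverse measure of B makes the diagonal term of the
      localised second moment no larger than the quadratic one; a smaller cell asks for a larger
      family.\<close>
    from nonsummable_finite_sums[OF div _ this, of "1 / measure lborel B"] \<psi>
    obtain F where F: "finite F" "F \<subseteq> U - (F0 \<union> {i \<in> U. u i $ l i \<le> R})"
      "1 / measure lborel B \<le> (\<Sum>i\<in>F. \<psi> i ^ ?n)" by fastforce
    define \<Psi> where "\<Psi> = (\<Sum>i\<in>F. \<psi> i ^ ?n)"
    have \<Psi>0: "\<Psi> > 0" using F(3) mB unfolding \<Psi>_def by (smt (verit) divide_pos_pos)
    have lower: "\<psi> i ^ ?n / (16 ^ ?n * 2 ^ (CARD('k) * ?n)) * measure lborel B \<le> measure lborel (A i \<inter> B)" if "i \<in> F" for i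
      using that F(2) \<psi> s unfolding A_def B_def by (intro R[where l = "l i"]) auto
    show "\<exists>F \<Psi>. finite F \<and> F \<subseteq> U - F0 \<and> \<Psi> > 0 \<and>
        1 / (16 ^ ?n * 2 ^ (CARD('k) * ?n)) * measure lborel (cell j x) * \<Psi> \<le> (\<Sum>u\<in>F. measure lborel (A u \<inter> cell j x)) \<and>
        (\<Sum>u\<in>F. \<Sum>v\<in>F. measure lborel (A u \<inter> A v \<inter> cell j x)) \<le> 4 ^ Suc ?n * measure lborel (cell j x) * \<Psi>\<^sup>2"
    proof (intro exI conjI)
      show "finite F" "F \<subseteq> U - F0" "\<Psi> > 0" using F \<Psi>0 by auto
      have "1 / (16 ^ ?n * 2 ^ (CARD('k) * ?n)) * measure lborel B * \<Psi>
        = (\<Sum>i\<in>F. \<psi> i ^ ?n / (16 ^ ?n * 2 ^ (CARD('k) * ?n)) * measure lborel B)"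
        unfolding \<Psi>_def by (simp add: sum_distrib_left sum_divide_distrib mult.commute)
      also have "\<dots> \<le> (\<Sum>u\<in>F. measure lborel (A u \<inter> B))" by (intro sum_mono lower)
      finally show "1 / (16 ^ ?n * 2 ^ (CARD('k) * ?n)) * measure lborel (cell j x) * \<Psi> \<le> (\<Sum>u\<in>F. measure lborel (A u \<inter> cell j x))"
        unfolding B_def .
      have fB: "emeasure lborel B < \<infinity>" by (simp add: B_def emeasure_cell)
      have "(\<Sum>u\<in>F. \<Sum>v\<in>F. measure lborel (A u \<inter> A v \<inter> B)) \<le> (\<Sum>u\<in>F. \<Sum>v\<in>F. measure lborel (E u \<inter> E v \<inter> B))"
      proof (intro sum_mono measure_mono_fmeasurable)
        fix v w
        have "B \<in> fmeasurable lborel" using fB by (intro fmeasurableI) (auto simp: B_def)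
        then show "E v \<inter> E w \<inter> B \<in> fmeasurable lborel"
          by (rule fmeasurableI2) (auto simp: B_def)
        show "A v \<inter> A w \<inter> B \<subseteq> E v \<inter> E w \<inter> B" using AE by blast
      qed (auto simp: B_def)
      also have "\<dots> \<le> 2 * (2 ^ ?n * \<Psi>) + 2 * (2 ^ ?n * \<Psi>)\<^sup>2 * measure lborel B"
      proof (rule pair_measure_localize[where Q = "cell 0 x" and \<mu> = "\<lambda>i. (2 * \<psi> i) ^ ?n"])
        have "cell j x \<subseteq> cell 0 x"
          by (induction j) (use cell_Suc_subset in blast)+
        then show "B \<subseteq> cell 0 x" unfolding B_def .
        fix i assume "i \<in> F"
        then have i: "i \<in> U" using F by auto
        have "u i $ l i > 0" using s[OF i] by (metis less_le_trans of_nat_0_less_iff)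
        then have "u i \<noteq> 0" by auto
        then have "emeasure lborel (cell 0 x \<inter> E i) = ennreal ((2 * \<psi> i) ^ ?n)"
          unfolding E_def using lat[OF i] k \<psi>[OF i] by (intro emeasure_near_lattice_matrix) auto
        then show "measure lborel (E i \<inter> cell 0 x) = (2 * \<psi> i) ^ ?n"
          using \<psi>[OF i] by (simp add: measure_def Int_commute)
        fix i' assume "i' \<in> F" "i \<noteq> i'"
        then have i': "i' \<in> U" using F by auto
        obtain a b where "u i $ a * u i' $ b \<noteq> u i $ b * u i' $ a" using ind[OF i i' \<open>i \<noteq> i'\<close>] by blast
        then have "emeasure lborel (cell 0 x \<inter> {X. X *v u i \<in> near_lattice (\<psi> i) \<and> X *v u i' \<in> near_lattice (\<psi> i')})
          = ennreal ((2 * \<psi> i) ^ ?n * (2 * \<psi> i') ^ ?n)"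
          using lat[OF i] lat[OF i'] \<psi>[OF i] \<psi>[OF i'] by (intro emeasure_pairwise_independent[of _ _ a b]) auto
        moreover have "E i \<inter> E i' \<inter> cell 0 x = cell 0 x \<inter> {X. X *v u i \<in> near_lattice (\<psi> i) \<and> X *v u i' \<in> near_lattice (\<psi> i')}"
          by (auto simp: E_def)
        ultimately show "measure lborel (E i \<inter> E i' \<inter> cell 0 x) = (2 * \<psi> i) ^ ?n * (2 * \<psi> i') ^ ?n"
          using \<psi>[OF i] \<psi>[OF i'] by (simp add: measure_def)
      next
        show "2 ^ ?n * \<Psi> = (\<Sum>u\<in>F. (2 * \<psi> u) ^ ?n)"
          by (simp add: \<Psi>_def power_mult_distrib sum_distrib_left)
      qed (use F in \<open>auto simp: B_def emeasure_cell\<close>)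
      also have "\<dots> \<le> 2 * (2 ^ ?n * \<Psi>)\<^sup>2 * measure lborel B + 2 * (2 ^ ?n * \<Psi>)\<^sup>2 * measure lborel B"
      proof (intro add_right_mono)
        have "1 \<le> \<Psi> * measure lborel B" using F(3) mB by (simp add: \<Psi>_def field_simps)
        moreover have "1 * (\<Psi> * measure lborel B) \<le> 2 ^ ?n * (\<Psi> * measure lborel B)"
          using \<Psi>0 mB by (intro mult_right_mono) auto
        ultimately have "1 \<le> 2 ^ ?n * \<Psi> * measure lborel B" by simp
        then have "2 * (2 ^ ?n * \<Psi>) * 1 \<le> 2 * (2 ^ ?n * \<Psi>) * (2 ^ ?n * \<Psi> * measure lborel B)"
          using \<Psi>0 by (intro mult_left_mono) auto
        then show "2 * (2 ^ ?n * \<Psi>) \<le> 2 * (2 ^ ?n * \<Psi>)\<^sup>2 * measure lborel B"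
          by (simp add: power2_eq_square mult_ac)
      qed
      also have "\<dots> = 4 ^ Suc ?n * measure lborel B * \<Psi>\<^sup>2"
      proof -
        have "((2::real) ^ ?n)\<^sup>2 = 4 ^ ?n" by (simp add: power_mult[symmetric] mult.commute[of _ 2]) (simp add: power_mult)
        then show ?thesis by (simp add: power_mult_distrib)
      qed
      finally show "(\<Sum>u\<in>F. \<Sum>v\<in>F. measure lborel (A u \<inter> A v \<inter> cell j x)) \<le> 4 ^ Suc ?n * measure lborel (cell j x) * \<Psi>\<^sup>2"
        unfolding B_def .
    qed
  qed (use U in auto)
  then show ?thesis unfolding A_def by simp
qed

section \<open>One column\<close>

text \<open>With g the gcd, the determinant is g times an integer h, nonzero and of size at most
  2\<Delta>/g, so h takes at most 4\<Delta>/g values. Given h, t is fixed modulo r/g and has at most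
  g + 1 places in the window; as g + 1 <= 2g, the gcd cancels. The value h = 0 could add about g
  pairs that \<Delta> does not control.\<close>

lemma card_determinant_pairs:
  fixes r r' :: nat and b :: int and \<Delta> :: real
  assumes r: "r > 0" "r' > 0" and \<Delta>: "\<Delta> \<ge> 0"
  defines "N \<equiv> {(t, t'). t \<in> {b..b + int r} \<and> t * int r' - t' * int r \<noteq> 0 \<and> \<bar>real_of_int (t * int r' - t' * int r)\<bar> \<le> 2 * \<Delta>}"
  shows "finite N" "real (card N) \<le> 8 * \<Delta>"
proof -
  define g where "g = gcd r r'"
  obtain \<alpha> \<beta> where ab: "r = g * \<alpha>" "r' = g * \<beta>" "coprime \<alpha> \<beta>" and g: "g > 0"
    using r gcd_coprime_exists[of r r'] unfolding g_def by (metis gcd_pos_nat mult.commute neq0_conv)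
  have a: "\<alpha> > 0" using r ab by (cases \<alpha>) auto
  define h where "h = (\<lambda>(t, t'). t * int \<beta> - t' * int \<alpha>)"
  define K where "K = \<lfloor>2 * \<Delta> / real g\<rfloor>"
  have K0: "K \<ge> 0" using \<Delta> g by (simp add: K_def)
  \<comment> \<open>A pair is encoded by h and by the period of length r/g containing t: two t with
    the same h are congruent modulo r/g, so equal quotients identify them.\<close>
  define f where "f = (\<lambda>(t, t'). (h (t, t'), (t - b) div int \<alpha>))"
  have gh: "t * int r' - t' * int r = int g * h (t, t')" for t t'
    by (simp add: ab h_def algebra_simps)
  have inj: "inj_on f N"
  proof (rule inj_onI)
    fix p1 p2 assume "f p1 = f p2"
    moreover obtain t1 t1' t2 t2' where p: "p1 = (t1, t1')" "p2 = (t2, t2')" by fastforce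
    ultimately have eq: "t1 * int \<beta> - t1' * int \<alpha> = t2 * int \<beta> - t2' * int \<alpha>"
      and d: "(t1 - b) div int \<alpha> = (t2 - b) div int \<alpha>" by (auto simp: f_def h_def)
    from eq have e: "(t1 - t2) * int \<beta> = (t1' - t2') * int \<alpha>" by (simp add: algebra_simps)
    then have "int \<alpha> dvd (t1 - t2) * int \<beta>" by simp
    then have "int \<alpha> dvd t1 - t2" using ab(3) by (simp add: coprime_dvd_mult_left_iff)
    then have "int \<alpha> dvd (t1 - b) - (t2 - b)" by simp
    then have "(t1 - b) mod int \<alpha> = (t2 - b) mod int \<alpha>" by (simp add: mod_eq_dvd_iff)
    with d have "t1 - b = t2 - b" by (metis div_mult_mod_eq)
    then have "t1 = t2" by simp
    with e a show "p1 = p2" by (simp add: p)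
  qed
  have sub: "f ` N \<subseteq> ({- K..K} - {0}) \<times> {0..int g}"
  proof (rule image_subsetI)
    fix p assume "p \<in> N"
    moreover obtain t t' where p: "p = (t, t')" by fastforce
    ultimately have t: "b \<le> t" "t \<le> b + int r" and n: "int g * h (t, t') \<noteq> 0" "\<bar>real_of_int (int g * h (t, t'))\<bar> \<le> 2 * \<Delta>"
      unfolding N_def gh by auto
    have "\<bar>real_of_int (h (t, t'))\<bar> \<le> 2 * \<Delta> / real g" using n(2) g by (simp add: abs_mult field_simps)
    then have "\<bar>h (t, t')\<bar> \<le> K" unfolding K_def by linarith
    moreover have "h (t, t') \<noteq> 0" using n by auto
    moreover have "0 \<le> (t - b) div int \<alpha>" using t a by (simp add: pos_imp_zdiv_nonneg_iff)
    moreover have "(t - b) div int \<alpha> \<le> int g"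
    proof -
      have "(t - b) div int \<alpha> \<le> (int g * int \<alpha>) div int \<alpha>" using t a ab by (intro zdiv_mono1) auto
      then show ?thesis using a by simp
    qed
    ultimately show "f p \<in> ({- K..K} - {0}) \<times> {0..int g}" by (auto simp: f_def p)
  qed
  have fin: "finite (({- K..K} - {0}) \<times> {0..int g})" by auto
  show "finite N" using inj_on_finite[OF inj sub fin] .
  have "card N \<le> card (({- K..K} - {0}) \<times> {0..int g})" by (rule card_inj_on_le[OF inj sub fin])
  also have "\<dots> = nat (2 * K) * (g + 1)"
  proof -
    have "card ({- K..K} - {0}) = nat (2 * K)" using K0 by (simp add: card_Diff_singleton nat_add_distrib)
    moreover have "card {0..int g} = g + 1" by (simp add: nat_add_distrib)
    ultimately show ?thesis by (simp only: card_cartesian_product)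
  qed
  finally have "real (card N) \<le> real (nat (2 * K) * (g + 1))" by (rule of_nat_mono)
  also have "\<dots> = 2 * of_int K * (real g + 1)" using K0 by (simp add: algebra_simps)
  also have "\<dots> \<le> 2 * (2 * \<Delta> / real g) * (real g + real g)"
    using g K0 \<Delta> by (intro mult_mono) (auto simp: K_def)
  also have "\<dots> = 8 * \<Delta>" using g by simp
  finally show "real (card N) \<le> 8 * \<Delta>" .
qed

text \<open>For a denominator 2^j r the endpoints of a cell of level j turn into the integers a r
  and (a + 1) r, and with \<psi> < 1/2 only the r + 1 integers between their negatives remain for t.
  This is why denominators are taken divisible by 2^j.\<close>

lemma near_window:
  fixes a :: int
  assumes "\<lfloor>2 ^ j * x\<rfloor> = a" "\<bar>x * real (2 ^ j * r) + of_int t\<bar> \<le> \<psi>" "\<psi> < 1 / 2" "r > 0"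
  shows "t \<in> {- (a + 1) * int r .. - (a + 1) * int r + int r}"
proof -
  have y: "of_int a \<le> 2 ^ j * x" "2 ^ j * x < of_int a + 1" using assms(1) by linarith+
  define Y where "Y = (2 ^ j * x) * real r"
  have "of_int a * real r \<le> Y" "Y \<le> (of_int a + 1) * real r"
    unfolding Y_def using y by (auto intro!: mult_right_mono)
  moreover have "\<bar>Y + of_int t\<bar> \<le> \<psi>" using assms(2) by (simp add: Y_def mult_ac)
  moreover have "real_of_int (- (a + 1) * int r) = - ((of_int a + 1) * real r)"
    "real_of_int (- (a * int r)) = - (of_int a * real r)"
    by (simp_all add: algebra_simps)
  ultimately have "real_of_int (- (a + 1) * int r) - 1 < of_int t" "of_int t < real_of_int (- (a * int r)) + 1"
    using assms(3) by linarith+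
  then have "- (a + 1) * int r - 1 < t" "t < - (a * int r) + 1" by linarith+
  then show ?thesis by (simp add: algebra_simps)
qed

lemma emeasure_le_card_mult:
  fixes S :: "real set" and \<mu> :: real
  assumes "finite N" "S \<subseteq> (\<Union>p\<in>N. I p)" "\<And>p. p \<in> N \<Longrightarrow> I p \<in> sets borel"
    "\<And>p. p \<in> N \<Longrightarrow> emeasure lborel (I p) \<le> ennreal \<mu>" "\<mu> \<ge> 0" "real (card N) \<le> c"
  shows "emeasure lborel S \<le> ennreal (c * \<mu>)"
proof -
  have "emeasure lborel S \<le> emeasure lborel (\<Union>p\<in>N. I p)"
    using assms by (intro emeasure_mono) (auto intro!: sets.finite_UN)
  also have "\<dots> \<le> (\<Sum>p\<in>N. emeasure lborel (I p))"
    using assms by (intro emeasure_subadditive_finite) auto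
  also have "\<dots> \<le> (\<Sum>p\<in>N. ennreal \<mu>)" using assms by (intro sum_mono)
  also have "\<dots> = ennreal (real (card N) * \<mu>)"
    using assms by (simp add: ennreal_mult ennreal_of_nat_eq_real_of_nat)
  also have "\<dots> \<le> ennreal (c * \<mu>)" using assms by (intro ennreal_leI mult_right_mono)
  finally show ?thesis .
qed

lemma near_interval:
  assumes "q > 0" "\<psi> \<ge> 0"
  shows "{x. \<bar>x * q + of_int t\<bar> \<le> \<psi>} \<in> sets borel"
    and "emeasure lborel {x. \<bar>x * q + of_int t\<bar> \<le> \<psi>} = ennreal (2 * \<psi> / q)"
proof -
  have "{x. \<bar>x * q + of_int t\<bar> \<le> \<psi>} = {(- of_int t - \<psi>) / q .. (- of_int t + \<psi>) / q}"
    using assms by (auto simp: field_simps abs_le_iff)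
  then show "{x. \<bar>x * q + of_int t\<bar> \<le> \<psi>} \<in> sets borel"
    "emeasure lborel {x. \<bar>x * q + of_int t\<bar> \<le> \<psi>} = ennreal (2 * \<psi> / q)"
    using assms by (simp_all add: diff_divide_distrib[symmetric] divide_right_mono)
qed

text \<open>There are r + 1 <= 2r numerators, each with an interval of length 2\<psi>/(2^j r), so r
  cancels.\<close>

lemma emeasure_near_single_le:
  fixes a :: int
  assumes r: "r > 0" and \<psi>: "0 \<le> \<psi>" "\<psi> < 1 / 2"
  shows "emeasure lborel {x. \<lfloor>2 ^ j * x\<rfloor> = a \<and> (\<exists>t\<in>P. \<bar>x * real (2 ^ j * r) + of_int t\<bar> \<le> \<psi>)} \<le> ennreal (4 * \<psi> / 2 ^ j)"
    (is "emeasure lborel ?S \<le> _")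
proof -
  define q where "q = real (2 ^ j * r)"
  have q: "q > 0" using r by (simp add: q_def)
  define T where "T = {- (a + 1) * int r .. - (a + 1) * int r + int r}"
  have "emeasure lborel ?S \<le> ennreal ((2 * real r) * (2 * \<psi> / q))"
  proof (rule emeasure_le_card_mult)
    show "?S \<subseteq> (\<Union>t\<in>T. {x. \<bar>x * q + of_int t\<bar> \<le> \<psi>})"
    proof
      fix x assume "x \<in> ?S"
      then obtain t where t: "\<lfloor>2 ^ j * x\<rfloor> = a" "\<bar>x * real (2 ^ j * r) + of_int t\<bar> \<le> \<psi>" by auto
      then have "t \<in> T" using near_window \<psi>(2) r unfolding T_def by blast
      then show "x \<in> (\<Union>t\<in>T. {x. \<bar>x * q + of_int t\<bar> \<le> \<psi>})" using t(2) unfolding q_def by blast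
    qed
    show "real (card T) \<le> 2 * real r" using r by (simp add: T_def nat_add_distrib)
  qed (use q \<psi> in \<open>auto simp: T_def near_interval\<close>)
  then show ?thesis using r by (simp add: q_def)
qed

text \<open>Coprimality makes the determinant \<open>t r' - t' r\<close> of two fractions non-zero, so that only
  the pairs counted above contribute.\<close>

lemma emeasure_near_pair_le:
  fixes a :: int
  assumes r: "r > 0" "r' > 0" "r \<noteq> r'" and \<psi>: "0 \<le> \<psi>" "\<psi> < 1 / 2" and \<psi>': "0 \<le> \<psi>'" "\<psi>' < 1 / 2"
  shows "emeasure lborel {x. \<lfloor>2 ^ j * x\<rfloor> = a
      \<and> (\<exists>t\<in>{t. coprime t (int (2 ^ j * r))}. \<bar>x * real (2 ^ j * r) + of_int t\<bar> \<le> \<psi>)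
      \<and> (\<exists>t\<in>{t. coprime t (int (2 ^ j * r'))}. \<bar>x * real (2 ^ j * r') + of_int t\<bar> \<le> \<psi>')} \<le> ennreal (16 * \<psi> * \<psi>' / 2 ^ j)"
    (is "emeasure lborel ?S \<le> _")
proof -
  define q q' where "q = real (2 ^ j * r)" and "q' = real (2 ^ j * r')"
  have q: "q > 0" "q' > 0" using r by (simp_all add: q_def q'_def)
  \<comment> \<open>The determinant t r' - t' r combines the two approximation errors and is at most
    2\<Delta>; the \<mu> below bounds the measure belonging to one pair. Up to scaling they are the
    maximum and the minimum of the same two quantities, so their product is explicit.\<close>
  define \<Delta> where "\<Delta> = max (\<psi> * real r') (\<psi>' * real r)"
  have \<Delta>: "\<Delta> \<ge> 0" using \<psi> by (simp add: \<Delta>_def le_max_iff_disj)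
  define b where "b = - (a + 1) * int r"
  define N where "N = {(t, t'). t \<in> {b..b + int r} \<and> t * int r' - t' * int r \<noteq> 0 \<and> \<bar>real_of_int (t * int r' - t' * int r)\<bar> \<le> 2 * \<Delta>}"
  have N: "finite N" "real (card N) \<le> 8 * \<Delta>"
    unfolding N_def using card_determinant_pairs[OF r(1,2) \<Delta>] by auto
  define I where "I p = {x. \<bar>x * q + of_int (fst p)\<bar> \<le> \<psi>} \<inter> {x. \<bar>x * q' + of_int (snd p)\<bar> \<le> \<psi>'}" for p :: "int \<times> int"
  define \<mu> where "\<mu> = min (2 * \<psi> / q) (2 * \<psi>' / q')"
  have \<mu>0: "\<mu> \<ge> 0" using q \<psi> \<psi>' by (simp add: \<mu>_def)
  have "?S \<subseteq> (\<Union>p\<in>N. I p)"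
  proof
    fix x assume "x \<in> ?S"
    then obtain t t' where x: "\<lfloor>2 ^ j * x\<rfloor> = a" and t: "coprime t (int (2 ^ j * r))" "\<bar>x * q + of_int t\<bar> \<le> \<psi>"
      and t': "coprime t' (int (2 ^ j * r'))" "\<bar>x * q' + of_int t'\<bar> \<le> \<psi>'" by (auto simp: q_def q'_def)
    have "t \<in> {b..b + int r}" using near_window[OF x, of r t \<psi>] t(2) \<psi> r unfolding b_def q_def by simp
    \<comment> \<open>Determinant 0 would make t/r and t'/r' the same fraction in lowest terms, with
      equal denominators.\<close>
    moreover have "t * int r' - t' * int r \<noteq> 0"
    proof
      assume "t * int r' - t' * int r = 0"
      then have e: "t * int r' = t' * int r" by simp
      have "coprime (int r) t" "coprime (int r') t'" using t(1) t'(1) by (simp_all add: coprime_commute)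
      then have "int r dvd int r'" "int r' dvd int r"
        using e by (metis coprime_dvd_mult_right_iff dvd_triv_right)+
      then have "r = r'" by (simp add: dvd_antisym)
      with r show False by simp
    qed
    moreover have "\<bar>real_of_int (t * int r' - t' * int r)\<bar> \<le> 2 * \<Delta>"
    proof -
      have "x * q * real r' = x * q' * real r" by (simp add: q_def q'_def)
      then have "real_of_int (t * int r' - t' * int r) = (x * q + of_int t) * real r' - (x * q' + of_int t') * real r"
        unfolding of_int_diff of_int_mult of_int_of_nat_eq distrib_right by linarith
      also have "\<bar>\<dots>\<bar> \<le> \<bar>x * q + of_int t\<bar> * real r' + \<bar>x * q' + of_int t'\<bar> * real r"
        by (rule order_trans[OF abs_triangle_ineq4]) (simp add: abs_mult)
      also have "\<dots> \<le> \<psi> * real r' + \<psi>' * real r" using t t' by (intro add_mono mult_right_mono) auto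
      also have "\<dots> \<le> 2 * \<Delta>" by (simp add: \<Delta>_def max_def)
      finally show ?thesis .
    qed
    ultimately have "(t, t') \<in> N" by (simp add: N_def)
    then show "x \<in> (\<Union>p\<in>N. I p)"
      using t(2) t'(2) by (intro UN_I[of "(t, t')"]) (simp_all add: I_def)
  qed
  moreover have "I p \<in> sets borel" for p unfolding I_def using q \<psi> \<psi>' by (intro sets.Int near_interval)
  moreover have "emeasure lborel (I p) \<le> ennreal \<mu>" for p
  proof -
    note n = near_interval[OF q(1) \<psi>(1), of "fst p"] near_interval[OF q(2) \<psi>'(1), of "snd p"]
    have "emeasure lborel (I p) \<le> emeasure lborel {x. \<bar>x * q + of_int (fst p)\<bar> \<le> \<psi>}"
      "emeasure lborel (I p) \<le> emeasure lborel {x. \<bar>x * q' + of_int (snd p)\<bar> \<le> \<psi>'}"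
      unfolding I_def using n(1,3) by (auto intro!: emeasure_mono)
    then show ?thesis unfolding n(2,4) \<mu>_def by (simp add: min_def)
  qed
  ultimately have "emeasure lborel ?S \<le> ennreal (8 * \<Delta> * \<mu>)"
    using N \<mu>0 by (intro emeasure_le_card_mult[of N])
  also have "8 * \<Delta> * \<mu> = 16 * \<psi> * \<psi>' / 2 ^ j"
  proof -
    have \<mu>: "\<mu> = 2 * min (\<psi> * real r') (\<psi>' * real r) / (2 ^ j * real r * real r')"
      using r by (simp add: \<mu>_def q_def q'_def min_def field_simps)
    have "8 * \<Delta> * \<mu> = 16 * (\<Delta> * min (\<psi> * real r') (\<psi>' * real r)) / (2 ^ j * real r * real r')"
      unfolding \<mu> by simp
    also have "\<Delta> * min (\<psi> * real r') (\<psi>' * real r) = \<psi> * real r' * (\<psi>' * real r)"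
      by (simp add: \<Delta>_def min_def max_def)
    also have "16 * (\<psi> * real r' * (\<psi>' * real r)) / (2 ^ j * real r * real r') = 16 * \<psi> * \<psi>' / 2 ^ j"
      using r by (simp add: field_simps)
    finally show ?thesis .
  qed
  finally show ?thesis .
qed

text \<open>Divergence is required along the multiples of every 2^j because the overlap estimate on
  a cell of level j is for denominators divisible by 2^j. With one column a matrix is a vector of
  independent coordinates, so all overlaps factor over the rows.\<close>

theorem Khintchine_coprime_one_column:
  fixes U :: "nat set" and \<psi> :: "nat \<Rightarrow> real" and l :: "'k::finite"
  assumes l: "\<And>j. j = l"
    and U: "\<And>q. q \<in> U \<Longrightarrow> q > 0 \<and> few_factors q \<and> 0 \<le> \<psi> q \<and> \<psi> q < 1 / 2"
    and div: "\<And>j. \<not> (\<lambda>q. \<psi> q ^ CARD('n::finite)) summable_on {q \<in> U. 2 ^ j dvd q}"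
  shows "AE X :: real ^ 'k ^ 'n in lborel. infinite {q \<in> U. \<forall>r. \<exists>t\<in>{t. coprime t (int q)}. \<bar>X $ r $ l * real q + of_int t\<bar> \<le> \<psi> q}"
proof -
  define A where "A q = {X :: real ^ 'k ^ 'n. \<forall>r. \<exists>t\<in>{t. coprime t (int q)}. \<bar>X $ r $ l * real q + of_int t\<bar> \<le> \<psi> q}" for q
  have Am [measurable, simp]: "A q \<in> sets borel" for q
    unfolding A_def by measurable
  have UNIV_l: "(UNIV :: 'k set) = {l}" using l by blast
  have k1: "CARD('k) = 1" by (simp add: UNIV_l)
  let ?n = "CARD('n)"
  have "AE X in lborel. infinite {q \<in> U. X \<in> A q}"
  proof (rule divergence_Borel_Cantelli_local[where c = "1 / (16 ^ ?n * 2 ^ ?n)" and C = "2 * 16 ^ ?n"])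
    fix j and x :: "real ^ 'k ^ 'n" and F0 :: "nat set" assume F0: "finite F0"
    define B where "B = cell j x"
    have mB: "measure lborel B = (1 / 2 ^ j) ^ ?n" unfolding B_def measure_cell by (simp add: k1)
    obtain R where R: "\<And>u l s \<psi> x. R \<le> u $ l \<Longrightarrow> 0 \<le> \<psi> \<Longrightarrow> \<psi> < 1 / 2 \<Longrightarrow>
        (\<And>r. few_factors (s r) \<and> s r > 0 \<and> real (s r) \<le> u $ l) \<Longrightarrow>
      \<psi> ^ ?n / (16 ^ ?n * 2 ^ (CARD('k) * ?n)) * measure lborel (cell j x)
        \<le> measure lborel (coprime_near u s \<psi> \<inter> cell j (x :: real ^ 'k ^ 'n))"
      using measure_coprime_near_lower_bound by blast
    have "finite {q. real q \<le> R}"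
      by (rule finite_subset[of _ "{..nat \<lfloor>R\<rfloor>}"]) (auto simp: le_nat_floor)
    then have "finite (F0 \<union> {q. real q \<le> R})" using F0 by simp
    \<comment> \<open>A sum of at least 1 suffices on every level, since here the diagonal bound
      already carries the measure of B as a factor.\<close>
    from nonsummable_finite_sums[OF div[of j] _ this, of 1] U
    obtain F where F: "finite F" "F \<subseteq> {q \<in> U. 2 ^ j dvd q} - (F0 \<union> {q. real q \<le> R})"
      "1 \<le> (\<Sum>q\<in>F. \<psi> q ^ ?n)" by auto
    define \<Psi> where "\<Psi> = (\<Sum>q\<in>F. \<psi> q ^ ?n)"
    have FU: "q \<in> U" "real q \<ge> R" "2 ^ j dvd q" if "q \<in> F" for q using F(2) that by auto
    have lower: "\<psi> q ^ ?n / (16 ^ ?n * 2 ^ ?n) * measure lborel B \<le> measure lborel (A q \<inter> B)" if "q \<in> F" for q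
    proof -
      note q = FU[OF that]
      have "A q = coprime_near (\<chi> _. real q) (\<lambda>_. q) (\<psi> q)"
        by (simp add: A_def coprime_near_def matrix_vector_mult_def UNIV_l)
      then show ?thesis
        using R[of "\<chi> _. real q" l "\<psi> q" "\<lambda>_. q" x] q U[OF q(1)] by (simp add: B_def k1)
    qed
    define near where "near q y \<longleftrightarrow> (\<exists>t\<in>{t. coprime t (int q)}. \<bar>y * real q + of_int t\<bar> \<le> \<psi> q)" for q and y :: real
    define S where "S q q' i = {y. \<lfloor>2 ^ j * y\<rfloor> = \<lfloor>2 ^ j * x $ i $ l\<rfloor> \<and> near q y \<and> near q' y}" for q q' i
    have prod: "emeasure lborel (A q \<inter> A q' \<inter> B) = (\<Prod>i\<in>UNIV. emeasure lborel (S q q' i))" for q q'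
    proof -
      have "A q \<inter> A q' \<inter> B = {X. \<forall>i. X $ i $ l \<in> S q q' i}"
      proof -
        have "(\<forall>i k. \<lfloor>2 ^ j * X $ i $ k\<rfloor> = \<lfloor>2 ^ j * x $ i $ k\<rfloor>) \<longleftrightarrow> (\<forall>i. \<lfloor>2 ^ j * X $ i $ l\<rfloor> = \<lfloor>2 ^ j * x $ i $ l\<rfloor>)"
          for X :: "real ^ 'k ^ 'n" using l by metis
        then show ?thesis unfolding A_def B_def cell_matrix S_def near_def by auto
      qed
      moreover have "S q q' i \<in> sets borel" for i unfolding S_def near_def by measurable
      ultimately show ?thesis using l by (simp add: emeasure_lborel_product_column)
    qed
    have prod_le: "measure lborel (A q \<inter> A q' \<inter> B) \<le> \<delta> ^ ?n"
      if "\<And>i. emeasure lborel (S q q' i) \<le> ennreal \<delta>" "\<delta> \<ge> 0" for q q' \<delta>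
    proof -
      have "emeasure lborel (A q \<inter> A q' \<inter> B) \<le> (\<Prod>i\<in>(UNIV::'n set). ennreal \<delta>)"
        unfolding prod by (intro prod_mono_ennreal that)
      also have "\<dots> = ennreal (\<delta> ^ ?n)" using that by (simp add: ennreal_power)
      finally show ?thesis using that(2) unfolding measure_def by (simp add: enn2real_leI)
    qed
    have pair: "measure lborel (A q \<inter> A q' \<inter> B) \<le> 16 ^ ?n * measure lborel B * (\<psi> q ^ ?n * \<psi> q' ^ ?n)
        + (if q' = q then 16 ^ ?n * measure lborel B * \<psi> q ^ ?n else 0)" if q: "q \<in> F" and q': "q' \<in> F" for q q'
    proof -
      obtain r r' where r: "q = 2 ^ j * r" "q' = 2 ^ j * r'"
        using FU(3)[OF q] FU(3)[OF q'] by (auto simp: dvd_def)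
      have \<psi>: "0 \<le> \<psi> q" "\<psi> q < 1 / 2" "0 \<le> \<psi> q'" "\<psi> q' < 1 / 2" and pos: "r > 0" "r' > 0"
        using U[OF FU(1)[OF q]] U[OF FU(1)[OF q']] r by auto
      have nn: "0 \<le> 16 ^ ?n * measure lborel B * (\<psi> q ^ ?n * \<psi> q' ^ ?n)" using \<psi> by simp
      show ?thesis
      proof (cases "q' = q")
        case True
        have "measure lborel (A q \<inter> A q' \<inter> B) \<le> (4 * \<psi> q / 2 ^ j) ^ ?n"
        proof (rule prod_le)
          fix i
          show "emeasure lborel (S q q' i) \<le> ennreal (4 * \<psi> q / 2 ^ j)"
            using emeasure_near_single_le[OF pos(1) \<psi>(1,2), of j "\<lfloor>2 ^ j * x $ i $ l\<rfloor>" "{t. coprime t (int q)}"] True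
            unfolding S_def near_def r(1)[symmetric] by simp
        qed (use \<psi> in simp)
        also have "\<dots> \<le> (16 * \<psi> q / 2 ^ j) ^ ?n"
          using \<psi> by (intro power_mono divide_right_mono mult_right_mono) auto
        also have "\<dots> = 16 ^ ?n * measure lborel B * \<psi> q ^ ?n"
          unfolding mB by (simp add: power_mult_distrib power_divide)
        finally show ?thesis unfolding if_P[OF True] using nn by linarith
      next
        case False
        then have "r \<noteq> r'" using r by auto
        have "measure lborel (A q \<inter> A q' \<inter> B) \<le> (16 * \<psi> q * \<psi> q' / 2 ^ j) ^ ?n"
        proof (rule prod_le)
          fix i
          show "emeasure lborel (S q q' i) \<le> ennreal (16 * \<psi> q * \<psi> q' / 2 ^ j)"
            using emeasure_near_pair_le[OF pos \<open>r \<noteq> r'\<close> \<psi>, of j "\<lfloor>2 ^ j * x $ i $ l\<rfloor>"]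
            unfolding S_def near_def r[symmetric] .
        qed (use \<psi> in simp)
        also have "\<dots> = 16 ^ ?n * measure lborel B * (\<psi> q ^ ?n * \<psi> q' ^ ?n)"
          unfolding mB by (simp add: power_mult_distrib power_divide)
        finally show ?thesis using False by simp
      qed
    qed
    show "\<exists>F \<Psi>. finite F \<and> F \<subseteq> U - F0 \<and> \<Psi> > 0 \<and>
        1 / (16 ^ ?n * 2 ^ ?n) * measure lborel (cell j x) * \<Psi> \<le> (\<Sum>u\<in>F. measure lborel (A u \<inter> cell j x)) \<and>
        (\<Sum>u\<in>F. \<Sum>v\<in>F. measure lborel (A u \<inter> A v \<inter> cell j x)) \<le> 2 * 16 ^ ?n * measure lborel (cell j x) * \<Psi>\<^sup>2"
    proof (intro exI conjI)
      show "finite F" "F \<subseteq> U - F0" using F by auto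
      show "\<Psi> > 0" using F(3) unfolding \<Psi>_def by linarith
      have "1 / (16 ^ ?n * 2 ^ ?n) * measure lborel B * \<Psi>
        = (\<Sum>q\<in>F. \<psi> q ^ ?n / (16 ^ ?n * 2 ^ ?n) * measure lborel B)"
        unfolding \<Psi>_def by (simp add: sum_distrib_left sum_divide_distrib mult.commute)
      also have "\<dots> \<le> (\<Sum>u\<in>F. measure lborel (A u \<inter> B))" by (intro sum_mono lower)
      finally show "1 / (16 ^ ?n * 2 ^ ?n) * measure lborel (cell j x) * \<Psi> \<le> (\<Sum>u\<in>F. measure lborel (A u \<inter> cell j x))"
        unfolding B_def .
      have "(\<Sum>u\<in>F. \<Sum>v\<in>F. measure lborel (A u \<inter> A v \<inter> B))
        \<le> (\<Sum>u\<in>F. \<Sum>v\<in>F. 16 ^ ?n * measure lborel B * (\<psi> u ^ ?n * \<psi> v ^ ?n)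
          + (if v = u then 16 ^ ?n * measure lborel B * \<psi> u ^ ?n else 0))"
        by (intro sum_mono pair)
      also have "\<dots> = 16 ^ ?n * measure lborel B * (\<Psi>\<^sup>2 + \<Psi>)"
      proof -
        let ?c = "16 ^ ?n * measure lborel B"
        have "(\<Sum>u\<in>F. \<Sum>v\<in>F. ?c * (\<psi> u ^ ?n * \<psi> v ^ ?n)) = ?c * \<Psi>\<^sup>2"
          unfolding \<Psi>_def power2_eq_square sum_product by (simp add: sum_distrib_left)
        moreover have "(\<Sum>u\<in>F. \<Sum>v\<in>F. if v = u then ?c * \<psi> u ^ ?n else 0) = ?c * \<Psi>"
          using F(1) by (simp add: \<Psi>_def sum_distrib_left)
        ultimately show ?thesis by (simp only: sum.distrib distrib_left)
      qed
      also have "\<dots> \<le> 16 ^ ?n * measure lborel B * (\<Psi>\<^sup>2 + \<Psi>\<^sup>2)"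
      proof -
        have "\<Psi> * 1 \<le> \<Psi> * \<Psi>" using F(3) unfolding \<Psi>_def[symmetric] by (intro mult_left_mono) auto
        then show ?thesis by (intro mult_left_mono add_left_mono) (auto simp: power2_eq_square)
      qed
      finally show "(\<Sum>u\<in>F. \<Sum>v\<in>F. measure lborel (A u \<inter> A v \<inter> cell j x)) \<le> 2 * 16 ^ ?n * measure lborel (cell j x) * \<Psi>\<^sup>2"
        unfolding B_def by simp
    qed
  qed auto
  then show ?thesis unfolding A_def by simp
qed

section \<open>Density of admissible points\<close>

text \<open>Cauchy condensation. In the window (2^i, 2^(i+1)] monotonicity bounds \<psi>^n from
  below by f(2^(i+1)) / 2^((i+1)(m-1)); at least c 2^(im) points make this a multiple of 2^i
  f(2^(i+1)), unless the cap 1/4 takes over. Summability would make the capped contributions tend to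
  0, so the cap would be inactive from some index on.\<close>

lemma nonsummable_of_dyadic_windows:
  fixes \<psi> :: "nat \<Rightarrow> real" and N :: "'i \<Rightarrow> nat" and m n :: nat
  defines "f \<equiv> \<lambda>x. real x ^ (m - 1) * \<psi> x ^ n"
  assumes m: "m > 0" and pos: "\<And>x. x \<ge> 1 \<Longrightarrow> \<psi> x > 0" and mono: "antimono_on {1..} f"
    and div: "\<not> f summable_on {1..}" and c: "c > 0"
    and fin: "\<And>i. finite {q \<in> S. 2 ^ i < N q \<and> N q \<le> 2 ^ Suc i}"
    and count: "\<And>i. i \<ge> i0 \<Longrightarrow> c * (2 ^ i) ^ m \<le> real (card {q \<in> S. 2 ^ i < N q \<and> N q \<le> 2 ^ Suc i})"
  shows "\<not> (\<lambda>q. min (\<psi> (N q)) (1 / 4) ^ n) summable_on {q \<in> S. N q > 0}"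
proof
  let ?w = "\<lambda>q. min (\<psi> (N q)) (1 / 4) ^ n"
  let ?S = "{q \<in> S. N q > 0}"
  assume sum: "?w summable_on ?S"
  have w0: "?w q \<ge> 0" if "q \<in> ?S" for q using pos[of "N q"] that by (simp add: less_imp_le)
  define W where "W i = {q \<in> S. 2 ^ i < N q \<and> N q \<le> 2 ^ Suc i}" for i
  define a where "a i = c / 2 ^ (m - 1) * (2 ^ i * f (2 ^ Suc i))" for i
  \<comment> \<open>The uncapped contribution against the capped one, in which the factor 2^(im) >=
    1 is given away.\<close>
  define b where "b i = min (a i) (c / 4 ^ n)" for i
  have f0: "f x \<ge> 0" if "x \<ge> 1" for x using pos[OF that] by (simp add: f_def)
  have a0: "a i \<ge> 0" for i using c f0[of "2 ^ Suc i"] by (simp add: a_def)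
  have WS: "W i \<subseteq> ?S" for i unfolding W_def by (auto intro: gr0I)
  have wlow: "b i \<le> sum ?w (W i)" if i: "i \<ge> i0" for i
  proof -
    define \<beta> where "\<beta> = min (f (2 ^ Suc i) / (2 ^ Suc i) ^ (m - 1)) (1 / 4 ^ n)"
    have \<beta>0: "\<beta> \<ge> 0" using f0[of "2 ^ Suc i"] by (simp add: \<beta>_def)
    have "\<beta> \<le> ?w q" if "q \<in> W i" for q
    proof -
      have q: "1 \<le> N q" "N q \<le> 2 ^ Suc i" using that unfolding W_def by (auto simp: Suc_le_eq intro: gr0I)
      then have "f (2 ^ Suc i) \<le> f (N q)" using mono by (auto simp: monotone_on_def)
      then have "f (2 ^ Suc i) / (2 ^ Suc i) ^ (m - 1) \<le> f (N q) / real (N q) ^ (m - 1)"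
      proof (intro frac_le power_mono)
        show "real (N q) \<le> 2 ^ Suc i" using q(2) by (metis of_nat_le_iff of_nat_numeral of_nat_power)
      qed (use q f0 in auto)
      also have "\<dots> = \<psi> (N q) ^ n" using q by (simp add: f_def)
      finally have "f (2 ^ Suc i) / (2 ^ Suc i) ^ (m - 1) \<le> \<psi> (N q) ^ n" .
      then show ?thesis by (auto simp: \<beta>_def min_def power_divide)
    qed
    then have "real (card (W i)) * \<beta> \<le> sum ?w (W i)"
      using sum_bounded_below[of "W i" \<beta> ?w] by simp
    moreover have "c * (2 ^ i) ^ m * \<beta> \<le> real (card (W i)) * \<beta>"
      using count[OF i] \<beta>0 unfolding W_def by (intro mult_right_mono)
    moreover have "b i \<le> c * (2 ^ i) ^ m * \<beta>"
    proof -
      have "a i = c * (2 ^ i) ^ m * (f (2 ^ Suc i) / (2 ^ Suc i) ^ (m - 1))"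
      proof -
        obtain m' where m': "m = Suc m'" using m by (cases m) auto
        show ?thesis unfolding a_def m' by (simp add: power_mult_distrib field_simps)
      qed
      moreover have "c / 4 ^ n * 1 \<le> c / 4 ^ n * (2 ^ i) ^ m"
        using c by (intro mult_left_mono) (auto intro!: one_le_power)
      moreover have "\<beta> = f (2 ^ Suc i) / (2 ^ Suc i) ^ (m - 1) \<or> \<beta> = 1 / 4 ^ n"
        unfolding \<beta>_def by (simp add: min_def)
      ultimately show ?thesis
        unfolding b_def by (elim disjE) (auto simp: min.coboundedI1 min.coboundedI2 mult_ac)
    qed
    ultimately show ?thesis by linarith
  qed
  have b0: "b i \<ge> 0" for i using a0 c by (simp add: b_def)
  have "summable (\<lambda>i. b (i + i0))"
  proof (rule summableI_nonneg_bounded)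
    fix K
    have disj: "W i \<inter> W j = {}" if "i \<noteq> j" for i j
    proof -
      have False if "i < j" "q \<in> W i" "q \<in> W j" for i j q
      proof -
        have "(2::nat) ^ Suc i \<le> 2 ^ j" using that by (intro power_increasing) auto
        with that(2,3) show False unfolding W_def by auto
      qed
      with that show ?thesis by (metis disjoint_iff linorder_neqE_nat)
    qed
    have "(\<Sum>i<K. b (i + i0)) \<le> (\<Sum>i<K. sum ?w (W (i + i0)))" by (intro sum_mono wlow) auto
    also have "\<dots> = sum ?w (\<Union>i<K. W (i + i0))"
      using fin disj by (intro sum.UNION_disjoint[symmetric]) (auto simp: W_def)
    also have "\<dots> \<le> infsum ?w ?S"
      using sum WS w0 fin by (intro finite_sum_le_infsum) (auto simp: W_def)
    finally show "(\<Sum>i<K. b (i + i0)) \<le> infsum ?w ?S" .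
  qed (rule b0)
  then have sb: "summable b" by (simp add: summable_iff_shift)
  then have "b \<longlonglongrightarrow> 0" by (rule summable_LIMSEQ_zero)
  then have "eventually (\<lambda>i. b i < c / 4 ^ n) sequentially"
    using c by (intro order_tendstoD(2)) auto
  then have "eventually (\<lambda>i. b i = a i) sequentially"
    by eventually_elim (auto simp: b_def min_def split: if_splits)
  then have "summable a" using sb by (subst (asm) summable_cong)
  then have "summable (\<lambda>i. 2 ^ (m - 1) / c * 2 * a i)" by (intro summable_mult)
  moreover have "(\<lambda>i. 2 ^ (m - 1) / c * 2 * a i) = (\<lambda>i. 2 ^ Suc i * f (2 ^ Suc i))"
    using c by (auto simp: a_def)
  ultimately have "summable (\<lambda>i. 2 ^ Suc i * f (2 ^ Suc i))" by (simp only:)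
  \<comment> \<open>The value at 0 is reset because \<open>f 0\<close> is unconstrained, whereas
    condensation speaks of a sequence indexed from 0.\<close>
  define f' where "f' x = (if x = 0 then 0 else f x)" for x
  have "summable (\<lambda>i. 2 ^ i * f' (2 ^ i))"
    using \<open>summable (\<lambda>i. 2 ^ Suc i * f (2 ^ Suc i))\<close> summable_Suc_iff[of "\<lambda>i. 2 ^ i * f' (2 ^ i)"]
    by (simp add: f'_def)
  then have "summable f'"
    using mono f0 by (subst condensation_test) (auto simp: f'_def monotone_on_def)
  then have "f' summable_on UNIV"
    using f0 by (subst summable_on_UNIV_nonneg_real_iff) (auto simp: f'_def)
  then have "f' summable_on {1..}" by (rule summable_on_subset) auto
  then have "f summable_on {1..}" by (rule summable_on_cong[THEN iffD1, rotated]) (auto simp: f'_def)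
  with div show False by simp
qed

text \<open>In each block of the partition a leading index is chosen among the \<open>q\<close>-indices; \<open>\<mu> j\<close> is the
  leading index of the block of \<open>j\<close>. If all other entries of the block, those of \<open>p\<close> included, are
  coprime to the leading one, the block is primitive.\<close>

definition admissible :: "('m \<Rightarrow> 'm) \<Rightarrow> (int ^ 'm::finite) set" where
  "admissible \<mu> = {q. \<forall>j. q $ j > 0 \<and> few_factors (nat (q $ \<mu> j)) \<and> (j \<noteq> \<mu> j \<longrightarrow> coprime (q $ j) (q $ \<mu> j))}"

lemma int_supnorm_attained: "\<exists>j. int (int_supnorm q) = \<bar>q $ j\<bar>"
proof -
  have "int_supnorm q \<in> range (\<lambda>i. nat \<bar>q $ i\<bar>)" unfolding int_supnorm_def by (intro Max_in) auto
  then show ?thesis by auto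
qed

lemma int_supnorm_ge: "\<bar>q $ j\<bar> \<le> int (int_supnorm q)"
proof -
  have "nat \<bar>q $ j\<bar> \<le> int_supnorm q" unfolding int_supnorm_def by (intro Max_ge) auto
  then show ?thesis by linarith
qed

lemma finite_int_vec_box: "finite {q :: int ^ 'm::finite. \<forall>j. a \<le> q $ j \<and> q $ j \<le> b}"
proof -
  have "{q :: int ^ 'm. \<forall>j. a \<le> q $ j \<and> q $ j \<le> b} \<subseteq> (\<lambda>f. \<chi> j. f j) ` (UNIV \<rightarrow>\<^sub>E {a..b})"
  proof
    fix q :: "int ^ 'm" assume "q \<in> {q. \<forall>j. a \<le> q $ j \<and> q $ j \<le> b}"
    then show "q \<in> (\<lambda>f. \<chi> j. f j) ` (UNIV \<rightarrow>\<^sub>E {a..b})"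
      by (intro image_eqI[of _ _ "\<lambda>j. q $ j"]) auto
  qed
  then show ?thesis by (rule finite_subset) (auto intro!: finite_PiE)
qed

lemma finite_int_supnorm_le: "finite {q :: int ^ 'm::finite. int_supnorm q \<le> K}"
proof (rule finite_subset[OF _ finite_int_vec_box[of "- int K" "int K"]], safe)
  fix q :: "int ^ 'm" and j assume "int_supnorm q \<le> K"
  then show "- int K \<le> q $ j" "q $ j \<le> int K" using int_supnorm_ge[of q j] by linarith+
qed

text \<open>Leaders are chosen first among numbers with few factors, then every other entry coprime
  to its leader; idempotence of \<mu> makes each leader lead itself, so the choices are not
  circular. All entries lie in (2^i, 2^(i+1)], which also places the sup norm there, and each has at
  least 2^i/16 choices.\<close>

lemma card_admissible:
  fixes \<mu> :: "'m::finite \<Rightarrow> 'm"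
  assumes \<mu>: "\<And>j. \<mu> (\<mu> j) = \<mu> j"
  shows "\<exists>i0. \<forall>i\<ge>i0. (1 / 16) ^ CARD('m) * (2 ^ i) ^ CARD('m)
     \<le> real (card {q \<in> admissible \<mu>. 2 ^ i < int_supnorm q \<and> int_supnorm q \<le> 2 ^ Suc i})"
proof -
  obtain L0 :: nat where L0: "\<And>L s a. L \<ge> L0 \<Longrightarrow> few_factors s \<Longrightarrow> s > 0 \<Longrightarrow> real s \<le> 2 * real L
     \<Longrightarrow> real (card {t \<in> {a<..a + int L}. coprime t (int s)}) \<ge> real L / 16"
    using card_coprime_interval_linear[of 2] by blast
  have "(1 / 16) ^ CARD('m) * (2 ^ i) ^ CARD('m)
     \<le> real (card {q \<in> admissible \<mu>. 2 ^ i < int_supnorm q \<and> int_supnorm q \<le> 2 ^ Suc i})" if i: "i \<ge> L0" for i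
  proof -
    define L :: nat where "L = 2 ^ i"
    have L: "L \<ge> L0" using i less_exp[of i] unfolding L_def by linarith
    have Lpos: "L > 0" by (simp add: L_def)
    define I where "I = {int L<..int L + int L}"
    have finI: "finite I" by (simp add: I_def)
    define W where "W = {w \<in> I. few_factors (nat w)}"
    define C where "C w = {t \<in> I. coprime t w}" for w
    have finW: "finite W" "finite (C w)" for w using finI by (auto simp: W_def C_def)
    \<comment> \<open>Two thirds of 2L, less the L numbers of the lower half, is L/3.\<close>
    have cardW: "real (card W) \<ge> real L / 16"
    proof -
      have "real (card {s \<in> {1..2 * L}. few_factors s}) \<ge> 2 / 3 * real (2 * L)" by (rule card_few_factors)
      moreover have "card {s \<in> {1..2 * L}. few_factors s} \<le> card ({1..L} \<union> nat ` W)"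
      proof (intro card_mono subsetI)
        fix s assume s: "s \<in> {s \<in> {1..2 * L}. few_factors s}"
        show "s \<in> {1..L} \<union> nat ` W"
        proof (cases "s \<le> L")
          case False
          then have "int s \<in> W" using s by (auto simp: W_def I_def)
          then show ?thesis by (intro UnI2 image_eqI[of _ _ "int s"]) auto
        qed (use s in auto)
      qed (use finW in auto)
      moreover have "card ({1..L} \<union> nat ` W) \<le> L + card W"
        using card_Un_le[of "{1..L}" "nat ` W"] card_image_le[OF finW(1), of nat] by simp
      ultimately show ?thesis by linarith
    qed
    have cardC: "real (card (C w)) \<ge> real L / 16" if "w \<in> W" for w
    proof -
      have "w > 0" "few_factors (nat w)" "real (nat w) \<le> 2 * real L" using that by (auto simp: W_def I_def)
      then show ?thesis using L0[OF L, of "nat w" "int L"] by (simp add: C_def I_def)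
    qed
    define D where "D = {j. \<mu> j = j}"
    define X where "X = (SIGMA f:(D \<rightarrow>\<^sub>E W). PiE (- D) (\<lambda>j. C (f (\<mu> j))))"
    define F where "F = (\<lambda>(f, g). (\<chi> j. if j \<in> D then f j else g j) :: int ^ 'm)"
    have "inj_on F X"
    proof (rule inj_onI)
      fix p p' assume p: "p \<in> X" "p' \<in> X" "F p = F p'"
      obtain f g f' g' where fg: "p = (f, g)" "p' = (f', g')" by fastforce
      have e: "(if j \<in> D then f j else g j) = (if j \<in> D then f' j else g' j)" for j
        using p(3) by (simp add: F_def fg vec_eq_iff)
      have "f = f'" using p(1,2) e unfolding fg X_def by (intro PiE_ext[of f D "\<lambda>_. W" f']) (auto, metis)
      moreover have "g j = g' j" for j
      proof (cases "j \<in> D")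
        case True then show ?thesis using p(1,2) unfolding fg X_def by (auto simp: PiE_def extensional_def)
      next
        case False then show ?thesis using e[of j] by simp
      qed
      ultimately show "p = p'" by (auto simp: fg)
    qed
    moreover have sub: "F ` X \<subseteq> {q \<in> admissible \<mu>. 2 ^ i < int_supnorm q \<and> int_supnorm q \<le> 2 ^ Suc i}"
    proof (rule image_subsetI)
      fix p assume "p \<in> X"
      moreover obtain f g where p: "p = (f, g)" by fastforce
      ultimately have f: "\<And>j. j \<in> D \<Longrightarrow> f j \<in> W" and g: "\<And>j. j \<notin> D \<Longrightarrow> g j \<in> C (f (\<mu> j))"
        unfolding X_def by auto
      define q where "q = F p"
      have qD: "q $ j = f j" if "j \<in> D" for j using that by (simp add: q_def F_def p)
      have qnD: "q $ j = g j" if "j \<notin> D" for j using that by (simp add: q_def F_def p)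
      have \<mu>D: "\<mu> j \<in> D" for j using \<mu> by (simp add: D_def)
      have qI: "q $ j \<in> I" for j
        using f[of j] g[of j] qD[of j] qnD[of j] by (cases "j \<in> D") (auto simp: W_def C_def)
      have "q \<in> admissible \<mu>"
        unfolding admissible_def
      proof (intro CollectI allI conjI impI)
        fix j
        show "q $ j > 0" using qI[of j] Lpos by (simp add: I_def)
        show "few_factors (nat (q $ \<mu> j))" using f[OF \<mu>D[of j]] qD[OF \<mu>D[of j]] by (simp add: W_def)
        assume "j \<noteq> \<mu> j"
        then have "j \<notin> D" by (simp add: D_def)
        then show "coprime (q $ j) (q $ \<mu> j)" using g[of j] qnD[of j] qD[OF \<mu>D[of j]] by (simp add: C_def)
      qed
      moreover obtain j where "int (int_supnorm q) = \<bar>q $ j\<bar>" using int_supnorm_attained by blast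
      then have "int L < int (int_supnorm q)" "int (int_supnorm q) \<le> 2 * int L" using qI[of j] Lpos by (auto simp: I_def)
      then have "L < int_supnorm q" "int_supnorm q \<le> 2 * L" by linarith+
      then have "2 ^ i < int_supnorm q" "int_supnorm q \<le> 2 ^ Suc i" by (simp_all add: L_def)
      ultimately show "F p \<in> {q \<in> admissible \<mu>. 2 ^ i < int_supnorm q \<and> int_supnorm q \<le> 2 ^ Suc i}"
        by (simp add: q_def)
    qed
    moreover have "finite {q \<in> admissible \<mu>. 2 ^ i < int_supnorm q \<and> int_supnorm q \<le> 2 ^ Suc i}"
      by (rule finite_subset[OF _ finite_int_supnorm_le[of "2 ^ Suc i"]]) auto
    ultimately have "card X \<le> card {q \<in> admissible \<mu>. 2 ^ i < int_supnorm q \<and> int_supnorm q \<le> 2 ^ Suc i}"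
      by (intro card_inj_on_le)
    moreover have "(real L / 16) ^ CARD('m) \<le> real (card X)"
    proof -
      have "card X = (\<Sum>f\<in>(D \<rightarrow>\<^sub>E W). card (PiE (- D) (\<lambda>j. C (f (\<mu> j)))))"
        unfolding X_def using finW by (intro card_SigmaI) (auto intro!: finite_PiE)
      then have "real (card X) = (\<Sum>f\<in>(D \<rightarrow>\<^sub>E W). (\<Prod>j\<in>- D. real (card (C (f (\<mu> j))))))"
        by (simp add: card_PiE)
      also have "\<dots> \<ge> (\<Sum>f\<in>(D \<rightarrow>\<^sub>E W). (\<Prod>j\<in>- D. real L / 16))"
      proof (intro sum_mono prod_mono conjI)
        fix f j assume "f \<in> D \<rightarrow>\<^sub>E W"
        moreover have "\<mu> j \<in> D" using \<mu> by (simp add: D_def)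
        ultimately show "real L / 16 \<le> real (card (C (f (\<mu> j))))" by (intro cardC) auto
      qed auto
      also have "(\<Sum>f\<in>(D \<rightarrow>\<^sub>E W). (\<Prod>j\<in>- D. real L / 16)) = real (card W) ^ card D * (real L / 16) ^ card (- D)"
        by (simp add: card_PiE)
      also have "\<dots> \<ge> (real L / 16) ^ card D * (real L / 16) ^ card (- D)"
        using cardW by (intro mult_right_mono power_mono) auto
      also have "(real L / 16) ^ card D * (real L / 16) ^ card (- D) = (real L / 16) ^ CARD('m)"
      proof -
        have "card D + card (- D) = CARD('m)"
          using card_Un_disjoint[of D "- D"] by (simp add: Compl_partition)
        then show ?thesis by (simp add: power_add[symmetric])
      qed
      finally show ?thesis .
    qed
    moreover have "(1 / 16) ^ CARD('m) * (2 ^ i) ^ CARD('m) = (real L / 16) ^ CARD('m)"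
      by (simp add: L_def power_divide)
    ultimately show ?thesis by linarith
  qed
  then show ?thesis by blast
qed

text \<open>A block of at least n + 1 elements cannot consist of p-indices alone, so it has a
  q-index to lead it, and it has a further element. If every q-index led, each block would hold just
  one q-index and therefore all n p-indices; then all blocks would coincide and m would be
  1.\<close>

lemma partition_leader:
  fixes \<pi> :: "('m::finite + 'n::finite) set set"
  assumes part: "partition_on UNIV \<pi>" and comp: "\<And>B. B \<in> \<pi> \<Longrightarrow> card B \<ge> CARD('n) + 1"
  obtains lam :: "'m + 'n \<Rightarrow> 'm" where
    "\<And>B. B \<in> \<pi> \<Longrightarrow> \<exists>i k. Inl i \<in> B \<and> k \<in> B \<and> k \<noteq> Inl i \<and> (\<forall>k\<in>B. lam k = i)"
    "\<And>k. lam (Inl (lam k)) = lam k"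
    "CARD('m) \<ge> 2 \<Longrightarrow> \<exists>i. lam (Inl i) \<noteq> i"
proof -
  have uniq: "\<exists>!B. B \<in> \<pi> \<and> k \<in> B" for k
  proof -
    obtain B where B: "B \<in> \<pi>" "k \<in> B" using partition_onD1[OF part] by blast
    moreover have "B' = B" if "B' \<in> \<pi>" "k \<in> B'" for B'
      using disjointD[OF partition_onD2[OF part] that(1) B(1)] that(2) B(2) by blast
    ultimately show ?thesis by blast
  qed
  define cmp where "cmp k = (THE B. B \<in> \<pi> \<and> k \<in> B)" for k
  have cmp: "cmp k \<in> \<pi>" "k \<in> cmp k" for k using theI'[OF uniq[of k]] by (auto simp: cmp_def)
  have cmp_eq: "cmp k = B" if "B \<in> \<pi>" "k \<in> B" for B k using uniq[of k] cmp[of k] that by blast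
  define pick where "pick B = (SOME i. Inl i \<in> B)" for B :: "('m + 'n) set"
  have pick: "Inl (pick B) \<in> B" if B: "B \<in> \<pi>" for B
  proof -
    have "\<exists>i. Inl i \<in> B"
    proof (rule ccontr)
      assume *: "\<not> (\<exists>i. Inl i \<in> B)"
      have "B \<subseteq> range Inr"
      proof
        fix k assume "k \<in> B"
        with * show "k \<in> range Inr" by (cases k) auto
      qed
      then have "card B \<le> card (range (Inr :: 'n \<Rightarrow> 'm + 'n))" by (intro card_mono) auto
      also have "\<dots> = CARD('n)" by (simp add: card_image)
      finally show False using comp[OF B] by simp
    qed
    then show ?thesis unfolding pick_def by (rule someI_ex)
  qed
  define lam where "lam k = pick (cmp k)" for k
  have lamB: "lam k = pick B" if "B \<in> \<pi>" "k \<in> B" for B k using cmp_eq[OF that] by (simp add: lam_def)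
  show thesis
  proof (rule that)
    fix B assume B: "B \<in> \<pi>"
    have "\<exists>k\<in>B. k \<noteq> Inl (pick B)"
    proof (rule ccontr)
      assume "\<not> ?thesis"
      then have "B \<subseteq> {Inl (pick B)}" by auto
      then have "card B \<le> card {Inl (pick B) :: 'm + 'n}" by (intro card_mono) auto
      then show False using comp[OF B] zero_less_card_finite[where 'a = 'n] by simp
    qed
    then show "\<exists>i k. Inl i \<in> B \<and> k \<in> B \<and> k \<noteq> Inl i \<and> (\<forall>k\<in>B. lam k = i)"
      using pick[OF B] lamB[OF B] by blast
  next
    fix k show "lam (Inl (lam k)) = lam k"
      using lamB[OF cmp(1)[of k] pick[OF cmp(1)[of k]]] by (simp add: lam_def)
  next
    assume "CARD('m) \<ge> 2"
    then obtain i i' :: 'm where ii: "i \<noteq> i'"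
      by (metis card_1_singleton_iff card_le_Suc0_iff_eq finite_class.finite_UNIV UNIV_I numeral_2_eq_2 not_less_eq_eq)
    show "\<exists>i. lam (Inl i) \<noteq> i"
    proof (rule ccontr)
      assume "\<not> ?thesis"
      then have all: "lam (Inl i) = i" for i by blast
      have "Inr r \<in> cmp (Inl i)" for r i
      proof (rule ccontr)
        assume r: "Inr r \<notin> cmp (Inl i)"
        have "cmp (Inl i) \<subseteq> insert (Inl i) (Inr ` (UNIV - {r}))"
        proof
          fix k assume k: "k \<in> cmp (Inl i)"
          show "k \<in> insert (Inl i) (Inr ` (UNIV - {r}))"
          proof (cases k)
            case (Inl j)
            then have "cmp (Inl j) = cmp (Inl i)" using k cmp_eq[OF cmp(1)] by blast
            then have "j = i" using all[of i] all[of j] by (simp add: lam_def)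
            then show ?thesis using Inl by simp
          next
            case (Inr b) then show ?thesis using k r by auto
          qed
        qed
        then have "card (cmp (Inl i)) \<le> card (insert (Inl i) (Inr ` (UNIV - {r})) :: ('m + 'n) set)"
          by (intro card_mono) auto
        also have "\<dots> \<le> Suc (card (UNIV - {r}))"
          by (rule order_trans[OF card_insert_le_m1]) (auto simp: card_image)
        also have "\<dots> = CARD('n)" by (simp add: card_Diff_singleton)
        finally show False using comp[OF cmp(1)[of "Inl i"]] by simp
      qed
      then have "cmp (Inl i) = cmp (Inl i')"
        using uniq[of "Inr undefined"] cmp(1) by blast
      then show False using all[of i] all[of i'] ii by (simp add: lam_def)
    qed
  qed
qed

section \<open>Reduction to the identity block\<close>

lemma AE_lborel_iff_negligible: "(AE x in lborel. P x) \<longleftrightarrow> negligible {x. \<not> P x}"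
proof -
  have "(AE x in lborel. P x) \<longleftrightarrow> (AE x in lebesgue. P x)" by (simp add: AE_completion_iff)
  also have "\<dots> \<longleftrightarrow> negligible {x. \<not> P x}"
    by (auto simp: eventually_ae_filter negligible_iff_null_sets[symmetric] intro: negligible_subset)
  finally show ?thesis .
qed

lemma negligible_Times_UNIV:
  fixes A :: "'a::euclidean_space set"
  assumes "negligible A"
  shows "negligible (A \<times> (UNIV :: 'b::euclidean_space set))"
proof -
  have "AE x in lborel. x \<notin> A" using assms by (simp add: AE_lborel_iff_negligible)
  then obtain N where N: "N \<in> null_sets lborel" "A \<subseteq> N"
    by (auto simp: eventually_ae_filter)
  have "emeasure lborel (N \<times> (UNIV :: 'b set)) = 0"
    using N by (subst emeasure_lborel_Times) auto
  then have "N \<times> (UNIV :: 'b set) \<in> null_sets lborel"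
    using N by (intro null_setsI) (auto simp: borel_prod[symmetric])
  then have "AE x in lborel. x \<notin> A \<times> (UNIV :: 'b set)"
    by (rule AE_I') (use N in auto)
  then show ?thesis by (simp add: AE_lborel_iff_negligible)
qed

lemma real_polynomial_function_entry:
  assumes "linear f"
  shows "real_polynomial_function (\<lambda>x :: 'a::euclidean_space. (f x :: real ^ 'k ^ 'n) $ i $ j)"
proof -
  have "linear (\<lambda>x. f x $ i $ j)"
    by (rule linearI) (simp_all add: linear_add[OF assms] linear_scale[OF assms])
  then show ?thesis by (intro real_polynomial_function.intros(1)) (simp add: linear_conv_bounded_linear)
qed

lemma negligible_linear_image_eq_dim:
  fixes f :: "'a::euclidean_space \<Rightarrow> 'b::euclidean_space"
  assumes "linear f" "negligible N" "DIM('a) \<le> DIM('b)"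
  shows "negligible (f ` N)"
  using assms by (intro negligible_differentiable_image_negligible linear_imp_differentiable_on)

text \<open>In a singular matrix some column i depends on the others. Storing the coefficients in
  place of that column, with 0 on the diagonal, exhibits the matrix as the image under the
  polynomial map \<open>G i\<close> of a point of the hyperplane where entry (i, i) is 0. A
  differentiable map between spaces of equal dimension keeps null sets null.\<close>

lemma negligible_det_zero: "negligible {M :: real ^ 'n ^ 'n. det M = 0}"
proof -
  define G where "G i M = (\<chi> r j. if j = i then (\<Sum>k\<in>UNIV - {i}. M $ k $ i * M $ r $ k) else M $ r $ j)"
    for i and M :: "real ^ 'n ^ 'n"
  have "{M :: real ^ 'n ^ 'n. det M = 0} \<subseteq> (\<Union>i. G i ` {M. M $ i $ i = 0})"
  proof
    fix M :: "real ^ 'n ^ 'n" assume "M \<in> {M. det M = 0}"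
    then have "\<not> (\<exists>B. B ** M = mat 1)"
      using invertible_det_nz[of M] matrix_left_right_inverse[of M] unfolding invertible_def by auto
    then obtain c i where c: "(\<Sum>j\<in>UNIV. c j *s column j M) = 0" "c i \<noteq> 0"
      unfolding matrix_left_invertible_independent_columns by blast
    define d where "d j = - c j / c i" for j
    have col: "M $ r $ i = (\<Sum>k\<in>UNIV - {i}. d k * M $ r $ k)" for r
    proof -
      have "0 = (\<Sum>j\<in>UNIV. c j *s column j M) $ r" using c by simp
      also have "\<dots> = (\<Sum>j\<in>UNIV. c j * M $ r $ j)" by (simp add: column_def)
      also have "\<dots> = c i * M $ r $ i + (\<Sum>j\<in>UNIV - {i}. c j * M $ r $ j)"
        by (subst sum.remove[of _ i]) auto
      finally have "M $ r $ i = - (\<Sum>j\<in>UNIV - {i}. c j * M $ r $ j) / c i" using c(2) by (simp add: field_simps)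
      also have "\<dots> = (\<Sum>k\<in>UNIV - {i}. d k * M $ r $ k)"
        by (simp add: d_def sum_negf sum_divide_distrib)
      finally show ?thesis .
    qed
    define M' where "M' = (\<chi> r j. if j = i then (if r = i then 0 else d r) else M $ r $ j)"
    have "G i M' = M" by (auto simp: G_def M'_def vec_eq_iff col)
    moreover have "M' $ i $ i = 0" by (simp add: M'_def)
    ultimately show "M \<in> (\<Union>i. G i ` {M. M $ i $ i = 0})" by (metis (mono_tags, lifting) UN_I UNIV_I image_eqI mem_Collect_eq)
  qed
  moreover have *: "negligible (G i ` {M. M $ i $ i = 0})" for i
  proof (rule negligible_differentiable_image_negligible)
    have "{M :: real ^ 'n ^ 'n. M $ i $ i = 0} = {M. axis i (axis i 1) \<bullet> M = 0}" by (auto simp: inner_axis')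
    then show "negligible {M :: real ^ 'n ^ 'n. M $ i $ i = 0}" by (simp add: negligible_hyperplane axis_eq_0_iff)
    have e: "real_polynomial_function (\<lambda>M :: real ^ 'n ^ 'n. M $ r $ j)" for r j
      using real_polynomial_function_entry[of "\<lambda>M. M"] by (simp add: linear_ident)
    have "real_polynomial_function (\<lambda>M. G i M $ r $ j)" for r j
    proof (cases "j = i")
      case True
      then have "(\<lambda>M. G i M $ r $ j) = (\<lambda>M. \<Sum>k\<in>UNIV - {i}. M $ k $ i * M $ r $ k)"
        by (simp add: G_def)
      then show ?thesis
        by (simp only:) (intro real_polynomial_function_sum real_polynomial_function.intros(4) e finite)
    next
      case False
      then have "(\<lambda>M. G i M $ r $ j) = (\<lambda>M. M $ r $ j)" by (simp add: G_def)
      then show ?thesis by (simp only: e)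
    qed
    then have "polynomial_function (G i)"
      unfolding polynomial_function_iff_Basis_inner by (auto simp: Basis_vec_def inner_axis)
    then show "G i differentiable_on {M. M $ i $ i = 0}"
      by (rule differentiable_on_polynomial_function)
  qed simp
  moreover have "negligible (\<Union>i. G i ` {M. M $ i $ i = 0})"
    using * by (intro negligible_Union) auto
  ultimately show ?thesis using negligible_subset by blast
qed

section \<open>Splitting off the square block, and invariance under left multiplication\<close>

definition blocks :: "real ^ 'm ^ 'n \<Rightarrow> real ^ 'n ^ 'n \<Rightarrow> real ^ ('m::finite + 'n::finite) ^ 'n" where
  "blocks \<Theta> \<Phi> = (\<chi> i k. case k of Inl j \<Rightarrow> \<Theta> $ i $ j | Inr j \<Rightarrow> \<Phi> $ i $ j)"

lemma Theta_blocks [simp]: "Theta (blocks \<Theta> \<Phi>) = \<Theta>" and Phi_blocks [simp]: "Phi (blocks \<Theta> \<Phi>) = \<Phi>"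
  by (simp_all add: Theta_def Phi_def blocks_def vec_eq_iff)

lemma blocks_Theta_Phi [simp]: "blocks (Theta X) (Phi X) = X"
  by (simp add: Theta_def Phi_def blocks_def vec_eq_iff split: sum.split)

lemma negligible_det_Phi_zero: "negligible {X :: real ^ ('m::finite + 'n::finite) ^ 'n. det (Phi X) = 0}"
proof -
  have "negligible ((\<lambda>p. blocks (snd p) (fst p)) ` ({M. det M = 0} \<times> (UNIV :: (real ^ 'm ^ 'n) set)) :: (real ^ ('m + 'n) ^ 'n) set)"
  proof (rule negligible_linear_image_eq_dim)
    show "negligible ({M :: real ^ 'n ^ 'n. det M = 0} \<times> (UNIV :: (real ^ 'm ^ 'n) set))"
      by (intro negligible_Times_UNIV negligible_det_zero)
    show "linear (\<lambda>p. blocks (snd p) (fst p) :: real ^ ('m + 'n) ^ 'n)"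
      by (rule linearI) (auto simp: blocks_def vec_eq_iff split: sum.split)
  qed (simp add: algebra_simps)
  then show ?thesis
  proof (rule negligible_subset, intro subsetI)
    fix X :: "real ^ ('m + 'n) ^ 'n" assume "X \<in> {X. det (Phi X) = 0}"
    then show "X \<in> (\<lambda>p. blocks (snd p) (fst p)) ` ({M. det M = 0} \<times> UNIV)"
      by (intro image_eqI[where x = "(Phi X, Theta X)"]) auto
  qed
qed

definition solutions :: "('m::finite + 'n::finite) set set \<Rightarrow> (nat \<Rightarrow> real) \<Rightarrow> real ^ 'm ^ 'n \<Rightarrow> real ^ 'n ^ 'n \<Rightarrow> real ^ 'n
    \<Rightarrow> ((int ^ 'm) \<times> (int ^ 'n)) set" where
  "solutions \<pi> \<psi> \<Theta> \<Phi> y = {(q, p). stack q p \<in> partition_points \<pi> \<and> q \<noteq> 0 \<and>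
     infnorm (\<Theta> *v real_vec q + \<Phi> *v real_vec p - y) \<le> \<psi> (int_supnorm q)}"

text \<open>Asking for every scaling of \<open>\<psi>\<close> makes the property invariant under left multiplication.\<close>

definition well_approximable where
  "well_approximable \<pi> \<psi> \<Theta> \<Phi> y \<longleftrightarrow> (\<forall>k>0. infinite (solutions \<pi> (\<lambda>j. \<psi> j / real k) \<Theta> \<Phi> y))"

lemma well_approximable_mult:
  fixes g :: "real ^ 'n ^ 'n"
  assumes "well_approximable \<pi> \<psi> \<Theta> \<Phi> y"
  shows "well_approximable \<pi> \<psi> (g ** \<Theta>) (g ** \<Phi>) (g *v y)"
  unfolding well_approximable_def
proof (intro allI impI)
  fix k :: nat assume k: "k > 0"
  obtain K where K: "K > 0" "\<And>x. norm (g *v x) \<le> norm x * K"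
    using bounded_linear.pos_bounded[OF matrix_vector_mul_bounded_linear[of g]] by blast
  \<comment> \<open>A natural number, so that k C is again one of the scalings in the
    definition.\<close>
  obtain C :: nat where C: "C > 0" "\<And>x. infnorm (g *v x) \<le> real C * infnorm x"
  proof
    define C where "C = nat \<lceil>sqrt DIM(real ^ 'n) * K\<rceil> + 1"
    show "C > 0" by (simp add: C_def)
    fix x
    have "infnorm (g *v x) \<le> norm x * K" using K(2)[of x] infnorm_le_norm[of "g *v x"] by linarith
    also have "\<dots> \<le> (sqrt DIM(real ^ 'n) * infnorm x) * K"
      using K(1) norm_le_infnorm[of x] by (intro mult_right_mono) auto
    also have "\<dots> = (sqrt DIM(real ^ 'n) * K) * infnorm x" by simp
    also have "\<dots> \<le> real C * infnorm x"
    proof (intro mult_right_mono infnorm_pos_le)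
      show "sqrt DIM(real ^ 'n) * K \<le> real C" unfolding C_def by linarith
    qed
    finally show "infnorm (g *v x) \<le> real C * infnorm x" .
  qed
  have "solutions \<pi> (\<lambda>j. \<psi> j / real (k * C)) \<Theta> \<Phi> y \<subseteq> solutions \<pi> (\<lambda>j. \<psi> j / real k) (g ** \<Theta>) (g ** \<Phi>) (g *v y)"
  proof
    fix v assume v: "v \<in> solutions \<pi> (\<lambda>j. \<psi> j / real (k * C)) \<Theta> \<Phi> y"
    obtain q p where qp: "v = (q, p)" by fastforce
    let ?z = "\<Theta> *v real_vec q + \<Phi> *v real_vec p - y"
    have "(g ** \<Theta>) *v real_vec q + (g ** \<Phi>) *v real_vec p - g *v y = g *v ?z"
      by (simp add: matrix_vector_mult_diff_distrib matrix_vector_right_distrib matrix_vector_mul_assoc)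
    moreover have "infnorm (g *v ?z) \<le> real C * (\<psi> (int_supnorm q) / real (k * C))"
    proof (rule order_trans[OF C(2) mult_left_mono])
      show "infnorm ?z \<le> \<psi> (int_supnorm q) / real (k * C)" using v by (simp add: solutions_def qp)
    qed simp
    moreover have "real C * (\<psi> (int_supnorm q) / real (k * C)) = \<psi> (int_supnorm q) / real k"
      using C(1) k by (simp add: field_simps)
    ultimately show "v \<in> solutions \<pi> (\<lambda>j. \<psi> j / real k) (g ** \<Theta>) (g ** \<Phi>) (g *v y)"
      using v by (auto simp: solutions_def qp)
  qed
  moreover have "infinite (solutions \<pi> (\<lambda>j. \<psi> j / real (k * C)) \<Theta> \<Phi> y)"
  proof -
    have "k * C > 0" using k C(1) by simp
    then show ?thesis using assms unfolding well_approximable_def by blast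
  qed
  ultimately show "infinite (solutions \<pi> (\<lambda>j. \<psi> j / real k) (g ** \<Theta>) (g ** \<Phi>) (g *v y))"
    by (rule infinite_super)
qed

text \<open>For invertible \<Phi> every pair (X, \<Phi>) is (\<Phi> Z, \<Phi>) with Z the inverse of
  \<Phi> times X, and left multiplication by \<Phi> carries approximability from Z to X. Bad pairs
  thus lie in the polynomial image of a null set. The equivariant maps \<open>L\<close> and
  \<open>c\<close> serve both the target 0 and a target that is a column of Z.\<close>

lemma negligible_not_well_approximable:
  fixes L :: "real ^ 'k ^ 'n \<Rightarrow> real ^ 'm ^ 'n" and \<pi> :: "('m::finite + 'n::finite) set set"
  assumes AE: "AE Z in lborel. well_approximable \<pi> \<psi> (L Z) (mat 1) (c Z)"
    and L: "\<And>\<Phi> Z. L (\<Phi> ** Z) = \<Phi> ** L Z" and c: "\<And>\<Phi> Z. c (\<Phi> ** Z) = \<Phi> *v c Z"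
  shows "negligible {p. det (snd p) \<noteq> 0 \<and> \<not> well_approximable \<pi> \<psi> (L (fst p)) (snd p) (c (fst p))}"
proof -
  define Bad where "Bad = {Z. \<not> well_approximable \<pi> \<psi> (L Z) (mat 1) (c Z)}"
  define F where "F = (\<lambda>p :: (real ^ 'k ^ 'n) \<times> (real ^ 'n ^ 'n). (snd p ** fst p, snd p))"
  have "negligible (F ` (Bad \<times> UNIV))"
  proof (rule negligible_differentiable_image_negligible)
    show "negligible (Bad \<times> (UNIV :: (real ^ 'n ^ 'n) set))"
      using AE by (intro negligible_Times_UNIV) (simp add: AE_lborel_iff_negligible Bad_def)
    have e: "real_polynomial_function (\<lambda>p :: (real ^ 'k ^ 'n) \<times> (real ^ 'n ^ 'n). fst p $ i $ j)"
      "real_polynomial_function (\<lambda>p :: (real ^ 'k ^ 'n) \<times> (real ^ 'n ^ 'n). snd p $ i $ j')" for i j j'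
      by (intro real_polynomial_function_entry linear_fst linear_snd)+
    have "polynomial_function F"
      unfolding polynomial_function_iff_Basis_inner
    proof
      fix b :: "(real ^ 'k ^ 'n) \<times> (real ^ 'n ^ 'n)" assume "b \<in> Basis"
      then consider r k where "b = (axis r (axis k 1), 0)" | r k where "b = (0, axis r (axis k 1))"
        by (auto simp: Basis_prod_def Basis_vec_def)
      then show "real_polynomial_function (\<lambda>x. F x \<bullet> b)"
      proof cases
        case (1 r k)
        have "(\<lambda>x. F x \<bullet> b) = (\<lambda>x. \<Sum>j\<in>UNIV. snd x $ r $ j * fst x $ j $ k)"
          by (simp add: 1 F_def inner_axis matrix_matrix_mult_def)
        then show ?thesis
          by (simp only:) (intro real_polynomial_function_sum real_polynomial_function.intros(4) e finite)
      next
        case (2 r k)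
        have "(\<lambda>x. F x \<bullet> b) = (\<lambda>x. snd x $ r $ k)" by (simp add: 2 F_def inner_axis)
        then show ?thesis by (simp only: e)
      qed
    qed
    then show "F differentiable_on Bad \<times> UNIV" by (rule differentiable_on_polynomial_function)
  qed simp
  then show ?thesis
  proof (rule negligible_subset, intro subsetI)
    fix p assume p: "p \<in> {p. det (snd p) \<noteq> 0 \<and> \<not> well_approximable \<pi> \<psi> (L (fst p)) (snd p) (c (fst p))}"
    then obtain B where B: "snd p ** B = mat 1" using invertible_det_nz[of "snd p"] unfolding invertible_def by blast
    define Z where "Z = B ** fst p"
    have Z: "snd p ** Z = fst p" by (simp add: Z_def matrix_mul_assoc B)
    have "Z \<in> Bad"
      using p well_approximable_mult[of \<pi> \<psi> "L Z" "mat 1" "c Z" "snd p"] by (auto simp: Bad_def L[symmetric] c[symmetric] Z)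
    moreover have "p = F (Z, snd p)" by (simp add: F_def Z)
    ultimately show "p \<in> F ` (Bad \<times> UNIV)" by blast
  qed
qed

lemma AE_well_approximable_homogeneous:
  fixes \<pi> :: "('m::finite + 'n::finite) set set"
  assumes "AE \<Theta> in lborel. well_approximable \<pi> \<psi> \<Theta> (mat 1) 0"
  shows "AE X in lborel. well_approximable \<pi> \<psi> (Theta X) (Phi X) 0"
proof -
  define N where "N = {p. det (snd p) \<noteq> 0 \<and> \<not> well_approximable \<pi> \<psi> (fst p) (snd p) 0}"
  have "negligible N"
    unfolding N_def using assms by (intro negligible_not_well_approximable[where L = "\<lambda>Z. Z"]) simp_all
  then have "negligible ((\<lambda>p. blocks (fst p) (snd p)) ` N)"
  proof (rule negligible_linear_image_eq_dim[rotated])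
    show "linear (\<lambda>p. blocks (fst p) (snd p) :: real ^ ('m + 'n) ^ 'n)"
      by (rule linearI) (auto simp: blocks_def vec_eq_iff split: sum.split)
  qed (simp add: algebra_simps)
  then have "negligible ((\<lambda>p. blocks (fst p) (snd p)) ` N \<union> {X :: real ^ ('m + 'n) ^ 'n. det (Phi X) = 0})"
    by (intro negligible_Un negligible_det_Phi_zero)
  then show ?thesis
    unfolding AE_lborel_iff_negligible
  proof (rule negligible_subset, intro subsetI)
    fix X assume X: "X \<in> {X. \<not> well_approximable \<pi> \<psi> (Theta X) (Phi X) 0}"
    then have "det (Phi X) \<noteq> 0 \<Longrightarrow> (Theta X, Phi X) \<in> N" by (simp add: N_def)
    moreover have "X = blocks (fst (Theta X, Phi X)) (snd (Theta X, Phi X))" by simp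
    ultimately show "X \<in> (\<lambda>p. blocks (fst p) (snd p)) ` N \<union> {X. det (Phi X) = 0}" by blast
  qed
qed

definition left_cols :: "real ^ ('m::finite + unit) ^ 'n \<Rightarrow> real ^ 'm ^ 'n" where
  "left_cols Z = (\<chi> i j. Z $ i $ Inl j)"

definition last_col :: "real ^ ('m::finite + unit) ^ 'n \<Rightarrow> real ^ 'n" where
  "last_col Z = (\<chi> i. Z $ i $ Inr ())"

text \<open>By Fubini only almost every target is known to be good, while the claim concerns each y.
  A single good nonzero z is therefore kept and moved to y by a fixed invertible matrix, whose
  action on matrices preserves null sets.\<close>

lemma AE_well_approximable_inhomogeneous:
  fixes \<pi> :: "('m::finite + 'n::finite) set set" and y :: "real ^ 'n"
  assumes "AE Z in lborel. well_approximable \<pi> \<psi> (left_cols Z) (mat 1) (last_col Z)" and y: "y \<noteq> 0"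
  shows "AE X in lborel. well_approximable \<pi> \<psi> (Theta X) (Phi X) y"
proof -
  define N where "N = {p. det (snd p) \<noteq> 0 \<and> \<not> well_approximable \<pi> \<psi> (left_cols (fst p)) (snd p) (last_col (fst p))}"
  define F where "F = (\<lambda>p :: (real ^ ('m + unit) ^ 'n) \<times> (real ^ 'n ^ 'n). (last_col (fst p), blocks (left_cols (fst p)) (snd p)))"
  have "negligible N"
    unfolding N_def by (intro negligible_not_well_approximable assms(1))
      (simp_all add: left_cols_def last_col_def matrix_matrix_mult_def matrix_vector_mult_def)
  then have neg: "negligible (F ` N)"
  proof (rule negligible_linear_image_eq_dim[rotated])
    show "linear F"
      by (rule linearI) (auto simp: F_def left_cols_def last_col_def blocks_def vec_eq_iff split: sum.split)
  qed (simp add: algebra_simps)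
  have "{(z, X). \<not> (det (Phi X) \<noteq> 0 \<longrightarrow> well_approximable \<pi> \<psi> (Theta X) (Phi X) z)} \<subseteq> F ` N"
  proof
    fix zX assume zX: "zX \<in> {(z, X). \<not> (det (Phi X) \<noteq> 0 \<longrightarrow> well_approximable \<pi> \<psi> (Theta X) (Phi X) z)}"
    obtain z X where zXe: "zX = (z, X)" by fastforce
    define Z :: "real ^ ('m + unit) ^ 'n" where
      "Z = (\<chi> i k. case k of Inl j \<Rightarrow> Theta X $ i $ j | Inr _ \<Rightarrow> z $ i)"
    have Z: "left_cols Z = Theta X" "last_col Z = z"
      by (simp_all add: Z_def left_cols_def last_col_def vec_eq_iff)
    have "(Z, Phi X) \<in> N" using zX by (simp add: zXe N_def Z)
    moreover have "zX = F (Z, Phi X)" by (simp add: zXe F_def Z)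
    ultimately show "zX \<in> F ` N" by blast
  qed
  then have "AE zX in lborel. det (Phi (snd zX)) \<noteq> 0 \<longrightarrow>
      well_approximable \<pi> \<psi> (Theta (snd zX)) (Phi (snd zX)) (fst zX)"
    unfolding AE_lborel_iff_negligible by (intro negligible_subset[OF neg]) (auto simp: case_prod_unfold)
  then have "AE z in lborel. AE X in lborel. det (Phi X) \<noteq> 0 \<longrightarrow> well_approximable \<pi> \<psi> (Theta X) (Phi X) z"
    unfolding lborel_prod[symmetric] by (drule_tac lborel_pair.AE_pair) simp
  moreover have "AE z :: real ^ 'n in lborel. z \<noteq> 0"
    by (simp add: AE_lborel_iff_negligible)
  ultimately have AEzX: "AE z in lborel. z \<noteq> 0 \<and> (AE X in lborel. det (Phi X) \<noteq> 0 \<longrightarrow> well_approximable \<pi> \<psi> (Theta X) (Phi X) z)"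
    by eventually_elim simp
  then obtain z where z: "z \<noteq> 0" and AEz: "AE X in lborel. det (Phi X) \<noteq> 0 \<longrightarrow> well_approximable \<pi> \<psi> (Theta X) (Phi X) z"
  proof -
    have "\<exists>z. z \<noteq> 0 \<and> (AE X in lborel. det (Phi X) \<noteq> 0 \<longrightarrow> well_approximable \<pi> \<psi> (Theta X) (Phi X) z)" (is "\<exists>z. ?P z")
    proof (rule ccontr)
      assume "\<not> (\<exists>z. ?P z)"
      then have "{z. \<not> ?P z} = UNIV" by blast
      moreover have "negligible {z. \<not> ?P z}" by (rule AEzX[unfolded AE_lborel_iff_negligible[of "?P"]])
      ultimately show False using open_not_negligible[of "UNIV :: (real ^ 'n) set"] by simp
    qed
    then show ?thesis using that by blast
  qed
  have "AE X in lborel. det (Phi X :: real ^ 'n ^ 'n) \<noteq> 0"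
    using negligible_det_Phi_zero by (simp add: AE_lborel_iff_negligible)
  with AEz have "AE X in lborel. well_approximable \<pi> \<psi> (Theta X) (Phi X) z"
    by eventually_elim simp
  then have negz: "negligible {X. \<not> well_approximable \<pi> \<psi> (Theta X) (Phi X) z}"
    by (simp add: AE_lborel_iff_negligible)
  \<comment> \<open>An orthogonal map sends the direction of z to that of y; composed with a scaling
    it gives an invertible g with g z = y.\<close>
  obtain f :: "real ^ 'n \<Rightarrow> real ^ 'n" where f: "orthogonal_transformation f" "f ((norm y / norm z) *\<^sub>R z) = y"
    using z orthogonal_transformation_exists[of "(norm y / norm z) *\<^sub>R z" y] by auto
  have fl: "linear f" using f(1) by (simp add: orthogonal_transformation_def)
  define h where "h x = (norm y / norm z) *\<^sub>R f x" for x
  have hl: "linear h" unfolding h_def using fl by (rule linear_compose_scale_right)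
  define g where "g = matrix h"
  have gz: "g *v z = y"
    using f(2) by (simp add: g_def matrix_works[OF hl[folded linear_matrix_vector_mul_eq]] h_def linear_scale[OF fl])
  have "inj h"
    using orthogonal_transformation_inj[OF f(1)] y z by (auto simp: inj_on_def h_def)
  then have "det g \<noteq> 0" unfolding g_def using det_nz_iff_inj[OF hl] by blast
  then obtain g' where g': "g ** g' = mat 1" using invertible_det_nz[of g] unfolding invertible_def by blast
  have blk: "Theta (g ** X) = g ** Theta X" "Phi (g ** X) = g ** Phi X" for X :: "real ^ ('m + 'n) ^ 'n"
    by (simp_all add: Theta_def Phi_def matrix_matrix_mult_def vec_eq_iff)
  have "negligible ((\<lambda>X. g ** X) ` {X. \<not> well_approximable \<pi> \<psi> (Theta X) (Phi X) z})"
  proof (rule negligible_linear_image_eq_dim[OF _ negz])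
    show "linear (\<lambda>X :: real ^ ('m + 'n) ^ 'n. g ** X)"
      by (rule linearI) (auto simp: matrix_matrix_mult_def vec_eq_iff algebra_simps sum.distrib sum_distrib_left)
  qed simp
  moreover have "{X. \<not> well_approximable \<pi> \<psi> (Theta X) (Phi X) y}
    \<subseteq> (\<lambda>X. g ** X) ` {X. \<not> well_approximable \<pi> \<psi> (Theta X) (Phi X) z}"
  proof
    fix X assume X: "X \<in> {X. \<not> well_approximable \<pi> \<psi> (Theta X) (Phi X) y}"
    have eq: "g ** (g' ** X) = X" by (simp add: matrix_mul_assoc g')
    have "\<not> well_approximable \<pi> \<psi> (Theta (g' ** X)) (Phi (g' ** X)) z"
      using X well_approximable_mult[of \<pi> \<psi> "Theta (g' ** X)" "Phi (g' ** X)" z g] by (auto simp: blk[symmetric] eq gz)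
    then show "X \<in> (\<lambda>X. g ** X) ` {X. \<not> well_approximable \<pi> \<psi> (Theta X) (Phi X) z}"
      by (intro image_eqI[of _ _ "g' ** X"]) (simp_all add: eq)
  qed
  ultimately show ?thesis unfolding AE_lborel_iff_negligible by (rule negligible_subset)
qed

section \<open>The divergence case\<close>

text \<open>The gcd of a block divides the leading entry and a further entry coprime to it. The
  second element matters: on a singleton the gcd would be the entry itself.\<close>

lemma stack_in_partition_points:
  fixes lam :: "'m::finite + 'n::finite \<Rightarrow> 'm"
  assumes lead: "\<And>B. B \<in> \<pi> \<Longrightarrow> \<exists>i k. Inl i \<in> B \<and> k \<in> B \<and> k \<noteq> Inl i \<and> (\<forall>k\<in>B. lam k = i)"
    and cop: "\<And>k. k \<noteq> Inl (lam k) \<Longrightarrow> coprime (v $ k) (v $ Inl (lam k))"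
  shows "v \<in> partition_points \<pi>"
  unfolding partition_points_def
proof (intro CollectI ballI)
  fix B assume "B \<in> \<pi>"
  then obtain i k where ik: "Inl i \<in> B" "k \<in> B" "k \<noteq> Inl i" "\<forall>k\<in>B. lam k = i" using lead by blast
  let ?g = "Gcd ((\<lambda>i. v $ i) ` B)"
  have "?g dvd v $ k" "?g dvd v $ Inl i" using ik by (auto intro: Gcd_dvd)
  moreover have "coprime (v $ k) (v $ Inl i)" using cop[of k] ik by auto
  ultimately have "is_unit ?g" by (metis coprime_common_divisor)
  then show "?g = 1" by (metis is_unit_normalize normalize_Gcd)
qed

lemma infnorm_vec_le_iff: "infnorm (x :: real ^ 'n) \<le> a \<longleftrightarrow> (\<forall>i. \<bar>x $ i\<bar> \<le> a)"
proof
  assume *: "infnorm x \<le> a"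
  show "\<forall>i. \<bar>x $ i\<bar> \<le> a"
    using order_trans[OF component_le_infnorm_cart *] by blast
next
  assume "\<forall>i. \<bar>x $ i\<bar> \<le> a"
  then show "infnorm x \<le> a" unfolding infnorm_cart by (intro cSup_least) auto
qed

text \<open>The vectors \<open>u q\<close> stand for q itself with y = 0 and for (q, -1) with y the
  last column. The integers witnessing nearness in the rows form p, and projecting solutions to q
  shows that infinitely many q give infinitely many solutions.\<close>

lemma infinite_solutions_of_coprime:
  fixes \<pi> :: "('m::finite + 'n::finite) set set" and lam :: "'m + 'n \<Rightarrow> 'm"
  assumes lead: "\<And>B. B \<in> \<pi> \<Longrightarrow> \<exists>i k. Inl i \<in> B \<and> k \<in> B \<and> k \<noteq> Inl i \<and> (\<forall>k\<in>B. lam k = i)"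
    and Zu: "\<And>q. Z *v u q = \<Theta> *v real_vec q - y"
    and inf: "infinite {q \<in> admissible (\<lambda>j. lam (Inl j)).
      Z \<in> coprime_near (u q) (\<lambda>r. nat (q $ lam (Inr r))) (min (\<psi> (int_supnorm q)) (1 / 4))}" (is "infinite ?S")
  shows "infinite (solutions \<pi> \<psi> \<Theta> (mat 1) y)"
proof -
  have "?S \<subseteq> fst ` solutions \<pi> \<psi> \<Theta> (mat 1) y"
  proof
    fix q assume q: "q \<in> ?S"
    then obtain t where t: "\<And>r. coprime (t r) (int (nat (q $ lam (Inr r))))"
      "\<And>r. \<bar>(\<Theta> *v real_vec q - y) $ r + of_int (t r)\<bar> \<le> \<psi> (int_supnorm q)"
      by (simp add: coprime_near_def Zu) metis
    have adm: "q $ j > 0" "j \<noteq> lam (Inl j) \<Longrightarrow> coprime (q $ j) (q $ lam (Inl j))" for j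
      using q by (auto simp: admissible_def)
    define p :: "int ^ 'n" where "p = (\<chi> r. t r)"
    have "stack q p \<in> partition_points \<pi>"
    proof (rule stack_in_partition_points[OF lead])
      fix k assume k: "k \<noteq> Inl (lam k)"
      show "coprime (stack q p $ k) (stack q p $ Inl (lam k))"
      proof (cases k)
        case (Inl j) then show ?thesis using k adm(2)[of j] by (simp add: stack_def)
      next
        case (Inr r) then show ?thesis using t(1)[of r] adm(1)[of "lam (Inr r)"] by (simp add: stack_def p_def)
      qed
    qed
    moreover have "q \<noteq> 0" using adm(1) by auto
    moreover have "infnorm (\<Theta> *v real_vec q + mat 1 *v real_vec p - y) \<le> \<psi> (int_supnorm q)"
      unfolding infnorm_vec_le_iff
    proof
      fix r show "\<bar>(\<Theta> *v real_vec q + mat 1 *v real_vec p - y) $ r\<bar> \<le> \<psi> (int_supnorm q)"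
        using t(2)[of r] by (simp add: p_def real_vec_def algebra_simps)
    qed
    ultimately have "(q, p) \<in> solutions \<pi> \<psi> \<Theta> (mat 1) y" by (simp add: solutions_def)
    then show "q \<in> fst ` solutions \<pi> \<psi> \<Theta> (mat 1) y" by force
  qed
  with inf show ?thesis by (meson finite_imageI finite_subset)
qed

lemma antimono_on_scaled:
  fixes \<psi> :: "nat \<Rightarrow> real"
  assumes mono: "antimono_on {1..} (\<lambda>x. real x ^ m * \<psi> x ^ n)"
    and div: "\<not> (\<lambda>j. real j ^ m * \<psi> j ^ n) summable_on {1..}" and k: "k > (0 :: nat)"
  shows "antimono_on {1..} (\<lambda>x. real x ^ m * (\<psi> x / real k) ^ n)"
    and "\<not> (\<lambda>j. real j ^ m * (\<psi> j / real k) ^ n) summable_on {1..}"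
proof -
  have eq: "(\<lambda>x. real x ^ m * (\<psi> x / real k) ^ n) = (\<lambda>x. (real x ^ m * \<psi> x ^ n) * (1 / real k ^ n))"
    by (simp add: power_divide)
  show "antimono_on {1..} (\<lambda>x. real x ^ m * (\<psi> x / real k) ^ n)"
    unfolding eq using mono unfolding monotone_on_def by (auto intro!: divide_right_mono)
  show "\<not> (\<lambda>j. real j ^ m * (\<psi> j / real k) ^ n) summable_on {1..}"
    unfolding eq using div k
      summable_on_cmult_left'[of "1 / real k ^ n" "\<lambda>j. real j ^ m * \<psi> j ^ n" "{1..}"] by simp
qed

lemma admissible_pos: "q \<in> admissible \<mu> \<Longrightarrow> q $ j > 0"
  by (simp add: admissible_def)

lemma int_supnorm_pos: "q \<in> admissible \<mu> \<Longrightarrow> int_supnorm q > 0"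
  using int_supnorm_ge[of q undefined] admissible_pos[of q \<mu> undefined] by linarith

lemma real_vec_lattice: "real_vec q \<in> lattice"
  by (simp add: lattice_vec real_vec_def)

context
  fixes \<pi> :: "('m::finite + 'n::finite) set set" and \<psi> :: "nat \<Rightarrow> real" and lam :: "'m + 'n \<Rightarrow> 'm"
  assumes lead: "\<And>B. B \<in> \<pi> \<Longrightarrow> \<exists>i k. Inl i \<in> B \<and> k \<in> B \<and> k \<noteq> Inl i \<and> (\<forall>k\<in>B. lam k = i)"
    and idem: "\<And>k. lam (Inl (lam k)) = lam k"
    and nonlead: "CARD('m) \<ge> 2 \<Longrightarrow> \<exists>i. lam (Inl i) \<noteq> i"
    and pos: "\<And>j. j \<ge> 1 \<Longrightarrow> \<psi> j > 0"
    and mono: "antimono_on {1..} (\<lambda>x. real x ^ (CARD('m) - 1) * \<psi> x ^ CARD('n))"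
    and div: "\<not> (\<lambda>j. real j ^ (CARD('m) - 1) * \<psi> j ^ CARD('n)) summable_on {1..}"
begin

abbreviation "Adm \<equiv> admissible (\<lambda>j. lam (Inl j))"

lemma min_weight:
  assumes "q \<in> Adm"
  shows "0 \<le> min (\<psi> (int_supnorm q)) (1 / 4)" "min (\<psi> (int_supnorm q)) (1 / 4) < 1 / 2"
  using pos[of "int_supnorm q"] int_supnorm_pos[OF assms] by (auto simp: Suc_le_eq less_imp_le)

lemma modulus:
  assumes "q \<in> Adm"
  shows "few_factors (nat (q $ lam (Inr r)))" "nat (q $ lam (Inr r)) > 0"
    "real (nat (q $ lam (Inr r))) \<le> real (int_supnorm q)"
proof -
  have "few_factors (nat (q $ lam (Inl (lam (Inr r)))))" using assms by (simp add: admissible_def)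
  then show "few_factors (nat (q $ lam (Inr r)))" by (simp add: idem)
  show "nat (q $ lam (Inr r)) > 0" using admissible_pos[OF assms] by simp
  show "real (nat (q $ lam (Inr r))) \<le> real (int_supnorm q)"
    using int_supnorm_ge[of q "lam (Inr r)"] by linarith
qed

lemma nonsummable_weights: "\<not> (\<lambda>q. min (\<psi> (int_supnorm q)) (1 / 4) ^ CARD('n)) summable_on Adm"
proof -
  obtain i0 where "\<forall>i\<ge>i0. (1 / 16) ^ CARD('m) * (2 ^ i) ^ CARD('m)
     \<le> real (card {q \<in> Adm. 2 ^ i < int_supnorm q \<and> int_supnorm q \<le> 2 ^ Suc i})"
    using card_admissible[of "\<lambda>j. lam (Inl j)"] idem by blast
  then have "\<not> (\<lambda>q. min (\<psi> (int_supnorm q)) (1 / 4) ^ CARD('n)) summable_on {q \<in> Adm. int_supnorm q > 0}"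
    using pos mono div
    by (intro nonsummable_of_dyadic_windows[where m = "CARD('m)" and c = "(1 / 16) ^ CARD('m)" and ?i0.0 = i0])
      (auto intro: finite_subset[OF _ finite_int_supnorm_le])
  moreover have "{q \<in> Adm. int_supnorm q > 0} = Adm" using int_supnorm_pos by blast
  ultimately show ?thesis by simp
qed

lemma countable_Adm: "countable Adm"
proof -
  have "Adm \<subseteq> (\<Union>K. {q. int_supnorm q \<le> K})" by auto
  then show ?thesis by (rule countable_subset) (auto intro: countable_finite finite_int_supnorm_le)
qed

text \<open>For positive q the entry attaining the sup norm dominates every leading entry, as the
  lower bound requires of the translated column.\<close>

definition "argmax q = (SOME j. int (int_supnorm q) = \<bar>q $ j\<bar>)" for q :: "int ^ 'm"

lemma argmax: "q \<in> Adm \<Longrightarrow> real_of_int (q $ argmax q) = real (int_supnorm q)"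
proof -
  assume q: "q \<in> Adm"
  have "int (int_supnorm q) = \<bar>q $ argmax q\<bar>" unfolding argmax_def by (rule someI_ex[OF int_supnorm_attained])
  then show ?thesis using admissible_pos[OF q, of "argmax q"] by linarith
qed

lemma AE_infinite_solutions_of_vectors:
  fixes u :: "int ^ 'm \<Rightarrow> real ^ 'k" and \<Theta> :: "real ^ 'k ^ 'n \<Rightarrow> real ^ 'm ^ 'n"
  assumes Zu: "\<And>Z q. Z *v u q = \<Theta> Z *v real_vec q - y Z" and ab: "a \<noteq> (b :: 'k)"
    and lat: "\<And>q. u q \<in> lattice" and l: "\<And>q. q \<in> Adm \<Longrightarrow> u q $ l q = real (int_supnorm q)"
    and ind: "\<And>q q'. q \<in> Adm \<Longrightarrow> q' \<in> Adm \<Longrightarrow> q \<noteq> q' \<Longrightarrow> \<exists>a b. u q $ a * u q' $ b \<noteq> u q $ b * u q' $ a"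
  shows "AE Z in lborel. infinite (solutions \<pi> \<psi> (\<Theta> Z) (mat 1) (y Z))"
proof -
  have "AE Z in lborel. infinite {q \<in> Adm. Z \<in> coprime_near (u q) (\<lambda>r. nat (q $ lam (Inr r))) (min (\<psi> (int_supnorm q)) (1 / 4))}"
  proof (rule Khintchine_Groshev_pairwise_independent[where l = l, OF _ ab])
    fix q assume q: "q \<in> Adm"
    show "0 \<le> min (\<psi> (int_supnorm q)) (1 / 4) \<and> min (\<psi> (int_supnorm q)) (1 / 4) < 1 / 2"
      using min_weight[OF q] by blast
    show "few_factors (nat (q $ lam (Inr r))) \<and> 0 < nat (q $ lam (Inr r)) \<and> real (nat (q $ lam (Inr r))) \<le> u q $ l q" for r
      using modulus[OF q, of r] l[OF q] by simp
  next
    fix R :: real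
    show "finite {q \<in> Adm. u q $ l q \<le> R}"
      by (rule finite_subset[OF _ finite_int_supnorm_le[of "nat \<lfloor>R\<rfloor>"]]) (auto simp: l intro: le_nat_floor)
  qed (use countable_Adm nonsummable_weights lat ind in auto)
  then show ?thesis
    by eventually_elim (rule infinite_solutions_of_coprime[of \<pi> lam], erule lead, rule Zu)
qed

text \<open>A q-index that does not lead has an entry coprime to that of its leader, so q is
  primitive, and proportional primitive vectors with positive entries coincide.\<close>

lemma AE_infinite_solutions_homogeneous_many_columns:
  assumes m: "CARD('m) \<ge> 2"
  shows "AE \<Theta> in lborel. infinite (solutions \<pi> \<psi> \<Theta> (mat 1) 0)"
proof -
  obtain i where i: "lam (Inl i) \<noteq> i" using nonlead[OF m] by blast
  show ?thesis
  proof (rule AE_infinite_solutions_of_vectors[where u = real_vec and l = argmax, OF _ i])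
    fix q q' assume q: "q \<in> Adm" and q': "q' \<in> Adm" and ne: "q \<noteq> q'"
    show "\<exists>a b. real_vec q $ a * real_vec q' $ b \<noteq> real_vec q $ b * real_vec q' $ a"
    proof (rule ccontr)
      assume *: "\<not> ?thesis"
      have eq: "q $ a * q' $ b = q $ b * q' $ a" for a b
      proof -
        have "real_vec q $ a * real_vec q' $ b = real_vec q $ b * real_vec q' $ a" using * by blast
        then show ?thesis unfolding real_vec_def by (simp flip: of_int_mult)
      qed
      have c: "coprime (q $ i) (q $ lam (Inl i))" "coprime (q' $ i) (q' $ lam (Inl i))"
        using q q' i unfolding admissible_def by force+
      have "q $ i dvd q $ lam (Inl i) * q' $ i" using eq[of i "lam (Inl i)"] by (metis dvd_triv_left)
      then have "q $ i dvd q' $ i" using c(1) by (metis coprime_dvd_mult_right_iff)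
      moreover have "q' $ i dvd q $ i * q' $ lam (Inl i)" using eq[of i "lam (Inl i)"] by (metis dvd_triv_right)
      then have "q' $ i dvd q $ i" using c(2) by (metis coprime_dvd_mult_left_iff)
      ultimately have "q $ i = q' $ i"
        using admissible_pos[OF q, of i] admissible_pos[OF q', of i] by (simp add: zdvd_antisym_nonneg)
      then have "q' $ b = q $ b" for b using eq[of i b] admissible_pos[OF q', of i] by simp
      then show False using ne by (simp add: vec_eq_iff)
    qed
  next
    show "real_vec q $ argmax q = real (int_supnorm q)" if "q \<in> Adm" for q
      using argmax[OF that] by (simp add: real_vec_def)
  qed (simp_all add: real_vec_lattice)
qed

lemma AE_infinite_solutions_homogeneous_one_column:
  assumes m: "CARD('m) = 1"
  shows "AE \<Theta> in lborel. infinite (solutions \<pi> \<psi> \<Theta> (mat 1) 0)"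
proof -
  obtain l :: 'm where "UNIV = {l}" using m by (metis card_1_singletonE)
  then have l: "j = l" for j by blast
  define U where "U = {q :: nat. q > 0 \<and> few_factors q}"
  have div: "\<not> (\<lambda>q. min (\<psi> q) (1 / 4) ^ CARD('n)) summable_on {q \<in> U. 2 ^ j dvd q}" for j
  proof -
    have "\<not> (\<lambda>q. min (\<psi> q) (1 / 4) ^ CARD('n)) summable_on {q \<in> {q. few_factors q \<and> 2 ^ j dvd q}. q > 0}"
    \<comment> \<open>With q = 2^j s and s in (2^d, 2^(d+1)], at least (2/3) 2^(d+1) - 2^d = 2^d/3
      of the s have few factors, and 2^d = 2^i / 2^j.\<close>
    proof (rule nonsummable_of_dyadic_windows[where m = 1 and c = "1 / (3 * 2 ^ j)" and ?i0.0 = j])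
      fix i assume i: "i \<ge> j"
      then obtain d where d: "i = j + d" using le_Suc_ex by blast
      define Good where "Good = {s \<in> {1..2 ^ Suc d}. few_factors s}"
      let ?T = "{q \<in> {q. few_factors q \<and> 2 ^ j dvd q}. 2 ^ i < q \<and> q \<le> 2 ^ Suc i}"
      have "(\<lambda>s. 2 ^ j * s) ` (Good - {1..2 ^ d}) \<subseteq> ?T"
        using few_factors_power2_mult by (auto simp: Good_def d power_add)
      then have "card ((\<lambda>s. 2 ^ j * s) ` (Good - {1..2 ^ d})) \<le> card ?T"
        by (intro card_mono) auto
      also have "card ((\<lambda>s. 2 ^ j * s) ` (Good - {1..2 ^ d})) = card (Good - {1..2 ^ d})"
        by (intro card_image) (auto simp: inj_on_def)
      finally have "real (card (Good - {1..2 ^ d})) \<le> real (card ?T)" by (rule of_nat_mono)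
      moreover have "real (card Good) - 2 ^ d \<le> real (card (Good - {1..2 ^ d}))"
      proof -
        have "card Good \<le> card (Good - {1..2 ^ d}) + 2 ^ d"
          using diff_card_le_card_Diff[of "{1..2 ^ d}" Good] by simp
        then have "real (card Good) \<le> real (card (Good - {1..2 ^ d}) + 2 ^ d)" by (rule of_nat_mono)
        then show ?thesis by simp
      qed
      moreover have "2 / 3 * real (2 ^ Suc d) \<le> real (card Good)" unfolding Good_def by (rule card_few_factors)
      ultimately show "1 / (3 * 2 ^ j) * (2 ^ i) ^ 1 \<le> real (card ?T)"
        by (simp add: d power_add)
    next
      fix i show "finite {q \<in> {q. few_factors q \<and> 2 ^ j dvd q}. 2 ^ i < q \<and> q \<le> 2 ^ Suc i}"
        by (rule finite_subset[of _ "{..2 ^ Suc i}"]) auto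
    qed (use pos mono div m in auto)
    then show ?thesis by (rule back_subst[of "\<lambda>S. \<not> _ summable_on S"]) (auto simp: U_def)
  qed
  have "AE \<Theta> :: real ^ 'm ^ 'n in lborel. infinite {q \<in> U. \<forall>r. \<exists>t\<in>{t. coprime t (int q)}.
      \<bar>\<Theta> $ r $ l * real q + of_int t\<bar> \<le> min (\<psi> q) (1 / 4)}"
    using pos div by (intro Khintchine_coprime_one_column l) (auto simp: U_def Suc_le_eq less_imp_le)
  then show ?thesis
  proof eventually_elim
    case (elim \<Theta>)
    define e :: "nat \<Rightarrow> int ^ 'm" where "e q = (\<chi> _. int q)" for q
    have UNIVl: "(UNIV :: 'm set) = {l}" using l by blast
    have sup: "int_supnorm (e q) = q" for q
      by (simp add: int_supnorm_def e_def UNIVl)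
    have laml: "lam k = l" for k by (rule l)
    let ?S = "{q \<in> Adm. \<Theta> \<in> coprime_near (real_vec q) (\<lambda>r. nat (q $ lam (Inr r))) (min (\<psi> (int_supnorm q)) (1 / 4))}"
    have "e ` {q \<in> U. \<forall>r. \<exists>t\<in>{t. coprime t (int q)}. \<bar>\<Theta> $ r $ l * real q + of_int t\<bar> \<le> min (\<psi> q) (1 / 4)} \<subseteq> ?S"
    proof (rule image_subsetI)
      fix q assume q: "q \<in> {q \<in> U. \<forall>r. \<exists>t\<in>{t. coprime t (int q)}. \<bar>\<Theta> $ r $ l * real q + of_int t\<bar> \<le> min (\<psi> q) (1 / 4)}"
      have "e q \<in> Adm" unfolding admissible_def using q l[of _] by (auto simp: e_def U_def laml)
      moreover have "(\<Theta> *v real_vec (e q)) $ r = \<Theta> $ r $ l * real q" for r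
        by (simp add: matrix_vector_mult_def UNIVl real_vec_def e_def)
      ultimately show "e q \<in> ?S"
        using q by (simp add: sup coprime_near_def) (simp add: e_def)
    qed
    moreover have "inj_on e S" for S by (auto simp: inj_on_def e_def vec_eq_iff)
    ultimately have "infinite ?S" using elim by (meson finite_imageD finite_subset)
    then show ?case
      by (rule infinite_solutions_of_coprime[where Z = \<Theta> and u = real_vec and \<pi> = \<pi>, rotated 2]) (erule lead, simp)
  qed
qed

text \<open>The common last entry -1 separates different q: where q and q' differ at j, the minor on
  j and the last coordinate is, up to sign, the difference of these entries. The case m = 1 is thus
  included.\<close>

lemma AE_infinite_solutions_inhomogeneous:
  "AE Z :: real ^ ('m + unit) ^ 'n in lborel. infinite (solutions \<pi> \<psi> (left_cols Z) (mat 1) (last_col Z))"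
proof -
  define u :: "int ^ 'm \<Rightarrow> real ^ ('m + unit)" where
    "u q = (\<chi> k. case k of Inl j \<Rightarrow> of_int (q $ j) | Inr _ \<Rightarrow> - 1)" for q
  show ?thesis
  proof (rule AE_infinite_solutions_of_vectors[where u = u and l = "\<lambda>q. Inl (argmax q)" and a = "Inl undefined" and b = "Inr ()"])
    show "Z *v u q = left_cols Z *v real_vec q - last_col Z" for Z :: "real ^ ('m + unit) ^ 'n" and q
      by (simp add: vec_eq_iff matrix_vector_mult_def u_def left_cols_def last_col_def real_vec_def
          UNIV_Plus_UNIV[symmetric] sum.Plus UNIV_unit del: UNIV_Plus_UNIV)
    show "u q \<in> lattice" for q by (auto simp: lattice_vec u_def split: sum.split)
    show "u q $ Inl (argmax q) = real (int_supnorm q)" if "q \<in> Adm" for q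
      using argmax[OF that] by (simp add: u_def)
    fix q q' :: "int ^ 'm" assume "q \<noteq> q'"
    then obtain j where "q $ j \<noteq> q' $ j" by (auto simp: vec_eq_iff)
    then show "\<exists>a b. u q $ a * u q' $ b \<noteq> u q $ b * u q' $ a"
      by (intro exI[of _ "Inl j"] exI[of _ "Inr ()"]) (simp add: u_def)
  qed simp
qed

end

section \<open>The convergence case\<close>

lemma emeasure_near_real_le:
  assumes "m \<noteq> 0" "\<psi> \<ge> 0"
  shows "emeasure lborel {x::real. \<bar>c + x * m\<bar> \<le> \<psi>} \<le> ennreal (2 * \<psi> / \<bar>m\<bar>)"
proof -
  have "{x::real. \<bar>c + x * m\<bar> \<le> \<psi>} \<subseteq> {- c / m - \<psi> / \<bar>m\<bar> .. - c / m + \<psi> / \<bar>m\<bar>}"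
  proof
    fix x assume "x \<in> {x::real. \<bar>c + x * m\<bar> \<le> \<psi>}"
    moreover have "c + x * m = (x - (- c / m)) * m" using assms by (simp add: field_simps)
    ultimately have "\<bar>x - (- c / m)\<bar> * \<bar>m\<bar> \<le> \<psi>" by (simp add: abs_mult)
    then have "\<bar>x - (- c / m)\<bar> \<le> \<psi> / \<bar>m\<bar>" using assms by (simp add: pos_le_divide_eq)
    then show "x \<in> {- c / m - \<psi> / \<bar>m\<bar> .. - c / m + \<psi> / \<bar>m\<bar>}" by (auto simp: abs_le_iff)
  qed
  then have "emeasure lborel {x::real. \<bar>c + x * m\<bar> \<le> \<psi>} \<le> emeasure lborel {- c / m - \<psi> / \<bar>m\<bar> .. - c / m + \<psi> / \<bar>m\<bar>}"
    by (rule emeasure_mono) simp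
  also have "\<dots> = ennreal (2 * \<psi> / \<bar>m\<bar>)" using assms by (simp add: divide_right_mono)
  finally show ?thesis .
qed

definition matrix_box :: "real \<Rightarrow> (real ^ 'k ^ 'n) set" where
  "matrix_box R = {X. \<forall>i k. \<bar>X $ i $ k\<bar> \<le> R}"

lemma matrix_box_measurable [measurable, simp]: "(matrix_box R :: (real ^ 'k ^ 'n) set) \<in> sets borel"
  unfolding matrix_box_def by measurable

lemma emeasure_matrix_box_finite: "emeasure lborel (matrix_box R :: (real ^ 'k ^ 'n) set) < \<infinity>"
proof -
  have "norm X \<le> (\<Sum>b\<in>(Basis :: (real ^ 'k ^ 'n) set). \<bar>R\<bar>)" if "X \<in> (matrix_box R :: (real ^ 'k ^ 'n) set)" for X
  proof (rule order_trans[OF norm_le_l1], intro sum_mono)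
    fix b :: "real ^ 'k ^ 'n" assume "b \<in> Basis"
    then obtain i k where "b = axis i (axis k 1)" by (auto simp: Basis_vec_def)
    then have "X \<bullet> b = X $ i $ k" by (simp add: inner_axis)
    moreover have "\<bar>X $ i $ k\<bar> \<le> R" using that by (simp add: matrix_box_def)
    ultimately show "\<bar>X \<bullet> b\<bar> \<le> \<bar>R\<bar>" by simp
  qed
  then have "bounded (matrix_box R :: (real ^ 'k ^ 'n) set)" by (rule boundedI)
  then show ?thesis by (rule emeasure_bounded_finite)
qed

text \<open>The upper counterpart of the local lower bound. A translation by less than 1 that ends
  in the box starts in the box enlarged by 1, and in each row the suitable translations lie in an
  interval of length 2\<psi>/|v_l|.\<close>

lemma emeasure_strip_le:
  fixes v :: "real ^ 'k" and y :: "real ^ 'n"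
  assumes l: "v $ l \<noteq> 0" and \<psi>: "\<psi> \<ge> 0"
  shows "emeasure lborel (matrix_box R \<inter> {X. \<forall>i. \<bar>(X *v v) $ i - y $ i\<bar> \<le> \<psi>})
    \<le> emeasure lborel (matrix_box (R + 1) :: (real ^ 'k ^ 'n) set) * ennreal ((2 * \<psi> / \<bar>v $ l\<bar>) ^ CARD('n))"
proof -
  define A where "A = {X :: real ^ 'k ^ 'n. \<forall>i. \<bar>(X *v v) $ i - y $ i\<bar> \<le> \<psi>}"
  have Am [measurable, simp]: "A \<in> sets borel" unfolding A_def by measurable
  define E where "E = matrix_box R \<inter> A"
  have Em [measurable, simp]: "E \<in> sets borel" unfolding E_def by measurable
  define B where "B = (matrix_box (R + 1) :: (real ^ 'k ^ 'n) set)"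
  define T where "T = (cell 0 0 :: (real ^ 'n) set)"
  have [measurable]: "B \<in> sets borel" "T \<in> sets borel" by (auto simp: B_def T_def)
  have T: "0 \<le> \<tau> $ i \<and> \<tau> $ i < 1" if "\<tau> \<in> T" for \<tau> i
  proof -
    have "\<lfloor>\<tau> $ i\<rfloor> = 0" using that by (auto simp: T_def cell_def Basis_vec_def inner_axis)
    then show ?thesis by linarith
  qed
  have T1: "emeasure lborel T = 1" by (simp add: T_def emeasure_cell)
  have sub: "X \<in> B" if "X + column_matrix l \<tau> \<in> E" "\<tau> \<in> T" for X \<tau>
    unfolding B_def matrix_box_def
  proof (intro CollectI allI)
    fix i k
    have "\<bar>(X + column_matrix l \<tau>) $ i $ k\<bar> \<le> R" using that by (auto simp: E_def matrix_box_def)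
    then show "\<bar>X $ i $ k\<bar> \<le> R + 1"
      using T[OF that(2), of i] by (auto simp: column_matrix_def split: if_splits)
  qed
  have "emeasure lborel E = emeasure lborel E * emeasure lborel T" by (simp add: T1)
  also have "\<dots> = (\<integral>\<^sup>+X. emeasure lborel {\<tau> \<in> T. X + column_matrix l \<tau> \<in> E} \<partial>lborel)"
    by (intro emeasure_column_translations(2)) (simp_all add: T_def)
  also have "\<dots> \<le> (\<integral>\<^sup>+X. ennreal ((2 * \<psi> / \<bar>v $ l\<bar>) ^ CARD('n)) * indicator B X \<partial>lborel)"
  proof (intro nn_integral_mono)
    fix X :: "real ^ 'k ^ 'n"
    define V where "V i = {x::real. \<bar>((X *v v) $ i - y $ i) + x * (v $ l)\<bar> \<le> \<psi>}" for i
    have Vm: "V i \<in> sets borel" for i unfolding V_def by measurable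
    have "emeasure lborel {\<tau> \<in> T. X + column_matrix l \<tau> \<in> E} \<le> emeasure lborel {\<tau> :: real ^ 'n. \<forall>i. \<tau> $ i \<in> V i}"
    proof (intro emeasure_mono subsetI CollectI allI)
      fix \<tau> i assume "\<tau> \<in> {\<tau> \<in> T. X + column_matrix l \<tau> \<in> E}"
      then have "\<bar>((X + column_matrix l \<tau>) *v v) $ i - y $ i\<bar> \<le> \<psi>" by (simp add: E_def A_def)
      then show "\<tau> $ i \<in> V i" unfolding add_column_matrix_vector V_def by (simp add: algebra_simps)
    next
      show "{\<tau> :: real ^ 'n. \<forall>i. \<tau> $ i \<in> V i} \<in> sets lborel" unfolding V_def by measurable
    qed
    also have "\<dots> = (\<Prod>i\<in>UNIV. emeasure lborel (V i))"
      using Vm by (rule emeasure_lborel_product_vec)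
    also have "\<dots> \<le> (\<Prod>i\<in>(UNIV::'n set). ennreal (2 * \<psi> / \<bar>v $ l\<bar>))"
      unfolding V_def using l \<psi> by (intro prod_mono_ennreal emeasure_near_real_le) auto
    also have "\<dots> = ennreal ((2 * \<psi> / \<bar>v $ l\<bar>) ^ CARD('n))"
      using \<psi> by (simp add: ennreal_power)
    finally show "emeasure lborel {\<tau> \<in> T. X + column_matrix l \<tau> \<in> E}
        \<le> ennreal ((2 * \<psi> / \<bar>v $ l\<bar>) ^ CARD('n)) * indicator B X"
    proof (cases "X \<in> B")
      case False
      then have "{\<tau> \<in> T. X + column_matrix l \<tau> \<in> E} = {}" using sub by blast
      then show ?thesis by (simp only: emeasure_empty zero_le)
    qed simp
  qed
  also have "\<dots> = emeasure lborel B * ennreal ((2 * \<psi> / \<bar>v $ l\<bar>) ^ CARD('n))"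
    by (subst nn_integral_cmult_indicator) (simp_all add: mult.commute)
  finally show ?thesis unfolding E_def A_def B_def .
qed

lemma card_int_supnorm_le: "real (card {p :: int ^ 'n::finite. int_supnorm p \<le> K}) \<le> (2 * real K + 1) ^ CARD('n)"
proof -
  have "{p :: int ^ 'n. int_supnorm p \<le> K} \<subseteq> (\<lambda>f. \<chi> j. f j) ` (UNIV \<rightarrow>\<^sub>E {- int K..int K})"
  proof
    fix p :: "int ^ 'n" assume "p \<in> {p. int_supnorm p \<le> K}"
    then have "\<bar>p $ j\<bar> \<le> int K" for j using int_supnorm_ge[of p j] by simp
    then show "p \<in> (\<lambda>f. \<chi> j. f j) ` (UNIV \<rightarrow>\<^sub>E {- int K..int K})"
      by (intro image_eqI[of _ _ "\<lambda>j. p $ j"]) (auto simp: abs_le_iff minus_le_iff)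
  qed
  then have "card {p :: int ^ 'n. int_supnorm p \<le> K} \<le> card ((UNIV :: 'n set) \<rightarrow>\<^sub>E {- int K..int K})"
    by (intro surj_card_le) (auto intro!: finite_PiE)
  also have "\<dots> = (2 * K + 1) ^ CARD('n)" by (simp add: card_PiE nat_add_distrib nat_mult_distrib)
  finally have "real (card {p :: int ^ 'n. int_supnorm p \<le> K}) \<le> real ((2 * K + 1) ^ CARD('n))" by (rule of_nat_mono)
  then show ?thesis by (simp add: add.commute)
qed

text \<open>The shell is covered by one family for each coordinate that may equal j or -j; 2j + 1 <=
  3j then gives a pure power of j.\<close>

lemma card_int_supnorm_eq:
  assumes j: "j \<ge> 1"
  shows "real (card {q :: int ^ 'm::finite. int_supnorm q = j}) \<le> 2 * real CARD('m) * (3 * real j) ^ (CARD('m) - 1)"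
proof -
  define P where "P l = PiE (UNIV :: 'm set) (\<lambda>i. if i = l then {- int j, int j} else {- int j..int j})" for l :: 'm
  have finP: "finite (P l)" for l unfolding P_def by (intro finite_PiE) auto
  have "{q :: int ^ 'm. int_supnorm q = j} \<subseteq> (\<lambda>f. \<chi> i. f i) ` (\<Union>l. P l)"
  proof
    fix q :: "int ^ 'm" assume q: "q \<in> {q. int_supnorm q = j}"
    obtain l where "int (int_supnorm q) = \<bar>q $ l\<bar>" using int_supnorm_attained by blast
    then have "q $ l \<in> {- int j, int j}" using q by auto
    moreover have "q $ i \<in> {- int j..int j}" for i
      using int_supnorm_ge[of q i] q by (simp add: abs_le_iff minus_le_iff)
    ultimately have "(\<lambda>i. q $ i) \<in> P l" by (auto simp: P_def)
    then show "q \<in> (\<lambda>f. \<chi> i. f i) ` (\<Union>l. P l)" by (intro image_eqI[of _ _ "\<lambda>i. q $ i"]) auto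
  qed
  then have "card {q :: int ^ 'm. int_supnorm q = j} \<le> card (\<Union>l. P l)"
    using finP by (intro surj_card_le) auto
  also have "\<dots> \<le> (\<Sum>l\<in>UNIV. card (P l))" by (intro card_UN_le) simp
  also have "\<dots> = (\<Sum>l\<in>(UNIV::'m set). 2 * (2 * j + 1) ^ (CARD('m) - 1))"
  proof (intro sum.cong refl)
    fix l :: 'm
    have "card (P l) = (\<Prod>i\<in>UNIV. card (if i = l then {- int j, int j} else {- int j..int j}))"
      unfolding P_def by (simp add: card_PiE)
    also have "\<dots> = card {- int j, int j} * (\<Prod>i\<in>UNIV - {l}. card (if i = l then {- int j, int j} else {- int j..int j}))"
      by (subst prod.remove[of _ l]) auto
    also have "(\<Prod>i\<in>UNIV - {l}. card (if i = l then {- int j, int j} else {- int j..int j})) = (\<Prod>i\<in>UNIV - {l}. 2 * j + 1)"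
      by (intro prod.cong) (auto simp: nat_add_distrib nat_mult_distrib)
    also have "card {- int j, int j} = 2" using j by simp
    finally show "card (P l) = 2 * (2 * j + 1) ^ (CARD('m) - 1)" by simp
  qed
  finally have "real (card {q :: int ^ 'm. int_supnorm q = j}) \<le> real (\<Sum>l\<in>(UNIV::'m set). 2 * (2 * j + 1) ^ (CARD('m) - 1))"
    by (rule of_nat_mono)
  also have "\<dots> = 2 * real CARD('m) * (2 * real j + 1) ^ (CARD('m) - 1)" by (simp add: add.commute)
  also have "\<dots> \<le> 2 * real CARD('m) * (3 * real j) ^ (CARD('m) - 1)"
    using j by (intro mult_left_mono power_mono) auto
  finally show ?thesis .
qed

lemma Theta_Phi_stack:
  fixes X :: "real ^ ('m::finite + 'n::finite) ^ 'n"
  shows "Theta X *v real_vec q + Phi X *v real_vec p = X *v real_vec (stack q p)"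
  by (simp add: vec_eq_iff matrix_vector_mult_def Theta_def Phi_def stack_def real_vec_def
      UNIV_Plus_UNIV[symmetric] sum.Plus del: UNIV_Plus_UNIV)

lemma int_supnorm_ge_1: "q \<noteq> 0 \<Longrightarrow> int_supnorm q \<ge> 1"
proof -
  assume "q \<noteq> 0"
  then obtain j where "q $ j \<noteq> 0" by (auto simp: vec_eq_iff)
  then show ?thesis using int_supnorm_ge[of q j] by linarith
qed

text \<open>Without such a bound the measures of the strips are not summable over \<open>p\<close>.\<close>

lemma solution_height_bound:
  fixes X :: "real ^ ('m::finite + 'n::finite) ^ 'n" and y :: "real ^ 'n"
  assumes det: "det (Phi X) \<noteq> 0"
    and \<psi>: "\<And>j. j \<ge> 1 \<Longrightarrow> \<psi> j \<le> M"
  obtains C where "\<And>q p. q \<noteq> 0 \<Longrightarrow> infnorm (Theta X *v real_vec q + Phi X *v real_vec p - y) \<le> \<psi> (int_supnorm q)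
     \<Longrightarrow> real (int_supnorm p) \<le> C * real (int_supnorm q)"
proof -
  obtain B where B: "B ** Phi X = mat 1" using det invertible_det_nz[of "Phi X"] unfolding invertible_def by blast
  obtain K where K: "K > 0" "\<And>x. norm (B *v x) \<le> norm x * K"
    using bounded_linear.pos_bounded[OF matrix_vector_mul_bounded_linear[of B]] by blast
  obtain K' where K': "K' > 0" "\<And>x. norm (Theta X *v x) \<le> norm x * K'"
    using bounded_linear.pos_bounded[OF matrix_vector_mul_bounded_linear[of "Theta X"]] by blast
  define a where "a = sqrt DIM(real ^ 'n)"
  define b where "b = sqrt DIM(real ^ 'm)"
  show thesis
  proof (rule that)
    fix q p assume q: "q \<noteq> 0" and le: "infnorm (Theta X *v real_vec q + Phi X *v real_vec p - y) \<le> \<psi> (int_supnorm q)"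
    define z where "z = Theta X *v real_vec q + Phi X *v real_vec p - y"
    have q1: "1 \<le> real (int_supnorm q)" using int_supnorm_ge_1[OF q] by simp
    have "Phi X *v real_vec p = z + y - Theta X *v real_vec q" by (simp add: z_def)
    then have "real_vec p = B *v (z + y - Theta X *v real_vec q)"
      by (metis B matrix_vector_mul_assoc matrix_vector_mul_lid)
    then have "norm (real_vec p) \<le> norm (z + y - Theta X *v real_vec q) * K" using K(2) by metis
    also have "norm (z + y - Theta X *v real_vec q) \<le> norm z + norm y + norm (Theta X *v real_vec q)"
      using norm_triangle_ineq4[of "z + y" "Theta X *v real_vec q"] norm_triangle_ineq[of z y] by linarith
    also have "norm z \<le> a * \<bar>M\<bar>"
    proof -
      have "infnorm z \<le> \<bar>M\<bar>" using le \<psi>[OF int_supnorm_ge_1[OF q]] unfolding z_def by linarith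
      then show ?thesis unfolding a_def using norm_le_infnorm[of z] by (meson mult_left_mono order_trans real_sqrt_ge_zero of_nat_0_le_iff)
    qed
    also have "norm (Theta X *v real_vec q) \<le> (b * real (int_supnorm q)) * K'"
      unfolding b_def real_int_supnorm using K' norm_le_infnorm[of "real_vec q"]
      by (meson mult_right_mono order_trans less_imp_le)
    finally have "norm (real_vec p) \<le> (a * \<bar>M\<bar> + norm y + b * real (int_supnorm q) * K') * K"
      using K(1) by (simp add: mult_right_mono)
    \<comment> \<open>Since the sup norm of q is at least 1, the constant terms are absorbed into a
      multiple of it.\<close>
    also have "\<dots> \<le> ((a * \<bar>M\<bar> + norm y) * real (int_supnorm q) + b * real (int_supnorm q) * K') * K"
    proof (intro mult_right_mono add_right_mono)
      have "(a * \<bar>M\<bar> + norm y) * 1 \<le> (a * \<bar>M\<bar> + norm y) * real (int_supnorm q)"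
        using q1 by (intro mult_left_mono) (auto simp: a_def)
      then show "a * \<bar>M\<bar> + norm y \<le> (a * \<bar>M\<bar> + norm y) * real (int_supnorm q)" by simp
    qed (use K in auto)
    also have "\<dots> = ((a * \<bar>M\<bar> + norm y + b * K') * K) * real (int_supnorm q)" by (simp add: algebra_simps)
    finally show "real (int_supnorm p) \<le> ((a * \<bar>M\<bar> + norm y + b * K') * K) * real (int_supnorm q)"
      unfolding real_int_supnorm using infnorm_le_norm[of "real_vec p"] by linarith
  qed
qed

text \<open>For |q| = j there are O(j^(m-1)) vectors q and O(j^n) vectors p with |p| <= R j, and
  each strip has measure O((\<psi>(j)/j)^n) inside a box, so the powers j^n cancel. One integer R
  exhausts both the boxes for X and the ratios |p|/|q|.\<close>

theorem AE_finite_solutions: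
  fixes \<psi> :: "nat \<Rightarrow> real" and y :: "real ^ 'n::finite"
  assumes pos: "\<And>j. j \<ge> 1 \<Longrightarrow> \<psi> j > 0"
    and mono: "antimono_on {1..} (\<lambda>x. real x ^ (CARD('m::finite) - 1) * \<psi> x ^ CARD('n))"
    and conv: "(\<lambda>j. real j ^ (CARD('m) - 1) * \<psi> j ^ CARD('n)) summable_on {1..}"
  shows "AE X :: real ^ ('m + 'n) ^ 'n in lborel. finite {(q :: int ^ 'm, p :: int ^ 'n).
      q \<noteq> 0 \<and> infnorm (Theta X *v real_vec q + Phi X *v real_vec p - y) \<le> \<psi> (int_supnorm q)}"
proof -
  let ?m = "CARD('m)" and ?n = "CARD('n)"
  define St where "St R q p = matrix_box (real R) \<inter> {X :: real ^ ('m + 'n) ^ 'n. \<forall>i. \<bar>(X *v real_vec (stack q p)) $ i - y $ i\<bar> \<le> \<psi> (int_supnorm q)}"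
    for R :: nat and q :: "int ^ 'm" and p :: "int ^ 'n"
  have Stm [measurable, simp]: "St R q p \<in> sets borel" for R q p unfolding St_def by measurable
  define Q where "Q j = {q :: int ^ 'm. int_supnorm q = j}" for j
  define P where "P R j = {p :: int ^ 'n. int_supnorm p \<le> R * j}" for R j
  have fin: "finite (Q j)" "finite (P R j)" for R j
    unfolding Q_def P_def by (rule finite_subset[OF _ finite_int_supnorm_le[of j]], auto intro: finite_int_supnorm_le)
  \<comment> \<open>The empty set at j = 0 agrees with q being nonzero and keeps the unconstrained
    value of \<psi> at 0 out of the sum.\<close>
  define E where "E R j = (if j = 0 then {} else (\<Union>q\<in>Q j. \<Union>p\<in>P R j. St R q p))" for R j
  have Em [measurable, simp]: "E R j \<in> sets borel" for R j
    unfolding E_def using fin by (auto intro!: sets.finite_UN)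
  have "AE X in lborel. eventually (\<lambda>j. X \<in> space lborel - E R j) sequentially" for R
  proof -
    obtain M where M: "emeasure lborel (matrix_box (real R + 1) :: (real ^ ('m + 'n) ^ 'n) set) = ennreal M" "M \<ge> 0"
      using emeasure_matrix_box_finite[of "real R + 1", where 'k = "'m + 'n" and 'n = 'n] by (cases rule: ennreal_cases) auto
    define D where "D = (2 * real ?m * 3 ^ (?m - 1)) * (2 * real R + 1) ^ ?n * (M * 2 ^ ?n)"
    have bound: "emeasure lborel (E R j) \<le> ennreal (D * (real j ^ (?m - 1) * \<psi> j ^ ?n))" if j: "j \<ge> 1" for j
    proof -
      have \<psi>j: "\<psi> j > 0" using pos j by simp
      have st: "emeasure lborel (St R q p) \<le> ennreal (M * (2 * \<psi> j / real j) ^ ?n)" if "q \<in> Q j" for q p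
      proof -
        obtain l where l: "int (int_supnorm q) = \<bar>q $ l\<bar>" using int_supnorm_attained by blast
        have v: "\<bar>real_vec (stack q p) $ Inl l\<bar> = real j"
          using l that by (simp add: real_vec_def stack_def Q_def)
        have "emeasure lborel (St R q p) \<le> ennreal M * ennreal ((2 * \<psi> j / \<bar>real_vec (stack q p) $ Inl l\<bar>) ^ ?n)"
        proof -
          have "real_vec (stack q p) $ Inl l \<noteq> 0" using v j by auto
          moreover have "int_supnorm q = j" using that by (simp add: Q_def)
          ultimately show ?thesis
            using emeasure_strip_le[of "real_vec (stack q p)" "Inl l" "\<psi> j" "real R" y] \<psi>j
            unfolding M(1)[symmetric] St_def by simp
        qed
        then show ?thesis unfolding v using M(2) \<psi>j by (simp add: ennreal_mult)
      qed
      have "emeasure lborel (E R j) \<le> (\<Sum>q\<in>Q j. emeasure lborel (\<Union>p\<in>P R j. St R q p))"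
        unfolding E_def using j fin by (auto intro!: emeasure_subadditive_finite sets.finite_UN)
      also have "\<dots> \<le> (\<Sum>q\<in>Q j. \<Sum>p\<in>P R j. emeasure lborel (St R q p))"
        using fin by (intro sum_mono emeasure_subadditive_finite) auto
      also have "\<dots> \<le> (\<Sum>q\<in>Q j. \<Sum>p\<in>P R j. ennreal (M * (2 * \<psi> j / real j) ^ ?n))"
        by (intro sum_mono st)
      also have "\<dots> = ennreal (real (card (Q j)) * (real (card (P R j)) * (M * (2 * \<psi> j / real j) ^ ?n)))"
        using M(2) \<psi>j by (simp add: ennreal_mult ennreal_of_nat_eq_real_of_nat)
      also have "\<dots> \<le> ennreal (D * (real j ^ (?m - 1) * \<psi> j ^ ?n))"
      proof (intro ennreal_leI)
        have "real (card (P R j)) \<le> (2 * real (R * j) + 1) ^ ?n" unfolding P_def by (rule card_int_supnorm_le)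
        also have "\<dots> \<le> ((2 * real R + 1) * real j) ^ ?n"
          using j by (intro power_mono) (auto simp: algebra_simps)
        finally have P: "real (card (P R j)) \<le> ((2 * real R + 1) * real j) ^ ?n" .
        have Qc: "real (card (Q j)) \<le> 2 * real ?m * (3 * real j) ^ (?m - 1)"
          unfolding Q_def using j by (rule card_int_supnorm_eq)
        have "real (card (Q j)) * (real (card (P R j)) * (M * (2 * \<psi> j / real j) ^ ?n))
          \<le> (2 * real ?m * (3 * real j) ^ (?m - 1)) * (((2 * real R + 1) * real j) ^ ?n * (M * (2 * \<psi> j / real j) ^ ?n))"
          using P Qc M(2) \<psi>j by (intro mult_mono mult_nonneg_nonneg) auto
        also have "\<dots> = D * (real j ^ (?m - 1) * \<psi> j ^ ?n)"
          using j by (simp add: D_def power_mult_distrib power_divide)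
        finally show "real (card (Q j)) * (real (card (P R j)) * (M * (2 * \<psi> j / real j) ^ ?n)) \<le> D * (real j ^ (?m - 1) * \<psi> j ^ ?n)" .
      qed
      finally show ?thesis .
    qed
    have D0: "D \<ge> 0" using M(2) by (simp add: D_def)
    show ?thesis
    proof (rule borel_cantelli_AE1)
      fix j
      show "E R j \<in> sets lborel" by simp
      show "emeasure lborel (E R j) < \<infinity>"
      proof (cases "j = 0")
        case False then show ?thesis using bound[of j] by (simp add: le_less_trans)
      qed (simp add: E_def)
    next
      define f where "f j = (if j = 0 then 0 else real j ^ (?m - 1) * \<psi> j ^ ?n)" for j
      have f0: "f j \<ge> 0" for j using pos[of j] by (simp add: f_def Suc_le_eq less_imp_le)
      have "f summable_on {1..}" by (rule summable_on_cong[THEN iffD1, OF _ conv]) (auto simp: f_def)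
      moreover have "f summable_on {0}" by simp
      ultimately have "f summable_on ({1..} \<union> {0})" by (rule summable_on_union)
      moreover have "{1..} \<union> {0} = (UNIV :: nat set)" by auto
      ultimately have "summable f" using f0 by (simp add: summable_on_UNIV_nonneg_real_iff)
      then have "summable (\<lambda>j. D * f j)" by (rule summable_mult)
      then show "summable (\<lambda>j. measure lborel (E R j))"
      proof (rule summable_comparison_test'[where N = 0])
        fix j :: nat
        have "measure lborel (E R j) \<le> D * f j"
        proof (cases "j = 0")
          case False
          then have "emeasure lborel (E R j) \<le> ennreal (D * f j)" using bound[of j] by (simp add: f_def)
          then show ?thesis using D0 f0[of j] unfolding measure_def by (simp add: enn2real_leI)
        qed (simp add: E_def f_def)
        then show "norm (measure lborel (E R j)) \<le> D * f j" by simp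
      qed
    qed
  qed
  then have "AE X in lborel. \<forall>R. eventually (\<lambda>j. X \<notin> E R j) sequentially"
    by (simp add: AE_all_countable)
  moreover have "AE X :: real ^ ('m + 'n) ^ 'n in lborel. det (Phi X) \<noteq> 0"
    using negligible_det_Phi_zero by (simp add: AE_lborel_iff_negligible)
  ultimately show ?thesis
  proof eventually_elim
    case (elim X)
    \<comment> \<open>Monotonicity is only known for the product with j^(m-1); that factor is at
      least 1, and equals 1 at j = 1.\<close>
    have \<psi>1: "\<psi> j \<le> \<psi> 1" if "j \<ge> 1" for j
    proof -
      have "\<psi> j ^ ?n * 1 \<le> \<psi> j ^ ?n * real j ^ (?m - 1)"
        using that pos[OF that] by (intro mult_left_mono) (auto intro!: one_le_power)
      also have "\<dots> \<le> \<psi> 1 ^ ?n" using monotone_onD[OF mono, of 1 j] that by (simp add: mult.commute)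
      finally have "\<psi> j ^ ?n \<le> \<psi> 1 ^ ?n" by simp
      then show ?thesis using pos[of 1] pos[OF that] by (simp add: power_mono_iff)
    qed
    obtain C where C: "\<And>q p. q \<noteq> 0 \<Longrightarrow> infnorm (Theta X *v real_vec q + Phi X *v real_vec p - y) \<le> \<psi> (int_supnorm q)
     \<Longrightarrow> real (int_supnorm p) \<le> C * real (int_supnorm q)"
      using solution_height_bound[of X \<psi> "\<psi> 1" y, OF elim(2)] \<psi>1 by blast
    define R where "R = nat \<lceil>max C (norm X)\<rceil>"
    have RC: "C \<le> real R" "norm X \<le> real R" unfolding R_def by linarith+
    have XR: "X \<in> matrix_box (real R)"
      unfolding matrix_box_def
    proof (intro CollectI allI)
      fix i k
      have "\<bar>X $ i $ k\<bar> \<le> norm (X $ i)" by (rule component_le_norm_cart)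
      also have "\<dots> \<le> norm X" by (rule Finite_Cartesian_Product.norm_nth_le)
      finally show "\<bar>X $ i $ k\<bar> \<le> real R" using RC by linarith
    qed
    obtain J where J: "\<And>j. j \<ge> J \<Longrightarrow> X \<notin> E R j"
      using elim(1) unfolding eventually_sequentially by blast
    have "{(q, p). q \<noteq> 0 \<and> infnorm (Theta X *v real_vec q + Phi X *v real_vec p - y) \<le> \<psi> (int_supnorm q)}
      \<subseteq> {q. int_supnorm q \<le> J} \<times> {p. int_supnorm p \<le> R * J}"
    proof
      fix v assume v: "v \<in> {(q, p). q \<noteq> 0 \<and> infnorm (Theta X *v real_vec q + Phi X *v real_vec p - y) \<le> \<psi> (int_supnorm q)}"
      obtain q p where qp: "v = (q, p)" by fastforce
      with v have q: "q \<noteq> 0" and le: "infnorm (Theta X *v real_vec q + Phi X *v real_vec p - y) \<le> \<psi> (int_supnorm q)"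
        by auto
      have "real (int_supnorm p) \<le> real R * real (int_supnorm q)"
        using C[OF q le] RC(1) by (meson mult_right_mono of_nat_0_le_iff order_trans)
      then have p: "int_supnorm p \<le> R * int_supnorm q" by (metis of_nat_le_iff of_nat_mult)
      have "X \<in> St R q p"
        using le XR unfolding Theta_Phi_stack infnorm_vec_le_iff St_def by simp
      then have "X \<in> E R (int_supnorm q)"
        using int_supnorm_ge_1[OF q] p unfolding E_def Q_def P_def by auto
      then have "int_supnorm q < J" using J by (meson not_le)
      moreover from this have "int_supnorm p \<le> R * J"
        using order_trans[OF p mult_le_mono2[of "int_supnorm q" J R]] by simp
      ultimately show "v \<in> {q. int_supnorm q \<le> J} \<times> {p. int_supnorm p \<le> R * J}"
        by (simp add: qp)
    qed
    then show ?case by (rule finite_subset) (intro finite_cartesian_product finite_int_supnorm_le)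
  qed
qed

lemma AE_all_scalings:
  assumes "\<And>k. k > 0 \<Longrightarrow> AE Z in lborel. infinite (solutions \<pi> (\<lambda>j. \<psi> j / real k) (f Z) (mat 1) (g Z))"
  shows "AE Z in lborel. well_approximable \<pi> \<psi> (f Z) (mat 1) (g Z)"
  unfolding well_approximable_def AE_all_countable
proof
  fix k :: nat
  show "AE Z in lborel. 0 < k \<longrightarrow> infinite (solutions \<pi> (\<lambda>j. \<psi> j / real k) (f Z) (mat 1) (g Z))"
    using assms[of k] by (cases "k = 0") auto
qed

theorem AE_well_approximable:
  fixes \<pi> :: "('m::finite + 'n::finite) set set" and \<psi> :: "nat \<Rightarrow> real" and y :: "real ^ 'n"
  assumes partition: "partition_on UNIV \<pi>"
    and components: "\<And>B. B \<in> \<pi> \<Longrightarrow> card B \<ge> CARD('n) + 1"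
    and pos: "\<And>j. j \<ge> 1 \<Longrightarrow> \<psi> j > 0"
    and mono: "antimono_on {1..} (\<lambda>x. real x ^ (CARD('m) - 1) * \<psi> x ^ CARD('n))"
    and div: "\<not> (\<lambda>j. real j ^ (CARD('m) - 1) * \<psi> j ^ CARD('n)) summable_on {1..}"
  shows "AE X in lborel. well_approximable \<pi> \<psi> (Theta X) (Phi X) y"
proof -
  obtain lam :: "'m + 'n \<Rightarrow> 'm" where
    lead: "\<And>B. B \<in> \<pi> \<Longrightarrow> \<exists>i k. Inl i \<in> B \<and> k \<in> B \<and> k \<noteq> Inl i \<and> (\<forall>k\<in>B. lam k = i)"
    and idem: "\<And>k. lam (Inl (lam k)) = lam k"
    and nonlead: "CARD('m) \<ge> 2 \<Longrightarrow> \<exists>i. lam (Inl i) \<noteq> i"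
    using partition_leader[OF partition components] by blast
  have scaled: "antimono_on {1..} (\<lambda>x. real x ^ (CARD('m) - 1) * (\<psi> x / real k) ^ CARD('n))"
    "\<not> (\<lambda>j. real j ^ (CARD('m) - 1) * (\<psi> j / real k) ^ CARD('n)) summable_on {1..}"
    "\<And>j. j \<ge> 1 \<Longrightarrow> \<psi> j / real k > 0" if "k > 0" for k
    using antimono_on_scaled[OF mono div that] pos that by auto
  show ?thesis
  proof (cases "y = 0")
    case True
    have "AE \<Theta> in lborel. infinite (solutions \<pi> (\<lambda>j. \<psi> j / real k) \<Theta> (mat 1) 0)" if k: "k > 0" for k
    proof (cases "CARD('m) = 1")
      case True
      then show ?thesis
        using lead idem nonlead scaled[OF k] by (intro AE_infinite_solutions_homogeneous_one_column[of \<pi> lam])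
    next
      case False
      then have "CARD('m) \<ge> 2" using zero_less_card_finite[where 'a = 'm] by linarith
      then show ?thesis
        using lead idem nonlead scaled[OF k] by (intro AE_infinite_solutions_homogeneous_many_columns[of \<pi> lam])
    qed
    then show ?thesis unfolding True by (intro AE_well_approximable_homogeneous AE_all_scalings)
  next
    case False
    have "AE Z in lborel. infinite (solutions \<pi> (\<lambda>j. \<psi> j / real k) (left_cols Z) (mat 1) (last_col Z))" if k: "k > 0" for k
      using lead idem nonlead scaled[OF k] by (intro AE_infinite_solutions_inhomogeneous[of \<pi> lam])
    then show ?thesis using False by (intro AE_well_approximable_inhomogeneous AE_all_scalings)
  qed
qed

theorem theorem1p3:
  fixes \<pi> :: "('m::finite + 'n::finite) set set"
    and \<psi> :: "nat \<Rightarrow> real"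
  assumes partition: "partition_on UNIV \<pi>"
    and components: "\<And>B. B \<in> \<pi> \<Longrightarrow> card B \<ge> CARD('n) + 1"
    and psi_pos: "\<And>j. j \<ge> 1 \<Longrightarrow> \<psi> j > 0"
    and mono: "antimono_on {1..} (\<lambda>x. real x ^ (CARD('m) - 1) * \<psi> x ^ CARD('n))"
  shows "(\<not> (\<lambda>j. real j ^ (CARD('m) - 1) * \<psi> j ^ CARD('n)) summable_on {1..} \<longrightarrow>
           (\<forall>y :: real ^ 'n. AE X :: real ^ ('m + 'n) ^ 'n in lebesgue.
              infinite {(q :: int ^ 'm, p :: int ^ 'n).
                stack q p \<in> partition_points \<pi> \<and> q \<noteq> 0 \<and>
                infnorm (Theta X *v real_vec q + Phi X *v real_vec p - y) \<le> \<psi> (int_supnorm q)}))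
       \<and> ((\<lambda>j. real j ^ (CARD('m) - 1) * \<psi> j ^ CARD('n)) summable_on {1..} \<longrightarrow>
           (\<forall>y :: real ^ 'n. AE X :: real ^ ('m + 'n) ^ 'n in lebesgue.
              finite {(q :: int ^ 'm, p :: int ^ 'n).
                q \<noteq> 0 \<and>
                infnorm (Theta X *v real_vec q + Phi X *v real_vec p - y) \<le> \<psi> (int_supnorm q)}))"
proof (intro conjI impI allI)
  fix y :: "real ^ 'n"
  assume div: "\<not> (\<lambda>j. real j ^ (CARD('m) - 1) * \<psi> j ^ CARD('n)) summable_on {1..}"
  have "AE X in lborel. well_approximable \<pi> \<psi> (Theta X) (Phi X) y"
    by (rule AE_well_approximable[OF partition components psi_pos mono div])
  then have "AE X :: real ^ ('m + 'n) ^ 'n in lborel. infinite (solutions \<pi> \<psi> (Theta X) (Phi X) y)"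
    by eventually_elim (auto simp: well_approximable_def dest: spec[of _ 1])
  then show "AE X :: real ^ ('m + 'n) ^ 'n in lebesgue. infinite {(q :: int ^ 'm, p :: int ^ 'n).
      stack q p \<in> partition_points \<pi> \<and> q \<noteq> 0 \<and>
      infnorm (Theta X *v real_vec q + Phi X *v real_vec p - y) \<le> \<psi> (int_supnorm q)}"
    unfolding AE_completion_iff solutions_def .
next
  fix y :: "real ^ 'n"
  assume "(\<lambda>j. real j ^ (CARD('m) - 1) * \<psi> j ^ CARD('n)) summable_on {1..}"
  then show "AE X :: real ^ ('m + 'n) ^ 'n in lebesgue. finite {(q :: int ^ 'm, p :: int ^ 'n).
      q \<noteq> 0 \<and> infnorm (Theta X *v real_vec q + Phi X *v real_vec p - y) \<le> \<psi> (int_supnorm q)}"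
    unfolding AE_completion_iff using psi_pos mono by (intro AE_finite_solutions)
qed

end
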